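(* Let $\mathcal{S}$ be a linear binary constraint system with corresponding non-signalling game $\mathcal{G}_{\mathcal{S}}$ and solution group $\Gamma(\mathcal{S})$. The game C*-algebra $C^*(\mathcal{G}_{\mathcal{S}})$ is *-isomorphic to the quotient of the full group C*-algebra $C^*(\Gamma(\mathcal{S}))$ by the relation $J+1=0$, i.e. by the closed two-sided ideal generated by $J+1$.
   Context: Linear binary constraint system $\mathcal{S}$: a finite set $X$ of constraints in $\pm1$-valued variables $\lambda_1,\dots,\lambda_n$, each $x\in X$ being of the form $(-1)^{\rho_x}\prod_{i\in V_x}\lambda_i=1$ with $V_x\subseteq\{1,\dots,n\}$ and $\rho_x\in\{0,1\}$, such that every variable appears in some constraint (i.e. $\bigcup_{x\in X}V_x=\{1,\dots,n\}$). Solution group $\Gamma(\mathcal{S})$: the group generated by involutions $u_1,\dots,u_n,J$ subject to the relations: $J$ commutes with $u_1,\dots,u_n$; and, for each constraint $x\in X$, $u_iu_j=u_ju_i$ for all $i,j\in V_x$ and $J^{\rho_x}\prod_{k\in V_x}u_k=1$. $\Gamma(\mathcal{S})$ is identified with a subgroup of the unitary group of its full group C*-algebra $C^*(\Gamma(\mathcal{S}))$. The game $\mathcal{G}_{\mathcal{S}}=(X,Y,A,B,\lambda)$: $X$ is the set of constraints, $Y=\{1,\dots,n\}$, $V_y=\{y\}$ for $y\in Y$, and $A=B$ is the set of all tuples $(a_i)_{i\in V}$ with $V\subseteq\{1,\dots,n\}$ and $a_i\in\{+1,-1\}$. The payoff function $\lambda:X\times Y\times A\times B\to\{0,1\}$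 is given as follows. For $x\in X$ and $j\in V_x$, where $x$ is the constraint $(-1)^{\rho_x}\prod_{i\in V_x}\lambda_i=1$, one has $\lambda(x,j,(a_i)_{i\in V_x},a_j)=1$ if and only if $(-1)^{\rho_x}\prod_{i\in V_x}a_i=1$ (here Bob's answer $a_j$ is regarded as a tuple indexed by $V_j=\{j\}$). In all other cases $\lambda=0$: a pair of answers to $(x,j)$ is acceptable only if $j\in V_x$, Alice's answer is a tuple indexed by $V_x$ satisfying the constraint $x$, and Bob's answer is the $j$-th entry of Alice's answer. The game C*-algebra $C^*(\mathcal{G})$ of a game $\mathcal{G}=(X,Y,A,B,\lambda)$ is the universal unital C*-algebra generated by projections $(p_{x,a})_{x\in X,a\in A}$ and $(q_{y,b})_{y\in Y,b\in B}$ satisfying $\sum_{a\in A}p_{x,a}=1$ for every $x\in X$, $\sum_{b\in B}q_{y,b}=1$ for every $y\in Y$, and $p_{x,a}q_{y,b}=0$ whenever $\lambda(x,y,a,b)=0$. The zero C*-algebra is regarded as a unital C*-algebra.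
   Formalization: For j not in V_x the payoff does not always vanish: a pair wins if Alice's tuple satisfies x and Bob's is indexed by {j}; with λ=0 there, C*(G_S)=0 whenever a constraint misses a variable, and the claim fails (λ_1=1, λ_2=1). Also n≥1 is assumed. *)

theory Defs
  imports "HOL-Analysis.Analysis" "HOL-Algebra.QuotRing"
begin

section \<open>Unital *-algebras with explicit carriers\<close>

text \<open>Rings, ideals, quotient rings and ring isomorphisms are those of HOL-Algebra, which allows
  the zero ring.\<close>

record 'a star_algebra = "'a ring" +
  scal :: "complex \<Rightarrow> 'a \<Rightarrow> 'a"
  adj :: "'a \<Rightarrow> 'a"

record 'a normed_star_algebra = "'a star_algebra" +
  nrm :: "'a \<Rightarrow> real"

definition star_isomorphic ::
    "('a, 'm) star_algebra_scheme \<Rightarrow> ('b, 'n) star_algebra_scheme \<Rightarrow> bool" where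
  "star_isomorphic A B \<longleftrightarrow>
     (\<exists>h \<in> ring_iso A B.
        (\<forall>c. \<forall>a \<in> carrier A. h (scal A c a) = scal B c (h a)) \<and>
        (\<forall>a \<in> carrier A. h (adj A a) = adj B (h a)))"

definition induced_on_cosets ::
    "('a, 'm) ring_scheme \<Rightarrow> 'a set \<Rightarrow> ('a \<Rightarrow> 'a) \<Rightarrow> 'a set \<Rightarrow> 'a set" where
  "induced_on_cosets A I f C = (\<Union>a\<in>C. I +>\<^bsub>A\<^esub> f a)"

text \<open>A coset \<open>C = I + a\<close> gets the quotient norm, the infimum of the norms of its members.\<close>

definition star_quotient ::
    "'a normed_star_algebra \<Rightarrow> 'a set \<Rightarrow> 'a set normed_star_algebra" where
  "star_quotient A I = ring.extend (FactRing A I)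
     \<lparr>scal = (\<lambda>c. induced_on_cosets A I (scal A c)),
      adj = induced_on_cosets A I (adj A),
      nrm = (\<lambda>C. Inf (nrm A ` C))\<rparr>"

definition norm_closed :: "'a normed_star_algebra \<Rightarrow> 'a set \<Rightarrow> bool" where
  "norm_closed A S \<longleftrightarrow>
     (\<forall>a \<in> carrier A. (\<forall>e>0. \<exists>s\<in>S. nrm A (a \<ominus>\<^bsub>A\<^esub> s) < e) \<longrightarrow> a \<in> S)"

definition closed_ideal_generated :: "'a normed_star_algebra \<Rightarrow> 'a set \<Rightarrow> 'a set" where
  "closed_ideal_generated A S = \<Inter>{I. ideal I A \<and> norm_closed A I \<and> S \<subseteq> I}"

section \<open>Completions\<close>

text \<open>The separated completion of a *-algebra in a seminorm \<open>p\<close>: Cauchy sequences modulo null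
  sequences. The seminorm of a Cauchy sequence is the limit of its values under \<open>p\<close>, and
  this is constant on cosets of the null sequences.\<close>

definition cauchy_algebra ::
    "'a star_algebra \<Rightarrow> ('a \<Rightarrow> real) \<Rightarrow> (nat \<Rightarrow> 'a) normed_star_algebra" where
  "cauchy_algebra A p =
     \<lparr>carrier = {s. (\<forall>n. s n \<in> carrier A) \<and>
                    (\<forall>e>0. \<exists>N. \<forall>m\<ge>N. \<forall>n\<ge>N. p (s m \<ominus>\<^bsub>A\<^esub> s n) < e)},
      mult = (\<lambda>s t n. s n \<otimes>\<^bsub>A\<^esub> t n),
      one = (\<lambda>n. \<one>\<^bsub>A\<^esub>),
      zero = (\<lambda>n. \<zero>\<^bsub>A\<^esub>),
      add = (\<lambda>s t n. s n \<oplus>\<^bsub>A\<^esub> t n),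
      scal = (\<lambda>c s n. scal A c (s n)),
      adj = (\<lambda>s n. adj A (s n)),
      nrm = (\<lambda>s. lim (\<lambda>n. p (s n)))\<rparr>"

definition null_sequences :: "'a star_algebra \<Rightarrow> ('a \<Rightarrow> real) \<Rightarrow> (nat \<Rightarrow> 'a) set" where
  "null_sequences A p = {s. (\<forall>n. s n \<in> carrier A) \<and> (\<lambda>n. p (s n)) \<longlonglongrightarrow> 0}"

definition completion ::
    "'a star_algebra \<Rightarrow> ('a \<Rightarrow> real) \<Rightarrow> (nat \<Rightarrow> 'a) set normed_star_algebra" where
  "completion A p = star_quotient (cauchy_algebra A p) (null_sequences A p)"

definition to_completion :: "'a star_algebra \<Rightarrow> ('a \<Rightarrow> real) \<Rightarrow> 'a \<Rightarrow> (nat \<Rightarrow> 'a) set" where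
  "to_completion A p a = null_sequences A p +>\<^bsub>cauchy_algebra A p\<^esub> (\<lambda>n. a)"

section \<open>Universal C*-algebras\<close>

definition cstar_seminorm :: "'a star_algebra \<Rightarrow> ('a \<Rightarrow> real) \<Rightarrow> bool" where
  "cstar_seminorm A p \<longleftrightarrow>
     (\<forall>a \<in> carrier A. 0 \<le> p a) \<and>
     (\<forall>a \<in> carrier A. \<forall>b \<in> carrier A. p (a \<oplus>\<^bsub>A\<^esub> b) \<le> p a + p b) \<and>
     (\<forall>c. \<forall>a \<in> carrier A. p (scal A c a) = cmod c * p a) \<and>
     (\<forall>a \<in> carrier A. \<forall>b \<in> carrier A. p (a \<otimes>\<^bsub>A\<^esub> b) \<le> p a * p b) \<and>
     (\<forall>a \<in> carrier A. p (adj A a \<otimes>\<^bsub>A\<^esub> a) = (p a)\<^sup>2)"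

text \<open>The C*-seminorms on \<open>A\<close> vanishing on \<open>R\<close> are exactly the functions
  \<open>a \<mapsto> \<parallel>\<pi> a\<parallel>\<close> for the unital *-homomorphisms \<open>\<pi>\<close> from \<open>A\<close> to C*-algebras with
  \<open>\<pi> R = 0\<close> (the zero algebra gives the seminorm \<open>0\<close>). Their supremum is finite whenever
  \<open>A\<close> is generated by elements that \<open>R\<close> forces to be partial isometries, as in both uses
  below; the completion is then the universal C*-algebra of \<open>A\<close> modulo \<open>R\<close>.\<close>

definition universal_seminorm :: "'a star_algebra \<Rightarrow> 'a set \<Rightarrow> 'a \<Rightarrow> real" where
  "universal_seminorm A R a = Sup {p a | p. cstar_seminorm A p \<and> (\<forall>r\<in>R. p r = 0)}"

definition universal_cstar ::
    "'a star_algebra \<Rightarrow> 'a set \<Rightarrow> (nat \<Rightarrow> 'a) set normed_star_algebra" where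
  "universal_cstar A R = completion A (universal_seminorm A R)"

section \<open>Monoid *-algebras, free *-algebras and group C*-algebras\<close>

text \<open>The complex monoid algebra of \<open>M\<close>, with the involution that extends an involutive
  anti-automorphism \<open>\<tau>\<close> of \<open>M\<close> conjugate-linearly.\<close>

definition monoid_algebra ::
    "('m, 'k) monoid_scheme \<Rightarrow> ('m \<Rightarrow> 'm) \<Rightarrow> ('m \<Rightarrow> complex) star_algebra" where
  "monoid_algebra M \<tau> =
     \<lparr>carrier = {f. finite {m. f m \<noteq> 0} \<and> {m. f m \<noteq> 0} \<subseteq> carrier M},
      mult = (\<lambda>f g m. \<Sum>(k, l) \<in> {(k, l). f k \<noteq> 0 \<and> g l \<noteq> 0 \<and> k \<otimes>\<^bsub>M\<^esub> l = m}. f k * g l),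
      one = (\<lambda>m. of_bool (m = \<one>\<^bsub>M\<^esub>)),
      zero = (\<lambda>m. 0),
      add = (\<lambda>f g m. f m + g m),
      scal = (\<lambda>c f m. c * f m),
      adj = (\<lambda>f m. if m \<in> carrier M then cnj (f (\<tau> m)) else 0)\<rparr>"

definition basis_element :: "'m \<Rightarrow> 'm \<Rightarrow> complex" where
  "basis_element m = (\<lambda>k. of_bool (k = m))"

text \<open>A letter \<open>(g, True)\<close> stands for the generator \<open>g\<close>; \<open>(g, False)\<close> stands for its adjoint
  in free *-algebras and for its inverse in group presentations.\<close>

type_synonym 'g word = "('g \<times> bool) list"

definition words :: "'g set \<Rightarrow> 'g word set" where
  "words G = lists (G \<times> UNIV)"

definition reverse_word :: "'g word \<Rightarrow> 'g word" where
  "reverse_word w = rev (map (\<lambda>(g, e). (g, \<not> e)) w)"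

definition word_monoid :: "'g set \<Rightarrow> 'g word monoid" where
  "word_monoid G = \<lparr>carrier = words G, mult = (@), one = []\<rparr>"

definition free_star_algebra :: "'g set \<Rightarrow> ('g word \<Rightarrow> complex) star_algebra" where
  "free_star_algebra G = monoid_algebra (word_monoid G) reverse_word"

definition generator :: "'g \<Rightarrow> 'g word \<Rightarrow> complex" where
  "generator g = basis_element [(g, True)]"

definition group_algebra :: "('m, 'k) monoid_scheme \<Rightarrow> ('m \<Rightarrow> complex) star_algebra" where
  "group_algebra G = monoid_algebra G (\<lambda>g. inv\<^bsub>G\<^esub> g)"

definition group_cstar ::
    "('m, 'k) monoid_scheme \<Rightarrow> (nat \<Rightarrow> 'm \<Rightarrow> complex) set normed_star_algebra" where
  "group_cstar G = universal_cstar (group_algebra G) {}"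

definition group_unitary ::
    "('m, 'k) monoid_scheme \<Rightarrow> 'm \<Rightarrow> (nat \<Rightarrow> 'm \<Rightarrow> complex) set" where
  "group_unitary G g =
     to_completion (group_algebra G) (universal_seminorm (group_algebra G) {}) (basis_element g)"

section \<open>Groups given by generators and relations\<close>

inductive_set word_congruence :: "'g set \<Rightarrow> ('g word \<times> 'g word) set \<Rightarrow> ('g word \<times> 'g word) set"
  for G :: "'g set" and R :: "('g word \<times> 'g word) set" where
  refl: "w \<in> words G \<Longrightarrow> (w, w) \<in> word_congruence G R"
| sym: "(v, w) \<in> word_congruence G R \<Longrightarrow> (w, v) \<in> word_congruence G R"
| trans: "(u, v) \<in> word_congruence G R \<Longrightarrow> (v, w) \<in> word_congruence G R \<Longrightarrow>
    (u, w) \<in> word_congruence G R"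
| cancel: "v \<in> words G \<Longrightarrow> w \<in> words G \<Longrightarrow> g \<in> G \<Longrightarrow>
    (v @ [(g, e), (g, \<not> e)] @ w, v @ w) \<in> word_congruence G R"
| relation: "v \<in> words G \<Longrightarrow> w \<in> words G \<Longrightarrow> (l, r) \<in> R \<Longrightarrow> l \<in> words G \<Longrightarrow> r \<in> words G \<Longrightarrow>
    (v @ l @ w, v @ r @ w) \<in> word_congruence G R"

definition word_class ::
    "'g set \<Rightarrow> ('g word \<times> 'g word) set \<Rightarrow> 'g word \<Rightarrow> 'g word set" where
  "word_class G R w = word_congruence G R `` {w}"

definition presented_group ::
    "'g set \<Rightarrow> ('g word \<times> 'g word) set \<Rightarrow> 'g word set monoid" where
  "presented_group G R =
     \<lparr>carrier = words G // word_congruence G R,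
      mult = (\<lambda>C D. \<Union>v\<in>C. \<Union>w\<in>D. word_class G R (v @ w)),
      one = word_class G R []\<rparr>"

section \<open>Games and their C*-algebras\<close>

record ('x, 'y, 'a, 'b) game =
  alice_questions :: "'x set"
  bob_questions :: "'y set"
  alice_answers :: "'a set"
  bob_answers :: "'b set"
  wins :: "'x \<Rightarrow> 'y \<Rightarrow> 'a \<Rightarrow> 'b \<Rightarrow> bool"

datatype ('x, 'y, 'a, 'b) game_gen = PGen 'x 'a | QGen 'y 'b

definition game_gens :: "('x, 'y, 'a, 'b) game \<Rightarrow> ('x, 'y, 'a, 'b) game_gen set" where
  "game_gens \<G> =
     {PGen x a | x a. x \<in> alice_questions \<G> \<and> a \<in> alice_answers \<G>} \<union>
     {QGen y b | y b. y \<in> bob_questions \<G> \<and> b \<in> bob_answers \<G>}"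

definition game_free_algebra ::
    "('x, 'y, 'a, 'b) game \<Rightarrow> (('x, 'y, 'a, 'b) game_gen word \<Rightarrow> complex) star_algebra" where
  "game_free_algebra \<G> = free_star_algebra (game_gens \<G>)"

text \<open>A relation \<open>s = t\<close> is represented by the element \<open>s - t\<close>.\<close>

definition game_relators ::
    "('x, 'y, 'a, 'b) game \<Rightarrow> (('x, 'y, 'a, 'b) game_gen word \<Rightarrow> complex) set" where
  "game_relators \<G> = (let F = game_free_algebra \<G> in
     {generator g \<otimes>\<^bsub>F\<^esub> generator g \<ominus>\<^bsub>F\<^esub> generator g | g. g \<in> game_gens \<G>} \<union>
     {adj F (generator g) \<ominus>\<^bsub>F\<^esub> generator g | g. g \<in> game_gens \<G>} \<union>
     {(\<Oplus>\<^bsub>F\<^esub>a\<in>alice_answers \<G>. generator (PGen x a)) \<ominus>\<^bsub>F\<^esub> \<one>\<^bsub>F\<^esub> | x.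
        x \<in> alice_questions \<G>} \<union>
     {(\<Oplus>\<^bsub>F\<^esub>b\<in>bob_answers \<G>. generator (QGen y b)) \<ominus>\<^bsub>F\<^esub> \<one>\<^bsub>F\<^esub> | y.
        y \<in> bob_questions \<G>} \<union>
     {generator (PGen x a) \<otimes>\<^bsub>F\<^esub> generator (QGen y b) | x y a b.
        x \<in> alice_questions \<G> \<and> y \<in> bob_questions \<G> \<and>
        a \<in> alice_answers \<G> \<and> b \<in> bob_answers \<G> \<and> \<not> wins \<G> x y a b})"

definition game_cstar ::
    "('x, 'y, 'a, 'b) game \<Rightarrow>
     (nat \<Rightarrow> ('x, 'y, 'a, 'b) game_gen word \<Rightarrow> complex) set normed_star_algebra" where
  "game_cstar \<G> = universal_cstar (game_free_algebra \<G>) (game_relators \<G>)"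

section \<open>Linear binary constraint systems\<close>

text \<open>The element \<open>x\<close> of \<open>constraints S\<close> labels the constraint
  \<open>(-1) ^ parity S x * (\<Prod>i \<in> vars S x. \<lambda>\<^sub>i) = 1\<close>.\<close>

record 'x constraint_system =
  num_vars :: nat
  constraints :: "'x set"
  vars :: "'x \<Rightarrow> nat set"
  parity :: "'x \<Rightarrow> nat"

text \<open>There is at least one variable: otherwise Bob has no question, no payoff relation exists,
  and the unsatisfiable constraint \<open>-1 = 1\<close> would go unnoticed by the game.\<close>

definition linear_bcs :: "'x constraint_system \<Rightarrow> bool" where
  "linear_bcs S \<longleftrightarrow>
     0 < num_vars S \<and>
     finite (constraints S) \<and>
     (\<forall>x \<in> constraints S. parity S x \<in> {0, 1}) \<and>
     (\<Union>x \<in> constraints S. vars S x) = {1..num_vars S}"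

datatype sol_gen = UGen nat | JGen

definition sol_gens :: "'x constraint_system \<Rightarrow> sol_gen set" where
  "sol_gens S = insert JGen (UGen ` {1..num_vars S})"

definition sol_relations :: "'x constraint_system \<Rightarrow> (sol_gen word \<times> sol_gen word) set" where
  "sol_relations S = (let u = (\<lambda>i. (UGen i, True)); J = (JGen, True) in
     {([u i, u i], []) | i. i \<in> {1..num_vars S}} \<union>
     {([J, J], [])} \<union>
     {([J, u i], [u i, J]) | i. i \<in> {1..num_vars S}} \<union>
     {([u i, u j], [u j, u i]) | i j. \<exists>x \<in> constraints S. i \<in> vars S x \<and> j \<in> vars S x} \<union>
     {(replicate (parity S x) J @ map u (sorted_list_of_set (vars S x)), []) | x.
        x \<in> constraints S})"

definition solution_group :: "'x constraint_system \<Rightarrow> sol_gen word set monoid" where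
  "solution_group S = presented_group (sol_gens S) (sol_relations S)"

definition sol_J :: "'x constraint_system \<Rightarrow> sol_gen word set" where
  "sol_J S = word_class (sol_gens S) (sol_relations S) [(JGen, True)]"

text \<open>A tuple \<open>(a\<^sub>i)\<close> indexed by \<open>V\<close> is a map with domain \<open>V\<close>.\<close>

definition sign_tuples :: "nat \<Rightarrow> (nat \<rightharpoonup> int) set" where
  "sign_tuples n = {a. dom a \<subseteq> {1..n} \<and> ran a \<subseteq> {1, -1}}"

definition satisfies :: "'x constraint_system \<Rightarrow> 'x \<Rightarrow> (nat \<rightharpoonup> int) \<Rightarrow> bool" where
  "satisfies S x a \<longleftrightarrow>
     dom a = vars S x \<and> (-1) ^ parity S x * (\<Prod>i \<in> vars S x. the (a i)) = 1"

text \<open>If \<open>j \<in> vars S x\<close>, then a pair of answers wins on \<open>(x, j)\<close> iff Alice's answer is a tuple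
  indexed by \<open>vars S x\<close> that satisfies \<open>x\<close> and Bob's is its \<open>j\<close>-th entry. If \<open>j\<close> does not occur
  in \<open>x\<close>, there is no \<open>j\<close>-th entry to compare with, and only this comparison is dropped. Letting
  all answers lose on such a pair would be wrong: for every game in which all answers lose on
  some \<open>(x, y)\<close>, the relations give
  \<open>1 = (\<Sum>a. p x a) * (\<Sum>b. q y b) = (\<Sum>a b. p x a * q y b) = 0\<close>,
  so \<open>C*(\<G>)\<close> is zero.\<close>

definition lcs_wins ::
    "'x constraint_system \<Rightarrow> 'x \<Rightarrow> nat \<Rightarrow> (nat \<rightharpoonup> int) \<Rightarrow> (nat \<rightharpoonup> int) \<Rightarrow> bool" where
  "lcs_wins S x j a b \<longleftrightarrow>
     satisfies S x a \<and> dom b = {j} \<and> (j \<in> vars S x \<longrightarrow> b j = a j)"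

definition lcs_game ::
    "'x constraint_system \<Rightarrow> ('x, nat, nat \<rightharpoonup> int, nat \<rightharpoonup> int) game" where
  "lcs_game S =
     \<lparr>alice_questions = constraints S,
      bob_questions = {1..num_vars S},
      alice_answers = sign_tuples (num_vars S),
      bob_answers = sign_tuples (num_vars S),
      wins = lcs_wins S\<rparr>"

end

theory Submission
  imports Defs
begin

text \<open>
  Write \<open>\<Gamma>\<close> for the solution group, \<open>A\<close> for its complex group algebra and \<open>F\<close> for the free
  *-algebra on the generators of the game, with the universal C*-seminorms \<open>\<tau>\<close> of \<open>A\<close> and \<open>\<sigma>\<close> of
  \<open>F\<close> modulo the relations of the game. The quotient by \<open>J + 1 = 0\<close> is a corner: \<open>J\<close> is a central
  involution, \<open>e = (1 - J) / 2\<close> is a central projection, and the closed ideal generated by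
  \<open>J + 1 = 2 (1 - e)\<close> is the annihilator of \<open>e\<close> (\<open>closed_ideal_generated_central\<close>). So the
  quotient is the completion of \<open>e A\<close>.

  From solutions to strategies: commuting involutions \<open>u\<^sub>i\<close> have joint spectral projections. The
  *-homomorphism \<open>\<phi> : F \<rightarrow> A\<close> sends Alice's generator \<open>p\<^sub>x\<^sub>,\<^sub>a\<close> to \<open>\<Prod>\<^sub>i (1 + a\<^sub>i u\<^sub>i) / 2\<close>, the
  product taken over the variables \<open>i\<close> of \<open>x\<close>, if \<open>a\<close> is indexed by these variables, and to \<open>0\<close>
  otherwise; Bob's generators are treated alike with the single variable \<open>y\<close>. In the corner, where
  \<open>J = -1\<close>, the projections of answers that violate a constraint vanish, so \<open>f \<mapsto> e \<phi>(f)\<close> kills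
  the relations of the game (\<open>game_hom_relator\<close>).

  From strategies to solutions: if \<open>p\<close> and \<open>q\<close> satisfy the relations of the game in some
  *-algebra, then \<open>u\<^sub>i = q\<^sub>i\<^sub>,\<^sub>1 - q\<^sub>i\<^sub>,\<^sub>-\<^sub>1\<close> and \<open>J = -1\<close> satisfy those of \<open>\<Gamma>\<close>, and the \<open>p\<close> and
  \<open>q\<close> are the spectral projections of the \<open>u\<^sub>i\<close>. The point is that \<open>p\<^sub>x\<^sub>,\<^sub>a u\<^sub>i = a\<^sub>i p\<^sub>x\<^sub>,\<^sub>a\<close> for the
  variables \<open>i\<close> of \<open>x\<close> (\<open>p_eigen\<close>). As \<open>\<Sum>\<^sub>a p\<^sub>x\<^sub>,\<^sub>a = 1\<close>, an equation may be checked after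
  multiplication by each \<open>p\<^sub>x\<^sub>,\<^sub>a\<close> (\<open>p_separates\<close>), where it becomes an identity between signs.
  Applied in the game C*-algebra, this gives a *-homomorphism \<open>\<psi>\<close> on \<open>A\<close> such that \<open>\<psi>(e) = 1\<close> and
  \<open>\<psi> \<circ> \<phi>\<close> is the canonical map of \<open>F\<close>.

  Comparing universal seminorms along \<open>\<phi>\<close> and \<open>\<psi>\<close> yields \<open>\<sigma> f = \<tau> (e \<phi>(f))\<close>
  (\<open>corner_seminorm_le\<close>, \<open>seminorm_le_corner\<close>), and \<open>f \<mapsto> e \<phi>(f)\<close> maps \<open>F\<close> onto \<open>e A\<close>
  (\<open>game_hom_onto_corner\<close>). Hence it induces an isomorphism of the completion of \<open>F\<close> with the
  completion of \<open>A\<close> modulo the annihilator of \<open>e\<close> (\<open>completion_iso_quotient_by_central\<close>).\<close>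

section \<open>*-algebras and *-homomorphisms\<close>

text \<open>The same axioms serve free and group algebras, algebras of Cauchy sequences and their quotients. The
  zero algebra is a model: it is the game C*-algebra if, for instance, \<open>-1 = 1\<close> is a constraint.\<close>

locale complex_star_algebra = ring A for A :: "('a, 'm) star_algebra_scheme" (structure) +
  assumes scal_closed [simp, intro]: "a \<in> carrier A \<Longrightarrow> scal A c a \<in> carrier A"
    and scal_add_right: "a \<in> carrier A \<Longrightarrow> b \<in> carrier A \<Longrightarrow>
      scal A c (a \<oplus> b) = scal A c a \<oplus> scal A c b"
    and scal_add_left: "a \<in> carrier A \<Longrightarrow> scal A (c + d) a = scal A c a \<oplus> scal A d a"
    and scal_scal [simp]: "a \<in> carrier A \<Longrightarrow> scal A c (scal A d a) = scal A (c * d) a"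
    and scal_1 [simp]: "a \<in> carrier A \<Longrightarrow> scal A 1 a = a"
    and mult_scal_left [simp]: "a \<in> carrier A \<Longrightarrow> b \<in> carrier A \<Longrightarrow>
      scal A c a \<otimes> b = scal A c (a \<otimes> b)"
    and mult_scal_right [simp]: "a \<in> carrier A \<Longrightarrow> b \<in> carrier A \<Longrightarrow>
      a \<otimes> scal A c b = scal A c (a \<otimes> b)"
    and adj_closed [simp, intro]: "a \<in> carrier A \<Longrightarrow> adj A a \<in> carrier A"
    and adj_add: "a \<in> carrier A \<Longrightarrow> b \<in> carrier A \<Longrightarrow> adj A (a \<oplus> b) = adj A a \<oplus> adj A b"
    and adj_mult: "a \<in> carrier A \<Longrightarrow> b \<in> carrier A \<Longrightarrow> adj A (a \<otimes> b) = adj A b \<otimes> adj A a"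
    and adj_adj [simp]: "a \<in> carrier A \<Longrightarrow> adj A (adj A a) = a"
    and adj_scal: "a \<in> carrier A \<Longrightarrow> adj A (scal A c a) = scal A (cnj c) (adj A a)"
begin

lemma scal_0_left [simp]: "a \<in> carrier A \<Longrightarrow> scal A 0 a = \<zero>"
  using scal_add_left[of a 0 0] by (metis add.l_cancel_one' add_0 scal_closed)

lemma scal_minus_1: "a \<in> carrier A \<Longrightarrow> scal A (-1) a = \<ominus> a"
  using scal_add_left[of a "-1" 1] by (simp add: minus_equality)

lemma scal_zero [simp]: "scal A c \<zero> = \<zero>"
  by (metis mult_zero_right scal_0_left scal_scal zero_closed)

lemma scal_minus: "a \<in> carrier A \<Longrightarrow> b \<in> carrier A \<Longrightarrow>
    scal A c (a \<ominus> b) = scal A c a \<ominus> scal A c b"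
  by (simp add: a_minus_def scal_add_right flip: scal_minus_1)

lemma adj_one [simp]: "adj A \<one> = \<one>"
  by (metis adj_adj adj_closed adj_mult l_one one_closed r_one)

lemma adj_zero [simp]: "adj A \<zero> = \<zero>"
  by (metis adj_closed adj_scal complex_cnj_zero scal_0_left zero_closed)

lemma adj_minus: "a \<in> carrier A \<Longrightarrow> b \<in> carrier A \<Longrightarrow> adj A (a \<ominus> b) = adj A a \<ominus> adj A b"
  by (simp add: a_minus_def adj_add adj_scal flip: scal_minus_1)

lemma minus_eq_zero_iff: "a \<in> carrier A \<Longrightarrow> b \<in> carrier A \<Longrightarrow> a \<ominus> b = \<zero> \<longleftrightarrow> a = b"
  by (metis a_minus_def add.inv_closed add.inv_inv minus_equality r_neg)

lemma minus_self: "a \<in> carrier A \<Longrightarrow> a \<ominus> a = \<zero>"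
  by (simp add: minus_eq_zero_iff)

lemma add_minus_cancel: "a \<in> carrier A \<Longrightarrow> b \<in> carrier A \<Longrightarrow> (a \<oplus> b) \<ominus> a = b"
  by algebra

lemma mult_minus_distrib: "a \<in> carrier A \<Longrightarrow> b \<in> carrier A \<Longrightarrow> c \<in> carrier A \<Longrightarrow>
    a \<otimes> (b \<ominus> c) = a \<otimes> b \<ominus> a \<otimes> c"
  by algebra

lemma minus_mult_distrib: "a \<in> carrier A \<Longrightarrow> b \<in> carrier A \<Longrightarrow> c \<in> carrier A \<Longrightarrow>
    (b \<ominus> c) \<otimes> a = b \<otimes> a \<ominus> c \<otimes> a"
  by algebra

lemma minus_zero_right [simp]: "a \<in> carrier A \<Longrightarrow> a \<ominus> \<zero> = a"
  by (simp add: a_minus_def)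

lemma finsum_scal: "(\<And>i. i \<in> K \<Longrightarrow> f i \<in> carrier A) \<Longrightarrow>
    (\<Oplus>i\<in>K. scal A c (f i)) = scal A c (\<Oplus>i\<in>K. f i)"
proof (induction K rule: infinite_finite_induct)
  case (insert x K)
  then show ?case by (simp add: Pi_def scal_add_right)
qed simp_all

end

definition star_hom :: "('a, 'm) star_algebra_scheme \<Rightarrow> ('b, 'n) star_algebra_scheme \<Rightarrow> ('a \<Rightarrow> 'b) \<Rightarrow> bool"
  where "star_hom A B h \<longleftrightarrow> h \<in> ring_hom A B \<and>
     (\<forall>c. \<forall>a \<in> carrier A. h (scal A c a) = scal B c (h a)) \<and>
     (\<forall>a \<in> carrier A. h (adj A a) = adj B (h a))"

lemma star_homD:
  assumes "star_hom A B h"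
  shows "a \<in> carrier A \<Longrightarrow> h a \<in> carrier B"
    and "a \<in> carrier A \<Longrightarrow> b \<in> carrier A \<Longrightarrow> h (a \<otimes>\<^bsub>A\<^esub> b) = h a \<otimes>\<^bsub>B\<^esub> h b"
    and "a \<in> carrier A \<Longrightarrow> b \<in> carrier A \<Longrightarrow> h (a \<oplus>\<^bsub>A\<^esub> b) = h a \<oplus>\<^bsub>B\<^esub> h b"
    and "h \<one>\<^bsub>A\<^esub> = \<one>\<^bsub>B\<^esub>"
    and "a \<in> carrier A \<Longrightarrow> h (scal A c a) = scal B c (h a)"
    and "a \<in> carrier A \<Longrightarrow> h (adj A a) = adj B (h a)"
  using assms by (auto simp: star_hom_def ring_hom_def)

lemma star_homI:
  assumes "\<And>a. a \<in> carrier A \<Longrightarrow> h a \<in> carrier B"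
    and "\<And>a b. a \<in> carrier A \<Longrightarrow> b \<in> carrier A \<Longrightarrow> h (a \<otimes>\<^bsub>A\<^esub> b) = h a \<otimes>\<^bsub>B\<^esub> h b"
    and "\<And>a b. a \<in> carrier A \<Longrightarrow> b \<in> carrier A \<Longrightarrow> h (a \<oplus>\<^bsub>A\<^esub> b) = h a \<oplus>\<^bsub>B\<^esub> h b"
    and "h \<one>\<^bsub>A\<^esub> = \<one>\<^bsub>B\<^esub>"
    and "\<And>a c. a \<in> carrier A \<Longrightarrow> h (scal A c a) = scal B c (h a)"
    and "\<And>a. a \<in> carrier A \<Longrightarrow> h (adj A a) = adj B (h a)"
  shows "star_hom A B h"
  using assms by (auto simp: star_hom_def ring_hom_def)

lemma star_hom_comp: "star_hom A B f \<Longrightarrow> star_hom B C g \<Longrightarrow> star_hom A C (\<lambda>a. g (f a))"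
  by (rule star_homI) (simp_all add: star_homD)

locale star_algebra_hom = A: complex_star_algebra A + B: complex_star_algebra B
  for A :: "('a, 'm) star_algebra_scheme" and B :: "('b, 'n) star_algebra_scheme" +
  fixes h assumes hom: "star_hom A B h"
begin

lemmas hom_simps = star_homD[OF hom]

lemma hom_zero: "h \<zero>\<^bsub>A\<^esub> = \<zero>\<^bsub>B\<^esub>"
  using hom_simps(5)[of "\<zero>\<^bsub>A\<^esub>" 0] hom_simps(1) by simp

lemma hom_minus: "a \<in> carrier A \<Longrightarrow> b \<in> carrier A \<Longrightarrow> h (a \<ominus>\<^bsub>A\<^esub> b) = h a \<ominus>\<^bsub>B\<^esub> h b"
  by (simp add: a_minus_def hom_simps flip: A.scal_minus_1 B.scal_minus_1)

lemma hom_finsum: "(\<And>i. i \<in> K \<Longrightarrow> f i \<in> carrier A) \<Longrightarrow>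
    h (\<Oplus>\<^bsub>A\<^esub>i\<in>K. f i) = (\<Oplus>\<^bsub>B\<^esub>i\<in>K. h (f i))"
proof (induction K rule: infinite_finite_induct)
  case (insert x K)
  then show ?case by (simp add: Pi_def hom_simps)
qed (simp_all add: hom_zero)

end

text \<open>All axioms are identities, so they pass to surjective images. That \<open>h\<close> preserves \<open>\<zero>\<close> is a
  separate hypothesis: as long as \<open>B\<close> is not known to be a group, \<open>h \<zero> \<oplus> h \<zero> = h \<zero>\<close> cannot be
  cancelled.\<close>

lemma star_hom_surj_star_algebra:
  fixes A :: "('a, 'm) star_algebra_scheme" and B :: "('b, 'n) star_algebra_scheme"
  assumes "complex_star_algebra A" and h: "star_hom A B h" "h \<zero>\<^bsub>A\<^esub> = \<zero>\<^bsub>B\<^esub>"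
    and surj: "carrier B = h ` carrier A"
  shows "complex_star_algebra B"
proof -
  interpret A: complex_star_algebra A by fact
  note h_simps = star_homD(2-6)[OF h(1), symmetric] h(2)[symmetric]
  have grp: "abelian_group B"
    by (rule abelian_groupI)
      (auto simp: surj h_simps A.a_assoc intro: A.a_comm intro!: bexI[of _ "\<ominus>\<^bsub>A\<^esub> _"],
        auto simp: A.a_comm A.a_assoc A.l_neg A.r_neg)
  have mon: "monoid B"
    by (rule monoidI) (auto simp: surj h_simps A.m_assoc)
  have "ring B"
    using grp mon by (rule ringI) (auto simp: surj h_simps A.l_distr A.r_distr)
  then show ?thesis
    by (rule complex_star_algebra.intro, unfold_locales)
      (auto simp: surj h_simps A.scal_add_right A.scal_add_left A.adj_add A.adj_mult A.adj_scal)
qed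

section \<open>Quotients by *-ideals\<close>

lemma star_quotient_simps:
  "carrier (star_quotient A I) = a_rcosets\<^bsub>A\<^esub> I"
  "mult (star_quotient A I) = rcoset_mult A I"
  "one (star_quotient A I) = I +>\<^bsub>A\<^esub> \<one>\<^bsub>A\<^esub>"
  "zero (star_quotient A I) = I"
  "add (star_quotient A I) = set_add A"
  "scal (star_quotient A I) = (\<lambda>c. induced_on_cosets A I (scal A c))"
  "adj (star_quotient A I) = induced_on_cosets A I (adj A)"
  "nrm (star_quotient A I) = (\<lambda>C. Inf (nrm A ` C))"
  by (simp_all add: star_quotient_def ring.extend_def FactRing_def)

locale star_ideal = complex_star_algebra A + ideal I A
  for A :: "'a normed_star_algebra" (structure) and I +
  assumes adj_mem: "a \<in> I \<Longrightarrow> adj A a \<in> I"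
begin

lemma scal_mem: assumes "a \<in> I" shows "scal A c a \<in> I"
proof -
  have "scal A c \<one> \<otimes> a \<in> I"
    using assms by (intro I_l_closed) auto
  then show ?thesis using assms Icarr by simp
qed

lemma coset_eq_iff:
  assumes "a \<in> carrier A" "b \<in> carrier A"
  shows "I +> a = I +> b \<longleftrightarrow> a \<ominus> b \<in> I"
  using quotient_eq_iff_same_a_r_cos[OF is_ideal assms] by simp

lemma coset_zero_iff: "a \<in> carrier A \<Longrightarrow> I +> a = I \<longleftrightarrow> a \<in> I"
  by (metis rcos_const_imp_mem a_rcos_const)

lemma coset_memD: assumes "a \<in> carrier A" "b \<in> I +> a" shows "b \<in> carrier A" "I +> b = I +> a"
  using assms a_elemrcos_carrier a_repr_independence' by metis+

text \<open>The operations of a quotient are defined as unions over all representatives. If \<open>f\<close> respects \<open>I\<close>,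
  then every representative contributes the same coset, so the union is that coset.\<close>

lemma induced_on_cosets_eq:
  assumes f: "\<And>a. a \<in> carrier A \<Longrightarrow> f a \<in> carrier A" "\<And>a. a \<in> I \<Longrightarrow> f a \<in> I"
    "\<And>a b. a \<in> carrier A \<Longrightarrow> b \<in> carrier A \<Longrightarrow> f (a \<ominus> b) = f a \<ominus> f b" and a: "a \<in> carrier A"
  shows "induced_on_cosets A I f (I +> a) = I +> f a"
proof -
  have "I +> f b = I +> f a" if "b \<in> I +> a" for b
  proof -
    note b = coset_memD[OF a that]
    then have "b \<ominus> a \<in> I" using coset_eq_iff a by simp
    then have "f b \<ominus> f a \<in> I" using f b a by metis
    then show ?thesis using coset_eq_iff f(1) a b by simp
  qed
  moreover have "a \<in> I +> a" using a by (rule a_rcos_self)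
  ultimately show ?thesis unfolding induced_on_cosets_def by blast
qed

lemma scal_coset: "a \<in> carrier A \<Longrightarrow> induced_on_cosets A I (scal A c) (I +> a) = I +> scal A c a"
  by (rule induced_on_cosets_eq) (auto simp: scal_mem scal_minus)

lemma adj_coset: "a \<in> carrier A \<Longrightarrow> induced_on_cosets A I (adj A) (I +> a) = I +> adj A a"
  by (rule induced_on_cosets_eq) (auto simp: adj_mem adj_minus)

lemma coset_carrier: "carrier (star_quotient A I) = (+>) I ` carrier A"
  by (auto simp: A_RCOSETS_def' star_quotient_simps)

lemma coset_hom: "star_hom A (star_quotient A I) ((+>) I)"
  using rcos_ring_hom
  by (intro star_homI) (auto simp: scal_coset adj_coset ring_hom_def FactRing_def star_quotient_simps)

lemma quotient_star_algebra: "complex_star_algebra (star_quotient A I)"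
  by (rule star_hom_surj_star_algebra[OF complex_star_algebra_axioms coset_hom _ coset_carrier])
    (simp add: star_quotient_simps a_rcos_zero[OF is_ideal zero_closed])

end

text \<open>The first isomorphism theorem. Since \<open>B\<close> may itself be a quotient of a quotient, a completion can
  be compared with a quotient of another completion in a single step, starting from sequences.\<close>

lemma star_isomorphic_of_surj:
  fixes A :: "'a normed_star_algebra" and B :: "('b, 'n) star_algebra_scheme"
  assumes "star_ideal A I" "complex_star_algebra B" and h: "star_hom A B h"
    and surj: "h ` carrier A = carrier B"
    and ker: "\<And>a. a \<in> carrier A \<Longrightarrow> h a = \<zero>\<^bsub>B\<^esub> \<longleftrightarrow> a \<in> I"
  shows "star_isomorphic (star_quotient A I) B"
proof -
  interpret star_ideal A I by fact
  interpret B: complex_star_algebra B by fact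
  interpret star_algebra_hom A B h by unfold_locales fact
  let ?Q = "star_quotient A I"
  have eq: "h a = h b \<longleftrightarrow> I +>\<^bsub>A\<^esub> a = I +>\<^bsub>A\<^esub> b" if "a \<in> carrier A" "b \<in> carrier A" for a b
  proof -
    have "h a = h b \<longleftrightarrow> h (a \<ominus>\<^bsub>A\<^esub> b) = \<zero>\<^bsub>B\<^esub>" using that by (simp add: hom_minus hom_simps B.minus_eq_zero_iff)
    then show ?thesis using that by (simp add: ker coset_eq_iff)
  qed
  define g where "g C = h (SOME a. a \<in> C)" for C
  have g: "g (I +>\<^bsub>A\<^esub> a) = h a" if "a \<in> carrier A" for a
  proof -
    have "(SOME b. b \<in> I +>\<^bsub>A\<^esub> a) \<in> I +>\<^bsub>A\<^esub> a" using a_rcos_self[OF that] by (rule someI)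
    from coset_memD[OF that this] show ?thesis unfolding g_def using eq that by simp
  qed
  note q = star_homD(2-6)[OF coset_hom, symmetric]
  have "star_hom ?Q B g"
    by (rule star_homI) (auto simp: coset_carrier q g hom_simps)
  moreover have "bij_betw g (carrier ?Q) (carrier B)"
    unfolding bij_betw_def
  proof
    show "inj_on g (carrier ?Q)" by (auto simp: inj_on_def coset_carrier g eq)
    show "g ` carrier ?Q = carrier B" by (simp add: coset_carrier image_image g flip: surj)
  qed
  ultimately show ?thesis
    unfolding star_isomorphic_def star_hom_def ring_iso_def by auto
qed

section \<open>Monoid *-algebras and their universal property\<close>

locale star_monoid = monoid M for M :: "('m, 'k) monoid_scheme" (structure) +
  fixes \<tau> :: "'m \<Rightarrow> 'm"
  assumes \<tau>_closed [simp, intro]: "m \<in> carrier M \<Longrightarrow> \<tau> m \<in> carrier M"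
    and \<tau>_\<tau> [simp]: "m \<in> carrier M \<Longrightarrow> \<tau> (\<tau> m) = m"
    and \<tau>_mult: "m \<in> carrier M \<Longrightarrow> n \<in> carrier M \<Longrightarrow> \<tau> (m \<otimes> n) = \<tau> n \<otimes> \<tau> m"
begin

abbreviation \<A> where "\<A> \<equiv> monoid_algebra M \<tau>"

lemma carrier_iff: "f \<in> carrier \<A> \<longleftrightarrow> finite {m. f m \<noteq> 0} \<and> {m. f m \<noteq> 0} \<subseteq> carrier M"
  by (simp add: monoid_algebra_def)

lemma operations:
  "\<one>\<^bsub>\<A>\<^esub> = basis_element \<one>" "\<zero>\<^bsub>\<A>\<^esub> = (\<lambda>m. 0)" "f \<oplus>\<^bsub>\<A>\<^esub> g = (\<lambda>m. f m + g m)"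
  "scal \<A> c f = (\<lambda>m. c * f m)"
  "adj \<A> f = (\<lambda>m. if m \<in> carrier M then cnj (f (\<tau> m)) else 0)"
  by (auto simp: monoid_algebra_def basis_element_def)

lemma pointwise: "(f \<oplus>\<^bsub>\<A>\<^esub> g) m = f m + g m" "scal \<A> c f m = c * f m"
  by (simp_all add: operations)

text \<open>The convolution is defined by a sum over the factorizations of \<open>m\<close> inside the supports. Sums over
  arbitrary finite sets that contain the supports allow the supports of \<open>f\<close>, \<open>g\<close> and \<open>f + g\<close> to
  be replaced by a common set.\<close>

lemma mult_on:
  assumes "finite K" "{m. f m \<noteq> 0} \<subseteq> K" "finite L" "{m. g m \<noteq> 0} \<subseteq> L"
  shows "(f \<otimes>\<^bsub>\<A>\<^esub> g) m = (\<Sum>k\<in>K. \<Sum>l\<in>L. if k \<otimes> l = m then f k * g l else 0)"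
proof -
  have "(f \<otimes>\<^bsub>\<A>\<^esub> g) m = (\<Sum>(k, l) \<in> {(k, l). f k \<noteq> 0 \<and> g l \<noteq> 0 \<and> k \<otimes> l = m}. f k * g l)"
    by (simp add: monoid_algebra_def)
  also have "\<dots> = (\<Sum>(k, l) \<in> K \<times> L. if k \<otimes> l = m then f k * g l else 0)"
    using assms by (intro sum.mono_neutral_cong_left) (auto split: if_splits)
  finally show ?thesis by (simp add: sum.cartesian_product)
qed

lemma supp_mult: "{m. (f \<otimes>\<^bsub>\<A>\<^esub> g) m \<noteq> 0} \<subseteq> (\<lambda>(k, l). k \<otimes> l) ` ({m. f m \<noteq> 0} \<times> {m. g m \<noteq> 0})"
proof
  fix m assume "m \<in> {m. (f \<otimes>\<^bsub>\<A>\<^esub> g) m \<noteq> 0}"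
  then have "{(k, l). f k \<noteq> 0 \<and> g l \<noteq> 0 \<and> k \<otimes> l = m} \<noteq> {}"
    by (auto simp: monoid_algebra_def simp del: Collect_empty_eq intro: ccontr)
  then show "m \<in> (\<lambda>(k, l). k \<otimes> l) ` ({m. f m \<noteq> 0} \<times> {m. g m \<noteq> 0})" by auto
qed

lemma basis_closed [simp, intro]: "m \<in> carrier M \<Longrightarrow> basis_element m \<in> carrier \<A>"
  by (auto simp: carrier_iff basis_element_def)

lemma zero_carrier: "\<zero>\<^bsub>\<A>\<^esub> \<in> carrier \<A>"
  by (simp add: carrier_iff operations)

lemma add_carrier: assumes "f \<in> carrier \<A>" "g \<in> carrier \<A>" shows "f \<oplus>\<^bsub>\<A>\<^esub> g \<in> carrier \<A>"
proof -
  have "{m. (f \<oplus>\<^bsub>\<A>\<^esub> g) m \<noteq> 0} \<subseteq> {m. f m \<noteq> 0} \<union> {m. g m \<noteq> 0}" by (auto simp: operations)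
  then show ?thesis using assms unfolding carrier_iff by (meson finite_UnI finite_subset le_sup_iff order_trans)
qed

lemma scal_carrier: "f \<in> carrier \<A> \<Longrightarrow> scal \<A> c f \<in> carrier \<A>"
  by (auto simp: carrier_iff operations elim: rev_finite_subset)

lemma mult_carrier: assumes "f \<in> carrier \<A>" "g \<in> carrier \<A>" shows "f \<otimes>\<^bsub>\<A>\<^esub> g \<in> carrier \<A>"
proof -
  have "finite {m. (f \<otimes>\<^bsub>\<A>\<^esub> g) m \<noteq> 0}"
    using assms by (intro finite_subset[OF supp_mult]) (simp add: carrier_iff)
  moreover have "{m. (f \<otimes>\<^bsub>\<A>\<^esub> g) m \<noteq> 0} \<subseteq> carrier M"
    using assms by (intro order_trans[OF supp_mult]) (auto simp: carrier_iff)
  ultimately show ?thesis by (simp add: carrier_iff)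
qed

lemma adj_carrier: assumes "f \<in> carrier \<A>" shows "adj \<A> f \<in> carrier \<A>"
proof -
  have "{m. adj \<A> f m \<noteq> 0} \<subseteq> \<tau> ` {m. f m \<noteq> 0}"
    by (auto simp: operations split: if_splits intro!: image_eqI[of _ \<tau> "\<tau> _"])
  then have "finite {m. adj \<A> f m \<noteq> 0}"
    using assms unfolding carrier_iff by (meson finite_imageI finite_subset)
  then show ?thesis by (auto simp: carrier_iff operations split: if_splits)
qed

text \<open>The basis elements span the algebra. Every (sesqui)linear identity below, including associativity,
  is thereby reduced to an identity in \<open>M\<close>.\<close>

lemma span_induct [consumes 1, case_names zero add]:
  assumes "f \<in> carrier \<A>" and "P \<zero>\<^bsub>\<A>\<^esub>"
    and step: "\<And>c m f. m \<in> carrier M \<Longrightarrow> f \<in> carrier \<A> \<Longrightarrow> P f \<Longrightarrow>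
      P (scal \<A> c (basis_element m) \<oplus>\<^bsub>\<A>\<^esub> f)"
  shows "P f"
proof -
  have "P f" if "finite K" "{m. f m \<noteq> 0} \<subseteq> K" "K \<subseteq> carrier M" for K f
    using that
  proof (induction K arbitrary: f)
    case empty
    then have "f = \<zero>\<^bsub>\<A>\<^esub>" by (auto simp: operations)
    then show ?case using assms(2) by simp
  next
    case (insert m K)
    define g where "g = f(m := 0)"
    have g: "{m. g m \<noteq> 0} \<subseteq> K" using insert.prems by (auto simp: g_def)
    then have "P g" using insert.IH insert.prems by simp
    moreover have "g \<in> carrier \<A>"
      unfolding carrier_iff using g insert.hyps insert.prems by (meson finite_subset insert_subset order_trans)
    ultimately have "P (scal \<A> (f m) (basis_element m) \<oplus>\<^bsub>\<A>\<^esub> g)"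
      using step[of m g "f m"] insert.prems by simp
    moreover have "scal \<A> (f m) (basis_element m) \<oplus>\<^bsub>\<A>\<^esub> g = f"
      by (auto simp: operations g_def basis_element_def)
    ultimately show ?case by simp
  qed
  moreover have "finite {m. f m \<noteq> 0}" "{m. f m \<noteq> 0} \<subseteq> carrier M"
    using assms(1) by (simp_all add: carrier_iff)
  ultimately show ?thesis by blast
qed

lemma basis_mult: "basis_element k \<otimes>\<^bsub>\<A>\<^esub> basis_element l = basis_element (k \<otimes> l)"
  by (rule ext, subst mult_on[where K="{k}" and L="{l}"]) (auto simp: basis_element_def)

lemma basis_adj: "m \<in> carrier M \<Longrightarrow> adj \<A> (basis_element m) = basis_element (\<tau> m)"
  by (rule ext) (auto simp: operations basis_element_def)

lemma mult_linear_left: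
  assumes "f \<in> carrier \<A>" "g \<in> carrier \<A>" "h \<in> carrier \<A>"
  shows "(scal \<A> c f \<oplus>\<^bsub>\<A>\<^esub> g) \<otimes>\<^bsub>\<A>\<^esub> h = scal \<A> c (f \<otimes>\<^bsub>\<A>\<^esub> h) \<oplus>\<^bsub>\<A>\<^esub> (g \<otimes>\<^bsub>\<A>\<^esub> h)"
proof
  fix m
  define K L where "K = {m. f m \<noteq> 0} \<union> {m. g m \<noteq> 0}" and "L = {m. h m \<noteq> 0}"
  have fin: "finite K" "finite L" using assms by (auto simp: carrier_iff K_def L_def)
  have sub: "{m. f m \<noteq> 0} \<subseteq> K" "{m. g m \<noteq> 0} \<subseteq> K"
    "{m. (scal \<A> c f \<oplus>\<^bsub>\<A>\<^esub> g) m \<noteq> 0} \<subseteq> K" "{m. h m \<noteq> 0} \<subseteq> L"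
    by (auto simp: K_def L_def operations)
  note on = mult_on[OF fin(1) _ fin(2) sub(4)]
  show "((scal \<A> c f \<oplus>\<^bsub>\<A>\<^esub> g) \<otimes>\<^bsub>\<A>\<^esub> h) m = (scal \<A> c (f \<otimes>\<^bsub>\<A>\<^esub> h) \<oplus>\<^bsub>\<A>\<^esub> (g \<otimes>\<^bsub>\<A>\<^esub> h)) m"
    unfolding pointwise(1)[of "scal \<A> c (f \<otimes>\<^bsub>\<A>\<^esub> h)"] pointwise(2)[of c "f \<otimes>\<^bsub>\<A>\<^esub> h"]
      on[OF sub(1)] on[OF sub(2)] on[OF sub(3)] sum.distrib[symmetric] sum_distrib_left
    by (intro sum.cong) (auto simp: pointwise ring_distribs)
qed

lemma mult_linear_right:
  assumes "f \<in> carrier \<A>" "g \<in> carrier \<A>" "h \<in> carrier \<A>"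
  shows "h \<otimes>\<^bsub>\<A>\<^esub> (scal \<A> c f \<oplus>\<^bsub>\<A>\<^esub> g) = scal \<A> c (h \<otimes>\<^bsub>\<A>\<^esub> f) \<oplus>\<^bsub>\<A>\<^esub> (h \<otimes>\<^bsub>\<A>\<^esub> g)"
proof
  fix m
  define K L where "K = {m. f m \<noteq> 0} \<union> {m. g m \<noteq> 0}" and "L = {m. h m \<noteq> 0}"
  have fin: "finite K" "finite L" using assms by (auto simp: carrier_iff K_def L_def)
  have sub: "{m. f m \<noteq> 0} \<subseteq> K" "{m. g m \<noteq> 0} \<subseteq> K"
    "{m. (scal \<A> c f \<oplus>\<^bsub>\<A>\<^esub> g) m \<noteq> 0} \<subseteq> K" "{m. h m \<noteq> 0} \<subseteq> L"
    by (auto simp: K_def L_def operations)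
  note on = mult_on[OF fin(2) sub(4) fin(1)]
  show "(h \<otimes>\<^bsub>\<A>\<^esub> (scal \<A> c f \<oplus>\<^bsub>\<A>\<^esub> g)) m = (scal \<A> c (h \<otimes>\<^bsub>\<A>\<^esub> f) \<oplus>\<^bsub>\<A>\<^esub> (h \<otimes>\<^bsub>\<A>\<^esub> g)) m"
    unfolding pointwise(1)[of "scal \<A> c (h \<otimes>\<^bsub>\<A>\<^esub> f)"] pointwise(2)[of c "h \<otimes>\<^bsub>\<A>\<^esub> f"]
      on[OF sub(1)] on[OF sub(2)] on[OF sub(3)] sum.distrib[symmetric] sum_distrib_left
    by (intro sum.cong) (auto simp: pointwise ring_distribs)
qed

lemma mult_zero: "f \<in> carrier \<A> \<Longrightarrow> f \<otimes>\<^bsub>\<A>\<^esub> \<zero>\<^bsub>\<A>\<^esub> = \<zero>\<^bsub>\<A>\<^esub>" "\<zero>\<^bsub>\<A>\<^esub> \<otimes>\<^bsub>\<A>\<^esub> f = \<zero>\<^bsub>\<A>\<^esub>"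
  by (simp_all add: monoid_algebra_def)

lemma scal_laws:
  "scal \<A> c (f \<oplus>\<^bsub>\<A>\<^esub> g) = scal \<A> c f \<oplus>\<^bsub>\<A>\<^esub> scal \<A> c g"
  "scal \<A> (c + d) f = scal \<A> c f \<oplus>\<^bsub>\<A>\<^esub> scal \<A> d f"
  "scal \<A> c (scal \<A> d f) = scal \<A> (c * d) f" "scal \<A> 1 f = f"
  "f \<oplus>\<^bsub>\<A>\<^esub> \<zero>\<^bsub>\<A>\<^esub> = f"
  by (simp_all add: fun_eq_iff pointwise operations(2) ring_distribs)

lemma mult_add_left: "f \<in> carrier \<A> \<Longrightarrow> g \<in> carrier \<A> \<Longrightarrow> h \<in> carrier \<A> \<Longrightarrow>
    (f \<oplus>\<^bsub>\<A>\<^esub> g) \<otimes>\<^bsub>\<A>\<^esub> h = (f \<otimes>\<^bsub>\<A>\<^esub> h) \<oplus>\<^bsub>\<A>\<^esub> (g \<otimes>\<^bsub>\<A>\<^esub> h)"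
  using mult_linear_left[of f g h 1] by (simp add: scal_laws)

lemma mult_add_right: "f \<in> carrier \<A> \<Longrightarrow> g \<in> carrier \<A> \<Longrightarrow> h \<in> carrier \<A> \<Longrightarrow>
    h \<otimes>\<^bsub>\<A>\<^esub> (f \<oplus>\<^bsub>\<A>\<^esub> g) = (h \<otimes>\<^bsub>\<A>\<^esub> f) \<oplus>\<^bsub>\<A>\<^esub> (h \<otimes>\<^bsub>\<A>\<^esub> g)"
  using mult_linear_right[of f g h 1] by (simp add: scal_laws)

lemma mult_scal_l: "f \<in> carrier \<A> \<Longrightarrow> g \<in> carrier \<A> \<Longrightarrow> scal \<A> c f \<otimes>\<^bsub>\<A>\<^esub> g = scal \<A> c (f \<otimes>\<^bsub>\<A>\<^esub> g)"
  using mult_linear_left[OF _ zero_carrier, of f g c] by (simp add: scal_laws mult_zero)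

lemma mult_scal_r: "f \<in> carrier \<A> \<Longrightarrow> g \<in> carrier \<A> \<Longrightarrow> g \<otimes>\<^bsub>\<A>\<^esub> scal \<A> c f = scal \<A> c (g \<otimes>\<^bsub>\<A>\<^esub> f)"
  using mult_linear_right[OF _ zero_carrier, of f g c] by (simp add: scal_laws mult_zero)

lemma adj_of_add: "adj \<A> (f \<oplus>\<^bsub>\<A>\<^esub> g) = adj \<A> f \<oplus>\<^bsub>\<A>\<^esub> adj \<A> g"
  by (auto simp: operations)

lemma adj_of_scal: "adj \<A> (scal \<A> c f) = scal \<A> (cnj c) (adj \<A> f)"
  by (auto simp: operations)

lemma adj_of_zero: "adj \<A> \<zero>\<^bsub>\<A>\<^esub> = \<zero>\<^bsub>\<A>\<^esub>" 
  by (auto simp: operations)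

lemmas closed = zero_carrier add_carrier scal_carrier mult_carrier adj_carrier
lemmas linear = mult_add_left mult_add_right mult_scal_l mult_scal_r mult_zero adj_of_add adj_of_scal adj_of_zero

lemma assoc:
  assumes "f \<in> carrier \<A>" "g \<in> carrier \<A>" "h \<in> carrier \<A>"
  shows "(f \<otimes>\<^bsub>\<A>\<^esub> g) \<otimes>\<^bsub>\<A>\<^esub> h = f \<otimes>\<^bsub>\<A>\<^esub> (g \<otimes>\<^bsub>\<A>\<^esub> h)"
  using assms(1)
proof (induction f rule: span_induct)
  case (add c k f)
  have "(basis_element k \<otimes>\<^bsub>\<A>\<^esub> g) \<otimes>\<^bsub>\<A>\<^esub> h = basis_element k \<otimes>\<^bsub>\<A>\<^esub> (g \<otimes>\<^bsub>\<A>\<^esub> h)"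
    using assms(2)
  proof (induction g rule: span_induct)
    case (add d l g)
    have "(basis_element k \<otimes>\<^bsub>\<A>\<^esub> basis_element l) \<otimes>\<^bsub>\<A>\<^esub> h =
        basis_element k \<otimes>\<^bsub>\<A>\<^esub> (basis_element l \<otimes>\<^bsub>\<A>\<^esub> h)"
      using assms(3)
    proof (induction h rule: span_induct)
      case (add e m h)
      then show ?case using \<open>k \<in> carrier M\<close> \<open>l \<in> carrier M\<close>
        by (simp add: linear closed basis_mult m_assoc)
    qed (use add \<open>k \<in> carrier M\<close> in \<open>simp add: linear closed basis_mult\<close>)
    then show ?case using add \<open>k \<in> carrier M\<close> assms(3) by (simp add: linear closed)
  qed (use add assms(3) in \<open>simp add: linear closed\<close>)
  then show ?case using add assms(2,3) by (simp add: linear closed)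
qed (use assms in \<open>simp add: linear closed\<close>)

lemma adj_of_mult:
  assumes "f \<in> carrier \<A>" "g \<in> carrier \<A>"
  shows "adj \<A> (f \<otimes>\<^bsub>\<A>\<^esub> g) = adj \<A> g \<otimes>\<^bsub>\<A>\<^esub> adj \<A> f"
  using assms(1)
proof (induction f rule: span_induct)
  case (add c k f)
  have "adj \<A> (basis_element k \<otimes>\<^bsub>\<A>\<^esub> g) = adj \<A> g \<otimes>\<^bsub>\<A>\<^esub> adj \<A> (basis_element k)"
    using assms(2)
  proof (induction g rule: span_induct)
    case (add d l g)
    then show ?case using \<open>k \<in> carrier M\<close>
      by (simp add: linear closed basis_mult basis_adj \<tau>_mult)
  qed (use add in \<open>simp add: linear closed\<close>)
  then show ?case using add assms(2) by (simp add: linear closed)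
qed (use assms in \<open>simp add: linear closed\<close>)

lemma one_mult: "f \<in> carrier \<A> \<Longrightarrow> \<one>\<^bsub>\<A>\<^esub> \<otimes>\<^bsub>\<A>\<^esub> f = f"
proof (induction f rule: span_induct)
  case (add c k f)
  then show ?case by (simp add: operations(1) linear closed basis_mult)
qed (simp add: linear closed operations(1))

lemma mult_one: "f \<in> carrier \<A> \<Longrightarrow> f \<otimes>\<^bsub>\<A>\<^esub> \<one>\<^bsub>\<A>\<^esub> = f"
proof (induction f rule: span_induct)
  case (add c k f)
  then show ?case by (simp add: operations(1) linear closed basis_mult)
qed (simp add: linear closed operations(1))

lemma adj_of_adj: "f \<in> carrier \<A> \<Longrightarrow> adj \<A> (adj \<A> f) = f"
proof (induction f rule: span_induct)
  case (add c k f)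
  then show ?case by (simp add: linear closed basis_adj)
qed (simp add: linear)

lemma monoid_star_algebra: "complex_star_algebra \<A>"
proof -
  have "abelian_group \<A>"
  proof (rule abelian_groupI)
    fix f assume f: "f \<in> carrier \<A>"
    show "\<exists>g\<in>carrier \<A>. g \<oplus>\<^bsub>\<A>\<^esub> f = \<zero>\<^bsub>\<A>\<^esub>"
      by (rule bexI[of _ "scal \<A> (-1) f"]) (use f scal_carrier[OF f, of "-1"] in \<open>auto simp: operations\<close>)
  qed (auto simp: closed, auto simp: operations)
  moreover have "monoid \<A>"
    by (rule monoidI) (auto simp: closed assoc one_mult mult_one, simp add: operations(1))
  ultimately have "ring \<A>"
    by (rule ringI) (simp_all add: linear)
  then show ?thesis
    by (rule complex_star_algebra.intro, unfold_locales)
      (simp_all add: closed linear adj_of_mult adj_of_adj scal_laws)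
qed

end

locale monoid_representation = star_monoid M \<tau> + B: complex_star_algebra B
  for M :: "('m, 'k) monoid_scheme" (structure) and \<tau> and B :: "('b, 'n) star_algebra_scheme" +
  fixes \<rho> :: "'m \<Rightarrow> 'b"
  assumes rep_closed [simp, intro]: "m \<in> carrier M \<Longrightarrow> \<rho> m \<in> carrier B"
    and rep_mult: "m \<in> carrier M \<Longrightarrow> n \<in> carrier M \<Longrightarrow> \<rho> (m \<otimes> n) = \<rho> m \<otimes>\<^bsub>B\<^esub> \<rho> n"
    and rep_one: "\<rho> \<one> = \<one>\<^bsub>B\<^esub>"
    and rep_adj: "m \<in> carrier M \<Longrightarrow> \<rho> (\<tau> m) = adj B (\<rho> m)"
begin

definition extension :: "('m \<Rightarrow> complex) \<Rightarrow> 'b" where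
  "extension f = (\<Oplus>\<^bsub>B\<^esub>m\<in>{m. f m \<noteq> 0}. scal B (f m) (\<rho> m))"

lemma extension_on:
  assumes "finite K" "{m. f m \<noteq> 0} \<subseteq> K" "K \<subseteq> carrier M"
  shows "extension f = (\<Oplus>\<^bsub>B\<^esub>m\<in>K. scal B (f m) (\<rho> m))"
  unfolding extension_def
  using assms by (intro B.add.finprod_mono_neutral_cong_left) auto

lemma extension_closed: "f \<in> carrier \<A> \<Longrightarrow> extension f \<in> carrier B"
  unfolding extension_def by (rule B.finsum_closed) (auto simp: carrier_iff)

lemma extension_basis: "m \<in> carrier M \<Longrightarrow> extension (basis_element m) = \<rho> m"
  by (subst extension_on[of "{m}"]) (auto simp: basis_element_def)

lemma extension_zero: "extension \<zero>\<^bsub>\<A>\<^esub> = \<zero>\<^bsub>B\<^esub>"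
  by (simp add: extension_def operations)

lemma extension_scal: assumes "f \<in> carrier \<A>"
  shows "extension (scal \<A> c f) = scal B c (extension f)"
proof -
  have "finite {m. f m \<noteq> 0}" "{m. f m \<noteq> 0} \<subseteq> carrier M" using assms by (auto simp: carrier_iff)
  then have "extension (scal \<A> c f) = (\<Oplus>\<^bsub>B\<^esub>m\<in>{m. f m \<noteq> 0}. scal B c (scal B (f m) (\<rho> m)))"
    by (subst extension_on[of "{m. f m \<noteq> 0}"]) (auto simp: pointwise intro!: B.finsum_cong')
  also have "\<dots> = scal B c (extension f)"
    unfolding extension_def using assms by (intro B.finsum_scal) (auto simp: carrier_iff)
  finally show ?thesis .
qed

lemma extension_add: assumes "f \<in> carrier \<A>" "g \<in> carrier \<A>"
  shows "extension (f \<oplus>\<^bsub>\<A>\<^esub> g) = extension f \<oplus>\<^bsub>B\<^esub> extension g"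
proof -
  let ?K = "{m. f m \<noteq> 0} \<union> {m. g m \<noteq> 0}"
  have K: "finite ?K" "?K \<subseteq> carrier M" using assms by (auto simp: carrier_iff)
  have c: "(\<lambda>m. scal B (h m) (\<rho> m)) \<in> ?K \<rightarrow> carrier B" for h using K(2) by auto
  have on: "extension h = (\<Oplus>\<^bsub>B\<^esub>m\<in>?K. scal B (h m) (\<rho> m))" if "{m. h m \<noteq> 0} \<subseteq> ?K" for h
    by (rule extension_on[OF K(1) that K(2)])
  have "extension (f \<oplus>\<^bsub>\<A>\<^esub> g) =
      (\<Oplus>\<^bsub>B\<^esub>m\<in>?K. scal B (f m) (\<rho> m) \<oplus>\<^bsub>B\<^esub> scal B (g m) (\<rho> m))"
    using K(2) by (subst on) (auto simp: pointwise B.scal_add_left intro!: B.finsum_cong')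
  also have "\<dots> = extension f \<oplus>\<^bsub>B\<^esub> extension g"
    using c by (subst on[of f], blast, subst on[of g], blast) (rule B.finsum_addf)
  finally show ?thesis .
qed

text \<open>The universal property: multiplicative maps from \<open>M\<close> that turn \<open>\<tau>\<close> into the involution extend to
  *-homomorphisms. It is used for the free *-algebra of the game and for the group algebra.\<close>

lemma extension_star_hom: "star_hom \<A> B extension"
proof (rule star_homI)
  show "extension (f \<otimes>\<^bsub>\<A>\<^esub> g) = extension f \<otimes>\<^bsub>B\<^esub> extension g"
    if "f \<in> carrier \<A>" "g \<in> carrier \<A>" for f g
    using that(1)
  proof (induction f rule: span_induct)
    case (add c k f)
    have "extension (basis_element k \<otimes>\<^bsub>\<A>\<^esub> g) = extension (basis_element k) \<otimes>\<^bsub>B\<^esub> extension g"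
      using that(2)
    proof (induction g rule: span_induct)
      case (add d l g)
      then show ?case using \<open>k \<in> carrier M\<close>
        by (simp add: linear closed basis_mult extension_add extension_scal extension_basis
          extension_closed rep_mult B.r_distr)
    qed (use add in \<open>simp add: linear closed extension_zero extension_closed\<close>)
    then show ?case using add that(2)
      by (simp add: linear closed extension_add extension_scal extension_closed B.l_distr)
  qed (use that in \<open>simp add: linear closed extension_zero extension_closed\<close>)
  show "extension (adj \<A> f) = adj B (extension f)" if "f \<in> carrier \<A>" for f
    using that
    by (induction f rule: span_induct)
      (simp_all add: linear closed extension_zero extension_add extension_scal extension_closed
        extension_basis basis_adj rep_adj B.adj_add B.adj_scal)
qed (simp_all add: extension_closed extension_add extension_scal operations(1) extension_basis rep_one)

end

lemma (in star_monoid) star_hom_eqI: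
  fixes B :: "('b, 'n) star_algebra_scheme"
  assumes "complex_star_algebra B" "star_hom \<A> B h" "star_hom \<A> B h'"
    and "\<And>m. m \<in> carrier M \<Longrightarrow> h (basis_element m) = h' (basis_element m)"
    and "f \<in> carrier \<A>"
  shows "h f = h' f"
proof -
  interpret h: star_algebra_hom \<A> B h
    using assms monoid_star_algebra by (simp add: star_algebra_hom_def star_algebra_hom_axioms_def)
  interpret h': star_algebra_hom \<A> B h'
    using assms monoid_star_algebra by (simp add: star_algebra_hom_def star_algebra_hom_axioms_def)
  show ?thesis
    using assms(5)
    by (induction f rule: span_induct)
      (simp_all add: h.hom_zero h'.hom_zero h.hom_simps h'.hom_simps closed assms(4))
qed

section \<open>C*-seminorms\<close>

text \<open>The conditions of \<^const>\<open>cstar_seminorm\<close>, for *-algebras whose record has further fields, so that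
  they can also be stated for the norm of a completion.\<close>

locale cstar_seminormed = complex_star_algebra A for A :: "('a, 'm) star_algebra_scheme" (structure) +
  fixes p :: "'a \<Rightarrow> real"
  assumes nonneg [simp]: "a \<in> carrier A \<Longrightarrow> 0 \<le> p a"
    and triangle: "a \<in> carrier A \<Longrightarrow> b \<in> carrier A \<Longrightarrow> p (a \<oplus> b) \<le> p a + p b"
    and homogeneous: "a \<in> carrier A \<Longrightarrow> p (scal A c a) = cmod c * p a"
    and submult: "a \<in> carrier A \<Longrightarrow> b \<in> carrier A \<Longrightarrow> p (a \<otimes> b) \<le> p a * p b"
    and cstar: "a \<in> carrier A \<Longrightarrow> p (adj A a \<otimes> a) = (p a)\<^sup>2"
begin

lemma zero [simp]: "p \<zero> = 0"
  using homogeneous[of \<zero> 0] by simp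

lemma uminus: "a \<in> carrier A \<Longrightarrow> p (\<ominus> a) = p a"
  using homogeneous[of a "-1"] by (simp add: scal_minus_1)

lemma minus: "a \<in> carrier A \<Longrightarrow> b \<in> carrier A \<Longrightarrow> p (a \<ominus> b) \<le> p a + p b"
  using triangle[of a "\<ominus> b"] by (simp add: a_minus_def uminus)

lemma minus_commute: assumes "a \<in> carrier A" "b \<in> carrier A" shows "p (a \<ominus> b) = p (b \<ominus> a)"
proof -
  have "a \<ominus> b = \<ominus> (b \<ominus> a)" using assms by algebra
  then show ?thesis using uminus assms by simp
qed

lemma reverse_triangle: assumes "a \<in> carrier A" "b \<in> carrier A" shows "\<bar>p a - p b\<bar> \<le> p (a \<ominus> b)"
proof -
  have "a = (a \<ominus> b) \<oplus> b" "b = (b \<ominus> a) \<oplus> a" using assms by algebra+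
  then have "p a \<le> p (a \<ominus> b) + p b" "p b \<le> p (b \<ominus> a) + p a"
    using triangle assms by (metis minus_closed)+
  then show ?thesis using minus_commute assms by force
qed

text \<open>The involution is isometric because \<open>p b\<^sup>2 = p (b\<^sup>* b) \<le> p b\<^sup>* p b\<close>, applied to \<open>b = a\<close> and
  \<open>b = a\<^sup>*\<close>.\<close>

lemma adj_eq: assumes "a \<in> carrier A" shows "p (adj A a) = p a"
proof -
  have *: "p b \<le> p (adj A b)" if "b \<in> carrier A" for b
  proof (cases "p b = 0")
    case False
    then have "0 < p b" using nonneg[OF that] by linarith
    moreover have "p b * p b \<le> p (adj A b) * p b"
      using cstar[OF that] submult[of "adj A b" b] that by (simp add: power2_eq_square)
    ultimately show ?thesis by simp
  qed (use that in simp)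
  have "p (adj A a) \<le> p a" using *[OF adj_closed[OF assms]] assms by (simp only: adj_adj)
  with *[OF assms] show ?thesis by (rule antisym[rotated])
qed

lemma pullback:
  fixes B :: "('b, 'n) star_algebra_scheme"
  assumes "complex_star_algebra B" "star_hom B A h"
  shows "cstar_seminormed B (\<lambda>b. p (h b))"
proof -
  interpret B: complex_star_algebra B by fact
  note h = star_homD[OF assms(2)]
  show ?thesis
    by unfold_locales (auto simp: h triangle homogeneous submult cstar)
qed

text \<open>Multiplication by a central projection is linear, multiplicative and compatible with the involution,
  so each condition on \<open>p\<close> passes to the composite.\<close>

lemma corner:
  assumes e: "e \<in> carrier A" "e \<otimes> e = e" "adj A e = e"
    and central: "\<And>a. a \<in> carrier A \<Longrightarrow> e \<otimes> a = a \<otimes> e"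
  shows "cstar_seminormed A (\<lambda>a. p (e \<otimes> a))"
proof unfold_locales
  have mult: "e \<otimes> (a \<otimes> b) = (e \<otimes> a) \<otimes> (e \<otimes> b)" if "a \<in> carrier A" "b \<in> carrier A" for a b
  proof -
    have "(e \<otimes> a) \<otimes> (e \<otimes> b) = e \<otimes> (a \<otimes> e) \<otimes> b" using that e by (simp add: m_assoc)
    also have "\<dots> = (e \<otimes> e) \<otimes> a \<otimes> b"
      using that e(1) central[OF that(1)] by (simp add: m_assoc)
    finally show ?thesis using that e(1,2) by (simp add: m_assoc)
  qed
  fix a b assume ab: "a \<in> carrier A" "b \<in> carrier A"
  show "p (e \<otimes> (a \<otimes> b)) \<le> p (e \<otimes> a) * p (e \<otimes> b)"
    unfolding mult[OF ab] using ab e by (intro submult) auto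
  have "adj A (e \<otimes> a) = e \<otimes> adj A a" using ab e central[of "adj A a"] by (simp add: adj_mult)
  then show "p (e \<otimes> (adj A a \<otimes> a)) = (p (e \<otimes> a))\<^sup>2"
    using cstar[of "e \<otimes> a"] ab e by (simp add: mult)
qed (use e in \<open>simp_all add: r_distr triangle homogeneous\<close>)

end

lemma cstar_seminorm_iff:
  assumes "complex_star_algebra A"
  shows "cstar_seminorm A p \<longleftrightarrow> cstar_seminormed A p"
  using assms by (auto simp: cstar_seminorm_def cstar_seminormed_def cstar_seminormed_axioms_def)

locale cstar_seminormed_algebra = cstar_seminormed A "nrm A" for A :: "'a normed_star_algebra" (structure)
begin

definition null where "null = {a \<in> carrier A. nrm A a = 0}"

lemma null_star_ideal: "star_ideal A null"
proof -
  have sub: "subgroup null (add_monoid A)"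
  proof (rule add.subgroupI)
    fix a b assume "a \<in> null" "b \<in> null"
    then show "a \<oplus> b \<in> null"
      using triangle[of a b] nonneg[of "a \<oplus> b"] by (simp add: null_def del: nonneg)
  qed (auto simp: null_def uminus intro!: exI[of _ \<zero>])
  have "ideal null A"
  proof (rule idealI)
    fix a x assume a: "a \<in> null" "x \<in> carrier A"
    then show "x \<otimes> a \<in> null" using submult[of x a] nonneg[of "x \<otimes> a"]
      by (simp add: null_def del: nonneg)
    show "a \<otimes> x \<in> null" using a submult[of a x] nonneg[of "a \<otimes> x"]
      by (simp add: null_def del: nonneg)
  qed (use ring_axioms sub in auto)
  then show ?thesis
    by (intro star_ideal.intro star_ideal_axioms.intro complex_star_algebra_axioms)
      (auto simp: null_def adj_eq)
qed

text \<open>The quotient norm is an infimum over a coset, but the seminorm is constant on cosets of its null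
  ideal, so no infimum has to be computed. In particular the C*-identity is inherited.\<close>

lemma nrm_quotient:
  assumes "a \<in> carrier A"
  shows "nrm (star_quotient A null) (null +> a) = nrm A a"
proof -
  interpret star_ideal A null by (rule null_star_ideal)
  have "nrm A b = nrm A a" if b: "b \<in> null +> a" for b
  proof -
    note b = coset_memD[OF assms b]
    have "b \<ominus> a \<in> null" using coset_eq_iff[OF b(1) assms] b(2) by blast
    then have "\<bar>nrm A b - nrm A a\<bar> \<le> 0"
      using reverse_triangle[OF b(1) assms] by (simp only: null_def mem_Collect_eq)
    then show ?thesis by linarith
  qed
  moreover have "a \<in> null +> a" using assms by (rule a_rcos_self)
  ultimately have "nrm A ` (null +> a) = {nrm A a}" by blast
  then show ?thesis by (simp add: star_quotient_simps)
qed

lemma quotient_seminormed: "cstar_seminormed_algebra (star_quotient A null)"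
proof -
  let ?Q = "star_quotient A null"
  interpret I: star_ideal A null by (rule null_star_ideal)
  interpret Q: complex_star_algebra ?Q by (rule I.quotient_star_algebra)
  note q = star_homD(2-6)[OF I.coset_hom, symmetric]
  have "cstar_seminormed ?Q (nrm ?Q)"
  proof unfold_locales
    fix x y and c
    assume "x \<in> carrier ?Q" "y \<in> carrier ?Q"
    then obtain a b where a: "a \<in> carrier A" and b: "b \<in> carrier A"
      and xy: "x = null +> a" "y = null +> b" unfolding I.coset_carrier by blast
    show "0 \<le> nrm ?Q x"
      using a by (simp only: xy nrm_quotient nonneg)
    show "nrm ?Q (x \<oplus>\<^bsub>?Q\<^esub> y) \<le>
        nrm ?Q x + nrm ?Q y"
      using a b by (simp only: xy q nrm_quotient a_closed triangle)
    show "nrm ?Q (x \<otimes>\<^bsub>?Q\<^esub> y) \<le>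
        nrm ?Q x * nrm ?Q y"
      using a b by (simp only: xy q nrm_quotient m_closed submult)
    show "nrm ?Q (scal ?Q c x) =
        cmod c * nrm ?Q x"
      using a by (simp only: xy q nrm_quotient scal_closed homogeneous)
    show "nrm ?Q (adj ?Q x \<otimes>\<^bsub>?Q\<^esub> x) =
        (nrm ?Q x)\<^sup>2"
      using a by (simp only: xy q nrm_quotient m_closed adj_closed cstar)
  qed
  then show ?thesis by (simp add: cstar_seminormed_algebra_def)
qed

lemma quotient_definite:
  assumes "c \<in> carrier (star_quotient A null)" "nrm (star_quotient A null) c = 0"
  shows "c = \<zero>\<^bsub>star_quotient A null\<^esub>"
proof -
  interpret I: star_ideal A null by (rule null_star_ideal)
  obtain a where a: "a \<in> carrier A" "c = null +> a"
    using assms(1) unfolding I.coset_carrier by blast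
  have "nrm A a = 0" using assms(2) unfolding a(2) nrm_quotient[OF a(1)] .
  with a(1) have "a \<in> null" unfolding null_def by blast
  then have "null +> a = null" using I.coset_zero_iff[OF a(1)] by blast
  then show ?thesis unfolding a(2) star_quotient_simps .
qed

end

section \<open>Separated completions\<close>

locale cstar_completion = cstar_seminormed A p for A :: "'a star_algebra" (structure) and p
begin

abbreviation \<C> where "\<C> \<equiv> cauchy_algebra A p"
abbreviation \<N> where "\<N> \<equiv> null_sequences A p"

lemma cauchy_iff: "s \<in> carrier \<C> \<longleftrightarrow> (\<forall>n. s n \<in> carrier A) \<and>
    (\<forall>e>0. \<exists>N. \<forall>m\<ge>N. \<forall>n\<ge>N. p (s m \<ominus> s n) < e)"
  by (simp add: cauchy_algebra_def)

lemma cauchy_simps: "mult \<C> s t = (\<lambda>n. s n \<otimes> t n)" "one \<C> = (\<lambda>n. \<one>)" "zero \<C> = (\<lambda>n. \<zero>)"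
  "add \<C> s t = (\<lambda>n. s n \<oplus> t n)" "scal \<C> c s = (\<lambda>n. scal A c (s n))"
  "adj \<C> s = (\<lambda>n. adj A (s n))" "nrm \<C> s = lim (\<lambda>n. p (s n))"
  by (simp_all add: cauchy_algebra_def)

lemma cauchy_mem: "s \<in> carrier \<C> \<Longrightarrow> s n \<in> carrier A"
  by (simp add: cauchy_iff)

text \<open>One criterion for sums, products, scalar multiples and adjoints. For products, the constants are
  bounds of the two factors.\<close>

lemma cauchy_dominated:
  assumes s: "s \<in> carrier \<C>" and s': "s' \<in> carrier \<C>" and t: "\<And>n. t n \<in> carrier A"
    and le: "\<And>m n. p (t m \<ominus> t n) \<le> K * p (s m \<ominus> s n) + L * p (s' m \<ominus> s' n)"
  shows "t \<in> carrier \<C>"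
  unfolding cauchy_iff
proof (intro conjI allI impI t)
  fix e :: real assume "0 < e"
  define M where "M = \<bar>K\<bar> + \<bar>L\<bar> + 1"
  have "0 < e / M" using \<open>0 < e\<close> by (simp add: M_def add_nonneg_pos)
  then obtain N N' where N: "\<And>m n. m \<ge> N \<Longrightarrow> n \<ge> N \<Longrightarrow> p (s m \<ominus> s n) < e / M"
    and N': "\<And>m n. m \<ge> N' \<Longrightarrow> n \<ge> N' \<Longrightarrow> p (s' m \<ominus> s' n) < e / M"
    using s s' unfolding cauchy_iff by meson
  show "\<exists>N. \<forall>m\<ge>N. \<forall>n\<ge>N. p (t m \<ominus> t n) < e"
  proof (intro exI[of _ "max N N'"] allI impI)
    fix m n assume mn: "m \<ge> max N N'" "n \<ge> max N N'"
    have nonneg: "0 \<le> p (s m \<ominus> s n)" "0 \<le> p (s' m \<ominus> s' n)" using s s' by (simp_all add: cauchy_mem)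
    have "p (t m \<ominus> t n) \<le> \<bar>K\<bar> * p (s m \<ominus> s n) + \<bar>L\<bar> * p (s' m \<ominus> s' n)"
      using le[of m n] nonneg
      by (meson abs_ge_self add_mono mult_right_mono order_trans)
    also have "\<dots> \<le> \<bar>K\<bar> * (e / M) + \<bar>L\<bar> * (e / M)"
      using N[of m n] N'[of m n] mn by (intro add_mono mult_left_mono) auto
    also have "\<dots> = (\<bar>K\<bar> + \<bar>L\<bar>) * (e / M)" by (rule distrib_right[symmetric])
    also have "\<dots> < M * (e / M)"
      using \<open>0 < e / M\<close> by (intro mult_strict_right_mono) (auto simp: M_def)
    also have "\<dots> = e" using \<open>0 < e / M\<close> \<open>0 < e\<close> by auto
    finally show "p (t m \<ominus> t n) < e" .
  qed
qed

lemma cauchy_p: assumes "s \<in> carrier \<C>" shows "Cauchy (\<lambda>n. p (s n))"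
  unfolding Cauchy_def dist_real_def
proof (intro allI impI)
  fix e :: real assume "0 < e"
  then obtain N where N: "\<And>m n. m \<ge> N \<Longrightarrow> n \<ge> N \<Longrightarrow> p (s m \<ominus> s n) < e"
    using assms unfolding cauchy_iff by meson
  then show "\<exists>M. \<forall>m\<ge>M. \<forall>n\<ge>M. \<bar>p (s m) - p (s n)\<bar> < e"
    using reverse_triangle[of "s _" "s _"] cauchy_mem[OF assms] by (metis le_less_trans)
qed

lemma p_tendsto: "s \<in> carrier \<C> \<Longrightarrow> (\<lambda>n. p (s n)) \<longlonglongrightarrow> nrm \<C> s"
  using cauchy_p[of s] by (simp add: cauchy_simps Cauchy_convergent_iff convergent_LIMSEQ_iff)

lemma cauchy_bounded: assumes "s \<in> carrier \<C>" obtains K where "0 < K" "\<And>n. p (s n) \<le> K"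
proof -
  have "Bseq (\<lambda>n. p (s n))" using p_tendsto[OF assms] by (rule convergent_imp_Bseq[OF convergentI])
  then obtain K where "0 < K" "\<And>n. norm (p (s n)) \<le> K" by (auto elim: BseqE)
  then show ?thesis using that by (metis abs_le_D1 real_norm_def)
qed

lemma cauchy_add: assumes s: "s \<in> carrier \<C>" and t: "t \<in> carrier \<C>"
  shows "(\<lambda>n. s n \<oplus> t n) \<in> carrier \<C>"
proof (rule cauchy_dominated[OF s t, of _ 1 1])
  fix m n
  note mem = cauchy_mem[OF s] cauchy_mem[OF t]
  have "s m \<oplus> t m \<ominus> (s n \<oplus> t n) = (s m \<ominus> s n) \<oplus> (t m \<ominus> t n)" using mem by algebra
  then show "p (s m \<oplus> t m \<ominus> (s n \<oplus> t n)) \<le> 1 * p (s m \<ominus> s n) + 1 * p (t m \<ominus> t n)"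
    using mem by (simp add: triangle)
qed (simp add: cauchy_mem s t)

lemma cauchy_mult: assumes s: "s \<in> carrier \<C>" and t: "t \<in> carrier \<C>"
  shows "(\<lambda>n. s n \<otimes> t n) \<in> carrier \<C>"
proof -
  obtain K L where K: "0 < K" "\<And>n. p (s n) \<le> K" and L: "0 < L" "\<And>n. p (t n) \<le> L"
    using cauchy_bounded s t by metis
  note mem [simp] = cauchy_mem[OF s] cauchy_mem[OF t]
  show ?thesis
  proof (rule cauchy_dominated[OF s t, of _ L K])
    fix m n
    have "s m \<otimes> t m \<ominus> s n \<otimes> t n = (s m \<ominus> s n) \<otimes> t m \<oplus> s n \<otimes> (t m \<ominus> t n)"
      using mem by algebra
    then have "p (s m \<otimes> t m \<ominus> s n \<otimes> t n) \<le> p ((s m \<ominus> s n) \<otimes> t m) + p (s n \<otimes> (t m \<ominus> t n))"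
      by (simp add: triangle)
    also have "\<dots> \<le> p (s m \<ominus> s n) * p (t m) + p (s n) * p (t m \<ominus> t n)"
      by (intro add_mono submult) auto
    also have "\<dots> \<le> p (s m \<ominus> s n) * L + K * p (t m \<ominus> t n)"
      using K L by (intro add_mono mult_mono) auto
    finally show "p (s m \<otimes> t m \<ominus> s n \<otimes> t n) \<le> L * p (s m \<ominus> s n) + K * p (t m \<ominus> t n)"
      by (simp add: mult.commute)
  qed simp
qed

lemma cauchy_scal: assumes "s \<in> carrier \<C>" shows "(\<lambda>n. scal A c (s n)) \<in> carrier \<C>"
  by (rule cauchy_dominated[OF assms assms, of _ "cmod c" 0])
    (simp_all add: cauchy_mem[OF assms] homogeneous flip: scal_minus)

lemma cauchy_adj: assumes "s \<in> carrier \<C>" shows "(\<lambda>n. adj A (s n)) \<in> carrier \<C>"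
  by (rule cauchy_dominated[OF assms assms, of _ 1 0])
    (simp_all add: cauchy_mem[OF assms] adj_eq flip: adj_minus)

lemma cauchy_const: "a \<in> carrier A \<Longrightarrow> (\<lambda>n. a) \<in> carrier \<C>"
  by (simp add: cauchy_iff minus_eq_zero_iff[THEN iffD2])

lemmas cauchy_closed = cauchy_add cauchy_mult cauchy_scal cauchy_adj cauchy_const

lemma cauchy_star_algebra: "complex_star_algebra \<C>"
proof -
  have "abelian_group \<C>"
  proof (rule abelian_groupI)
    fix s assume s: "s \<in> carrier \<C>"
    show "\<exists>t\<in>carrier \<C>. t \<oplus>\<^bsub>\<C>\<^esub> s = \<zero>\<^bsub>\<C>\<^esub>"
      by (rule bexI[of _ "\<lambda>n. scal A (-1) (s n)"])
        (use s cauchy_scal[OF s, of "-1"] in \<open>auto simp: cauchy_simps cauchy_mem scal_minus_1 l_neg\<close>)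
  qed (auto simp: cauchy_simps cauchy_closed cauchy_mem a_ac)
  moreover have "monoid \<C>"
    by (rule monoidI) (auto simp: cauchy_simps cauchy_closed cauchy_mem m_assoc)
  ultimately have "ring \<C>"
    by (rule ringI) (auto simp: cauchy_simps cauchy_closed cauchy_mem l_distr r_distr)
  then show ?thesis
    by (rule complex_star_algebra.intro, unfold_locales)
      (auto simp: cauchy_simps cauchy_closed cauchy_mem scal_add_right scal_add_left adj_add
        adj_mult adj_scal)
qed

lemma cauchy_seminormed: "cstar_seminormed_algebra \<C>"
proof -
  interpret C: complex_star_algebra \<C> by (rule cauchy_star_algebra)
  have "cstar_seminormed \<C> (nrm \<C>)"
  proof unfold_locales
    fix s t and c assume s: "s \<in> carrier \<C>" and t: "t \<in> carrier \<C>"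
    note mem [simp] = cauchy_mem[OF s] cauchy_mem[OF t]
    note lim = p_tendsto[OF s] p_tendsto[OF t]
    show "0 \<le> nrm \<C> s"
      by (rule LIMSEQ_le_const[OF lim(1)]) auto
    show "nrm \<C> (s \<oplus>\<^bsub>\<C>\<^esub> t) \<le> nrm \<C> s + nrm \<C> t"
      by (rule LIMSEQ_le[OF p_tendsto[OF C.a_closed[OF s t]] tendsto_add[OF lim]])
        (auto simp: cauchy_simps triangle)
    show "nrm \<C> (s \<otimes>\<^bsub>\<C>\<^esub> t) \<le> nrm \<C> s * nrm \<C> t"
      by (rule LIMSEQ_le[OF p_tendsto[OF C.m_closed[OF s t]] tendsto_mult[OF lim]])
        (auto simp: cauchy_simps submult)
    have "(\<lambda>n. p (scal A c (s n))) \<longlonglongrightarrow> cmod c * nrm \<C> s"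
      using tendsto_mult[OF tendsto_const lim(1)] by (simp add: homogeneous)
    then show "nrm \<C> (scal \<C> c s) = cmod c * nrm \<C> s"
      using LIMSEQ_unique[OF p_tendsto[OF C.scal_closed[OF s]]] by (simp add: cauchy_simps)
    have "(\<lambda>n. p (adj A (s n) \<otimes> s n)) \<longlonglongrightarrow> (nrm \<C> s)\<^sup>2"
      using tendsto_power[OF lim(1), of 2] by (simp add: cstar)
    then show "nrm \<C> (adj \<C> s \<otimes>\<^bsub>\<C>\<^esub> s) = (nrm \<C> s)\<^sup>2"
      using LIMSEQ_unique[OF p_tendsto[OF C.m_closed[OF C.adj_closed[OF s] s]]]
      by (simp add: cauchy_simps)
  qed
  then show ?thesis by (simp add: cstar_seminormed_algebra_def)
qed

end
sublocale cstar_completion \<subseteq> C: cstar_seminormed_algebra "cauchy_algebra A p"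
  by (rule cauchy_seminormed)

context cstar_completion
begin

text \<open>Null sequences are automatically Cauchy, so they form the null ideal of the limit seminorm and the
  completion is an instance of the preceding quotient.\<close>

lemma null_sequences_eq: "\<N> = C.null"
proof (rule subset_antisym; rule subsetI)
  fix s assume s: "s \<in> \<N>"
  then have mem: "s n \<in> carrier A" for n by (simp add: null_sequences_def)
  have lim: "(\<lambda>n. p (s n)) \<longlonglongrightarrow> 0" using s by (simp add: null_sequences_def)
  have "s \<in> carrier \<C>"
    unfolding cauchy_iff
  proof (intro conjI allI impI mem)
    fix e :: real assume "0 < e"
    then have "\<forall>\<^sub>F n in sequentially. p (s n) < e / 2"
      using order_tendstoD(2)[OF lim, of "e / 2"] by simp
    then obtain N where N: "\<And>n. n \<ge> N \<Longrightarrow> p (s n) < e / 2"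
      by (auto simp: eventually_sequentially)
    show "\<exists>N. \<forall>m\<ge>N. \<forall>n\<ge>N. p (s m \<ominus> s n) < e"
    proof (intro exI allI impI)
      fix m n assume "m \<ge> N" "n \<ge> N"
      then show "p (s m \<ominus> s n) < e" using minus[OF mem mem, of m n] N[of m] N[of n] by simp
    qed
  qed
  then show "s \<in> C.null" using LIMSEQ_unique[OF p_tendsto lim] by (simp add: C.null_def)
next
  fix s assume "s \<in> C.null"
  then show "s \<in> \<N>" using p_tendsto[of s] by (auto simp: C.null_def null_sequences_def cauchy_mem)
qed

lemma completion_eq: "completion A p = star_quotient \<C> C.null"
  by (simp add: completion_def null_sequences_eq)

lemma completion_seminormed: "cstar_seminormed_algebra (completion A p)"
  unfolding completion_eq by (rule C.quotient_seminormed)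

lemma completion_definite: "c \<in> carrier (completion A p) \<Longrightarrow> nrm (completion A p) c = 0 \<Longrightarrow>
    c = \<zero>\<^bsub>completion A p\<^esub>"
  unfolding completion_eq by (rule C.quotient_definite)

lemma const_hom: "star_hom A \<C> (\<lambda>a n. a)"
  by (rule star_homI) (simp_all add: cauchy_simps cauchy_const)

lemma to_completion_hom: "star_hom A (completion A p) (to_completion A p)"
  unfolding completion_eq to_completion_def null_sequences_eq
  by (rule star_hom_comp[OF const_hom star_ideal.coset_hom[OF C.null_star_ideal]])

lemma nrm_to_completion: "a \<in> carrier A \<Longrightarrow> nrm (completion A p) (to_completion A p a) = p a"
  unfolding completion_eq to_completion_def null_sequences_eq
  by (subst C.nrm_quotient) (auto simp: cauchy_const cauchy_simps)

end

section \<open>Universal C*-seminorms\<close>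

text \<open>The boundedness makes the supremum that defines the universal seminorm a genuine least upper
  bound.\<close>

locale universal_cstar_data = complex_star_algebra A for A :: "'a star_algebra" (structure) +
  fixes R :: "'a set"
  assumes bounded: "a \<in> carrier A \<Longrightarrow>
    \<exists>K. \<forall>p. cstar_seminormed A p \<and> (\<forall>r\<in>R. p r = 0) \<longrightarrow> p a \<le> K"
begin

abbreviation \<S> where "\<S> \<equiv> {p. cstar_seminormed A p \<and> (\<forall>r\<in>R. p r = 0)}"
abbreviation \<sigma> where "\<sigma> \<equiv> universal_seminorm A R"

lemma universal_eq: "\<sigma> a = (SUP p\<in>\<S>. p a)"
  unfolding universal_seminorm_def cstar_seminorm_iff[OF complex_star_algebra_axioms]
  by (rule arg_cong[of _ _ Sup]) auto

lemma zero_seminorm: "(\<lambda>a. 0) \<in> \<S>"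
  by simp (unfold_locales, simp_all)

lemma le_universal: assumes "p \<in> \<S>" "a \<in> carrier A" shows "p a \<le> \<sigma> a"
  unfolding universal_eq using assms bounded[OF assms(2)]
  by (intro cSUP_upper) (auto intro: bdd_aboveI2)

lemma universal_le: assumes "\<And>p. p \<in> \<S> \<Longrightarrow> p a \<le> K" shows "\<sigma> a \<le> K"
  unfolding universal_eq using zero_seminorm assms by (intro cSUP_least) auto

lemma universal_vanishes: "r \<in> R \<Longrightarrow> \<sigma> r = 0"
proof -
  assume r: "r \<in> R"
  have ne: "\<S> \<noteq> {}" using zero_seminorm by blast
  have "(SUP p\<in>\<S>. p r) = (SUP p\<in>\<S>. 0)" using r by (intro SUP_cong) auto
  then show ?thesis unfolding universal_eq cSUP_const[OF ne] .
qed

text \<open>A pointwise supremum of C*-seminorms is a C*-seminorm: squaring is monotone on the nonnegative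
  reals, so it commutes with the supremum in the C*-identity.\<close>

lemma universal_seminormed: "cstar_seminormed A \<sigma>"
proof unfold_locales
  fix a b and c assume a: "a \<in> carrier A" and b: "b \<in> carrier A"
  note le = le_universal[OF _ a] le_universal[OF _ b]
  show nn: "0 \<le> \<sigma> x" if "x \<in> carrier A" for x
    using le_universal[OF zero_seminorm that] .
  show "\<sigma> (a \<oplus> b) \<le> \<sigma> a + \<sigma> b"
  proof (rule universal_le)
    fix p assume p: "p \<in> \<S>" then interpret p: cstar_seminormed A p by simp
    show "p (a \<oplus> b) \<le> \<sigma> a + \<sigma> b" using p.triangle[OF a b] le[OF p] by linarith
  qed
  show "\<sigma> (a \<otimes> b) \<le> \<sigma> a * \<sigma> b"
  proof (rule universal_le)
    fix p assume p: "p \<in> \<S>" then interpret p: cstar_seminormed A p by simp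
    have "p a * p b \<le> \<sigma> a * \<sigma> b" using le[OF p] a b nn by (intro mult_mono) auto
    then show "p (a \<otimes> b) \<le> \<sigma> a * \<sigma> b" using p.submult[OF a b] by linarith
  qed
  have scal_le: "\<sigma> (scal A d x) \<le> cmod d * \<sigma> x" if "x \<in> carrier A" for d x
  proof (rule universal_le)
    fix p assume p: "p \<in> \<S>" then interpret p: cstar_seminormed A p by simp
    show "p (scal A d x) \<le> cmod d * \<sigma> x"
      using that le_universal[OF p that] by (simp add: p.homogeneous mult_left_mono)
  qed
  show "\<sigma> (scal A c a) = cmod c * \<sigma> a"
  proof (cases "c = 0")
    case True
    then show ?thesis using scal_le[OF a, of 0] nn[of "scal A 0 a"] a by simp
  next
    case False
    then have "\<sigma> a \<le> cmod (inverse c) * \<sigma> (scal A c a)"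
      using scal_le[of "scal A c a" "inverse c"] a by simp
    then have "cmod c * \<sigma> a \<le> cmod c * (cmod (inverse c) * \<sigma> (scal A c a))"
      by (intro mult_left_mono) auto
    also have "\<dots> = \<sigma> (scal A c a)" using False by (simp flip: mult.assoc norm_mult)
    finally show ?thesis using scal_le[OF a, of c] by linarith
  qed
  show "\<sigma> (adj A a \<otimes> a) = (\<sigma> a)\<^sup>2"
  proof (rule antisym)
    show "\<sigma> (adj A a \<otimes> a) \<le> (\<sigma> a)\<^sup>2"
    proof (rule universal_le)
      fix p assume p: "p \<in> \<S>" then interpret p: cstar_seminormed A p by simp
      show "p (adj A a \<otimes> a) \<le> (\<sigma> a)\<^sup>2"
        unfolding p.cstar[OF a] using le(1)[OF p] a by (intro power_mono) auto
    qed
    have "\<sigma> a \<le> sqrt (\<sigma> (adj A a \<otimes> a))"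
    proof (rule universal_le)
      fix p assume p: "p \<in> \<S>" then interpret p: cstar_seminormed A p by simp
      have "(p a)\<^sup>2 \<le> \<sigma> (adj A a \<otimes> a)"
        using le_universal[OF p, of "adj A a \<otimes> a"] a by (simp add: p.cstar)
      then show "p a \<le> sqrt (\<sigma> (adj A a \<otimes> a))" by (rule real_le_rsqrt)
    qed
    then show "(\<sigma> a)\<^sup>2 \<le> \<sigma> (adj A a \<otimes> a)"
      using nn[OF a] nn[of "adj A a \<otimes> a"] a
      by (metis adj_closed m_closed power_mono real_sqrt_pow2)
  qed
qed

end

text \<open>By the triangle inequality, boundedness has to be checked on the basis only.\<close>

lemma (in star_monoid) bounded_on_algebraI:
  assumes "\<And>p. p \<in> \<P> \<Longrightarrow> cstar_seminormed \<A> p"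
    and "\<And>m. m \<in> carrier M \<Longrightarrow> \<exists>K. \<forall>p\<in>\<P>. p (basis_element m) \<le> K"
    and "f \<in> carrier \<A>"
  shows "\<exists>K. \<forall>p\<in>\<P>. p f \<le> K"
  using assms(3)
proof (induction f rule: span_induct)
  case zero
  show ?case by (rule exI[of _ 0]) (simp add: cstar_seminormed.zero[OF assms(1)])
next
  case (add c m f)
  obtain K L where K: "\<And>p. p \<in> \<P> \<Longrightarrow> p (basis_element m) \<le> K"
    and L: "\<And>p. p \<in> \<P> \<Longrightarrow> p f \<le> L" using assms(2)[OF add(1)] add(3) by blast
  have "p (scal \<A> c (basis_element m) \<oplus>\<^bsub>\<A>\<^esub> f) \<le> cmod c * K + L" if p: "p \<in> \<P>" for p
  proof -
    interpret p: cstar_seminormed \<A> p using assms(1) p .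
    have "p (scal \<A> c (basis_element m) \<oplus>\<^bsub>\<A>\<^esub> f) \<le> cmod c * p (basis_element m) + p f"
      using p.triangle[of "scal \<A> c (basis_element m)" f] p.homogeneous add by (simp add: closed)
    also have "\<dots> \<le> cmod c * K + L" using K[OF p] L[OF p] by (intro add_mono mult_left_mono) auto
    finally show ?thesis .
  qed
  then show ?case by blast
qed

section \<open>Words and groups given by generators and relations\<close>

lemma words_simps [simp]:
  "[] \<in> words G" "l # w \<in> words G \<longleftrightarrow> fst l \<in> G \<and> w \<in> words G"
  "v @ w \<in> words G \<longleftrightarrow> v \<in> words G \<and> w \<in> words G"
  by (auto simp: words_def mem_Times_iff)

lemma reverse_word_simps [simp]:
  "reverse_word [] = []" "reverse_word (l # w) = reverse_word w @ [(fst l, \<not> snd l)]"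
  "reverse_word (v @ w) = reverse_word w @ reverse_word v"
  by (auto simp: reverse_word_def split: prod.splits)

lemma reverse_reverse_word [simp]: "reverse_word (reverse_word w) = w"
  by (induction w) auto

lemma reverse_word_words [simp]: "w \<in> words G \<Longrightarrow> reverse_word w \<in> words G"
  by (induction w) auto

lemma word_monoid_simps [simp]:
  "carrier (word_monoid G) = words G" "mult (word_monoid G) = (@)" "one (word_monoid G) = []"
  by (simp_all add: word_monoid_def)

lemma star_monoid_words: "star_monoid (word_monoid G) reverse_word"
  by (unfold_locales) auto

lemma star_monoid_group: "group M \<Longrightarrow> star_monoid M (m_inv M)"
  by (rule star_monoid.intro) (auto simp: star_monoid_axioms_def group.inv_mult_group group.inv_inv
    group.inv_closed group.is_monoid)

lemma word_congruence_words:
  "(v, w) \<in> word_congruence G R \<Longrightarrow> v \<in> words G \<and> w \<in> words G"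
  by (induction rule: word_congruence.induct) auto

lemma word_congruence_append:
  assumes "(v, w) \<in> word_congruence G R" "a \<in> words G" "b \<in> words G"
  shows "(a @ v @ b, a @ w @ b) \<in> word_congruence G R"
  using assms
proof (induction rule: word_congruence.induct)
  case (cancel v w g e)
  then show ?case using word_congruence.cancel[of "a @ v" G "w @ b" g e R] by simp
next
  case (relation v w l r)
  then show ?case using word_congruence.relation[of "a @ v" G "w @ b" l r R] by simp
qed (auto intro: word_congruence.intros)

lemma equiv_word_congruence: "equiv (words G) (word_congruence G R)"
  by (rule equivI) (auto simp: refl_on_def sym_def trans_def dest: word_congruence_words
    intro: word_congruence.intros)

lemma word_class_eq_iff:
  "v \<in> words G \<Longrightarrow> w \<in> words G \<Longrightarrow>
    word_class G R v = word_class G R w \<longleftrightarrow> (v, w) \<in> word_congruence G R"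
  unfolding word_class_def by (rule eq_equiv_class_iff[OF equiv_word_congruence])

lemma presented_group_carrier: "carrier (presented_group G R) = word_class G R ` words G"
  by (auto simp: presented_group_def quotient_def word_class_def)

lemma presented_group_one: "\<one>\<^bsub>presented_group G R\<^esub> = word_class G R []"
  by (simp add: presented_group_def)

text \<open>The product of classes is a union over all pairs of representatives, which collapses because the
  word congruence is compatible with concatenation on both sides.\<close>

lemma word_class_mult:
  assumes "v \<in> words G" "w \<in> words G"
  shows "word_class G R v \<otimes>\<^bsub>presented_group G R\<^esub> word_class G R w = word_class G R (v @ w)"
proof -
  have "word_class G R (v' @ w') = word_class G R (v @ w)"
    if "v' \<in> word_class G R v" "w' \<in> word_class G R w" for v' w'
  proof -
    have vw: "(v, v') \<in> word_congruence G R" "(w, w') \<in> word_congruence G R"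
      using that by (simp_all add: word_class_def)
    have "v' \<in> words G" using vw(1) word_congruence_words by blast
    then have "(v @ w, v' @ w') \<in> word_congruence G R"
      using word_congruence_append[OF vw(1), of "[]" w] word_congruence_append[OF vw(2), of v' "[]"] assms
      by (auto intro: word_congruence.trans)
    then show ?thesis using word_class_eq_iff word_congruence_words by metis
  qed
  moreover have "v \<in> word_class G R v" "w \<in> word_class G R w"
    using assms by (auto simp: word_class_def intro: word_congruence.refl)
  ultimately have "(\<Union>v'\<in>word_class G R v. \<Union>w'\<in>word_class G R w. word_class G R (v' @ w')) =
      word_class G R (v @ w)" by blast
  then show ?thesis by (simp add: presented_group_def)
qed

text \<open>The reversed word cancels letter by letter from the middle outwards; this provides inverses.\<close>

lemma reverse_word_append_congruent:
  "w \<in> words G \<Longrightarrow> (reverse_word w @ w, []) \<in> word_congruence G R"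
proof (induction w)
  case Nil
  then show ?case by (auto intro: word_congruence.refl)
next
  case (Cons l w)
  obtain g e where l: "l = (g, e)" by (cases l)
  have "(reverse_word w @ [(g, \<not> e), (g, \<not> \<not> e)] @ w, reverse_word w @ w) \<in> word_congruence G R"
    using Cons.prems l by (intro word_congruence.cancel) auto
  then show ?case using Cons l by (auto intro: word_congruence.trans)
qed

lemma presented_group_group: "group (presented_group G R)"
proof (rule groupI)
  fix C assume "C \<in> carrier (presented_group G R)"
  then obtain w where w: "w \<in> words G" "C = word_class G R w" unfolding presented_group_carrier by blast
  then show "\<exists>D\<in>carrier (presented_group G R). D \<otimes>\<^bsub>presented_group G R\<^esub> C = \<one>\<^bsub>presented_group G R\<^esub>"
    by (auto simp: presented_group_carrier presented_group_one word_class_mult word_class_eq_iff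
        intro!: bexI[of _ "reverse_word w"] reverse_word_append_congruent)
qed (auto simp: presented_group_carrier presented_group_one word_class_mult)

lemma word_class_inv:
  assumes "w \<in> words G"
  shows "inv\<^bsub>presented_group G R\<^esub> (word_class G R w) = word_class G R (reverse_word w)"
proof -
  interpret group "presented_group G R" by (rule presented_group_group)
  show ?thesis
    by (rule inv_equality)
      (use assms in \<open>auto simp: presented_group_carrier presented_group_one word_class_mult
        word_class_eq_iff reverse_word_append_congruent\<close>)
qed

section \<open>Values of words in *-algebras\<close>

definition letter_value :: "('b, 'n) star_algebra_scheme \<Rightarrow> ('g \<Rightarrow> 'b) \<Rightarrow> 'g \<times> bool \<Rightarrow> 'b" where
  "letter_value B v l = (if snd l then v (fst l) else adj B (v (fst l)))"

text \<open>Lists fix the order of the factors. The products over the variables of a constraint are listed by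
  \<^const>\<open>sorted_list_of_set\<close>, as in the relations of the solution group.\<close>

definition list_product :: "('b, 'n) monoid_scheme \<Rightarrow> 'b list \<Rightarrow> 'b" where
  "list_product B bs = foldr (mult B) bs \<one>\<^bsub>B\<^esub>"

definition word_value :: "('b, 'n) star_algebra_scheme \<Rightarrow> ('g \<Rightarrow> 'b) \<Rightarrow> 'g word \<Rightarrow> 'b" where
  "word_value B v w = list_product B (map (letter_value B v) w)"

lemma list_product_simps [simp]:
  "list_product B [] = \<one>\<^bsub>B\<^esub>" "list_product B (b # bs) = b \<otimes>\<^bsub>B\<^esub> list_product B bs"
  by (simp_all add: list_product_def)

lemma (in monoid) list_product_closed: "set bs \<subseteq> carrier G \<Longrightarrow> list_product G bs \<in> carrier G"
  by (induction bs) auto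

lemma (in monoid) list_product_append:
  "set as \<subseteq> carrier G \<Longrightarrow> set bs \<subseteq> carrier G \<Longrightarrow>
    list_product G (as @ bs) = list_product G as \<otimes> list_product G bs"
  by (induction as) (auto simp: m_assoc list_product_closed)

locale word_valuation = complex_star_algebra B for B :: "('b, 'n) star_algebra_scheme" (structure) +
  fixes G :: "'g set" and v :: "'g \<Rightarrow> 'b"
  assumes gen_closed [simp, intro]: "g \<in> G \<Longrightarrow> v g \<in> carrier B"
begin

lemma letter_closed: "fst l \<in> G \<Longrightarrow> letter_value B v l \<in> carrier B"
  by (simp add: letter_value_def)

lemma letters_closed: "w \<in> words G \<Longrightarrow> set (map (letter_value B v) w) \<subseteq> carrier B"
  by (auto simp: words_def letter_closed)

lemma word_closed: "w \<in> words G \<Longrightarrow> word_value B v w \<in> carrier B"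
  unfolding word_value_def by (intro list_product_closed letters_closed)

lemma word_value_simps: "word_value B v [] = \<one>"
  "word_value B v (l # w) = letter_value B v l \<otimes> word_value B v w"
  by (simp_all add: word_value_def)

lemma word_value_letter: "g \<in> G \<Longrightarrow> word_value B v [(g, True)] = v g"
  by (simp add: word_value_simps letter_value_def)

lemma word_value_append: "w \<in> words G \<Longrightarrow> w' \<in> words G \<Longrightarrow>
    word_value B v (w @ w') = word_value B v w \<otimes> word_value B v w'"
  unfolding word_value_def by (simp add: list_product_append letters_closed del: set_map)

lemma word_value_reverse: "w \<in> words G \<Longrightarrow> word_value B v (reverse_word w) = adj B (word_value B v w)"
proof (induction w)
  case (Cons l w)
  then show ?case
    by (auto simp: word_value_append word_value_simps letter_closed word_closed adj_mult letter_value_def)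
qed (simp add: word_value_simps)

lemma word_representation: "monoid_representation (word_monoid G) reverse_word B (word_value B v)"
  by (intro monoid_representation.intro star_monoid_words complex_star_algebra_axioms
      monoid_representation_axioms.intro)
    (auto simp: word_closed word_value_append word_value_simps word_value_reverse)

end

locale presentation_valuation = word_valuation B G v
  for B :: "('b, 'n) star_algebra_scheme" (structure) and G :: "'g set" and v +
  fixes R :: "('g word \<times> 'g word) set"
  assumes unitary: "g \<in> G \<Longrightarrow> v g \<otimes> adj B (v g) = \<one>" "g \<in> G \<Longrightarrow> adj B (v g) \<otimes> v g = \<one>"
    and relations: "(l, r) \<in> R \<Longrightarrow> l \<in> words G \<Longrightarrow> r \<in> words G \<Longrightarrow> word_value B v l = word_value B v r"
begin

text \<open>Von Dyck's theorem: unitaries that satisfy the relations give congruent words the same value.\<close>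

lemma word_value_congruent:
  "(w, w') \<in> word_congruence G R \<Longrightarrow> word_value B v w = word_value B v w'"
proof (induction rule: word_congruence.induct)
  case (cancel w w' g e)
  then have "word_value B v [(g, e), (g, \<not> e)] = \<one>"
    by (auto simp: word_value_simps letter_value_def unitary)
  then show ?case using cancel word_value_append[of "[(g, e), (g, \<not> e)]" w']
    by (simp add: word_value_append word_closed)
next
  case (relation w w' l r)
  then show ?case by (simp add: word_value_append relations)
qed auto

definition class_value :: "'g word set \<Rightarrow> 'b" where
  "class_value C = word_value B v (SOME w. w \<in> C)"

lemma class_value_word_class: assumes "w \<in> words G"
  shows "class_value (word_class G R w) = word_value B v w"
proof -
  have "w \<in> word_class G R w" using assms by (auto simp: word_class_def intro: word_congruence.refl)
  then have "(SOME w'. w' \<in> word_class G R w) \<in> word_class G R w" by (rule someI)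
  then have "(w, SOME w'. w' \<in> word_class G R w) \<in> word_congruence G R" by (simp add: word_class_def)
  then show ?thesis unfolding class_value_def by (rule word_value_congruent[symmetric])
qed

text \<open>Together with the universal property of the group algebra, this turns every unitary solution of the
  relations into a *-homomorphism from the group algebra of the presented group.\<close>

lemma class_representation:
  "monoid_representation (presented_group G R) (m_inv (presented_group G R)) B class_value"
  by (intro monoid_representation.intro star_monoid_group presented_group_group
      complex_star_algebra_axioms monoid_representation_axioms.intro)
    (auto simp: presented_group_carrier presented_group_one word_class_mult word_class_inv
      class_value_word_class word_closed word_value_append word_value_simps word_value_reverse)

end

section \<open>Boundedness of the C*-seminorms\<close>

text \<open>\<open>p \<one> = (p \<one>)\<^sup>2\<close> leaves only the values \<open>0\<close> and \<open>1\<close>. The seminorms that vanish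
  identically are not excluded, so \<open>p \<one>\<close> need not be \<open>1\<close>.\<close>

lemma (in cstar_seminormed) p_one_le: "p \<one> \<le> 1"
proof -
  have "p \<one> = (p \<one>)\<^sup>2" using cstar[of \<one>] by simp
  then have "p \<one> * (p \<one> - 1) = 0" by (simp add: power2_eq_square algebra_simps)
  then show ?thesis by auto
qed

lemma (in cstar_seminormed) p_unitary_le:
  assumes "u \<in> carrier A" "adj A u \<otimes> u = \<one>" shows "p u \<le> 1"
  using cstar[OF assms(1)] p_one_le assms nonneg[OF assms(1)] power2_le_imp_le[of "p u" 1] by simp

text \<open>Modulo the null ideal, \<open>u\<close> is a projection, so \<open>p u = p (u\<^sup>* u) = (p u)\<^sup>2\<close>.\<close>

lemma (in cstar_seminormed) p_projection_le:
  assumes u: "u \<in> carrier A" and "p (u \<otimes> u \<ominus> u) = 0" "p (adj A u \<ominus> u) = 0" shows "p u \<le> 1"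
proof -
  have "adj A u \<otimes> u \<ominus> u = (adj A u \<ominus> u) \<otimes> u \<oplus> (u \<otimes> u \<ominus> u)" using u adj_closed[OF u] by algebra
  then have "p (adj A u \<otimes> u \<ominus> u) \<le> p (adj A u \<ominus> u) * p u + p (u \<otimes> u \<ominus> u)"
    using u triangle[of "(adj A u \<ominus> u) \<otimes> u" "u \<otimes> u \<ominus> u"] submult[of "adj A u \<ominus> u" u] by simp
  then have "p (adj A u \<otimes> u \<ominus> u) \<le> 0" using assms by simp
  then have "p (adj A u \<otimes> u) = p u" using reverse_triangle[of "adj A u \<otimes> u" u] u by simp
  then have "p u * (p u - 1) = 0" using cstar[OF u] by (simp add: power2_eq_square algebra_simps)
  then show ?thesis by auto
qed

lemma group_algebra_universal:
  assumes "group M" shows "universal_cstar_data (group_algebra M) {}"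
proof -
  interpret star_monoid M "m_inv M" by (rule star_monoid_group[OF assms])
  interpret group M by fact
  have "\<exists>K. \<forall>p\<in>{p. cstar_seminormed \<A> p}. p f \<le> K" if "f \<in> carrier \<A>" for f
  proof (rule bounded_on_algebraI[OF _ _ that])
    fix m assume m: "m \<in> carrier M"
    have "p (basis_element m) \<le> 1" if "cstar_seminormed \<A> p" for p
      using m by (intro cstar_seminormed.p_unitary_le[OF that])
        (auto simp: basis_adj basis_mult operations(1))
    then show "\<exists>K. \<forall>p\<in>{p. cstar_seminormed \<A> p}. p (basis_element m) \<le> K" by blast
  qed simp
  then show ?thesis
    using monoid_star_algebra by (auto simp: universal_cstar_data_def universal_cstar_data_axioms_def
      group_algebra_def)
qed

text \<open>Words are products of letters, each of which has seminorm at most 1.\<close>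

lemma free_algebra_universal:
  assumes "\<And>g. g \<in> G \<Longrightarrow> generator g \<otimes>\<^bsub>free_star_algebra G\<^esub> generator g
      \<ominus>\<^bsub>free_star_algebra G\<^esub> generator g \<in> R"
    and "\<And>g. g \<in> G \<Longrightarrow> adj (free_star_algebra G) (generator g)
      \<ominus>\<^bsub>free_star_algebra G\<^esub> generator g \<in> R"
  shows "universal_cstar_data (free_star_algebra G) R"
proof -
  interpret star_monoid "word_monoid G" reverse_word by (rule star_monoid_words)
  let ?P = "{p. cstar_seminormed \<A> p \<and> (\<forall>r\<in>R. p r = 0)}"
  have "\<exists>K. \<forall>p\<in>?P. p f \<le> K" if "f \<in> carrier \<A>" for f
  proof (rule bounded_on_algebraI[OF _ _ that])
    fix w assume w: "w \<in> carrier (word_monoid G)"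
    have "p (basis_element w) \<le> 1" if p: "p \<in> ?P" for p
    proof -
      interpret cstar_seminormed \<A> p using p by simp
      have gen: "p (generator g) \<le> 1" if "g \<in> G" for g
        using p that assms[OF that, unfolded free_star_algebra_def]
        by (intro p_projection_le) (auto simp: generator_def)
      have letter: "p (basis_element [l]) \<le> 1" if l: "fst l \<in> G" for l
      proof (cases "snd l")
        case True
        then show ?thesis using gen[OF l] by (cases l) (simp add: generator_def)
      next
        case False
        then have "basis_element [l] = adj \<A> (generator (fst l))"
          using l by (cases l) (simp add: generator_def basis_adj)
        then show ?thesis using gen[OF l] l by (simp add: adj_eq generator_def)
      qed
      from w show "p (basis_element w) \<le> 1"
      proof (induction w)
        case Nil
        then show ?case using p_one_le by (simp add: operations(1))
      next
        case (Cons l w)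
        have "p (basis_element (l # w)) \<le> p (basis_element [l]) * p (basis_element w)"
          using submult[of "basis_element [l]" "basis_element w"] Cons.prems
          by (simp add: basis_mult)
        also have "\<dots> \<le> 1 * 1"
          using Cons letter[of l] by (intro mult_mono) auto
        finally show ?case by simp
      qed
    qed
    then show "\<exists>K. \<forall>p\<in>?P. p (basis_element w) \<le> K" by blast
  qed simp
  then show ?thesis
    using monoid_star_algebra by (simp add: universal_cstar_data_def universal_cstar_data_axioms_def
      free_star_algebra_def)
qed

section \<open>Spectral projections of commuting involutions\<close>

context complex_star_algebra
begin

text \<open>For an involution \<open>u\<close> and a sign \<open>s\<close>, the spectral projection of \<open>u\<close> for the eigenvalue \<open>s\<close>.\<close>

definition half :: "complex \<Rightarrow> 'a \<Rightarrow> 'a" where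
  "half s u = scal A (1 / 2) (\<one> \<oplus> scal A s u)"

lemma half_closed [simp]: "u \<in> carrier A \<Longrightarrow> half s u \<in> carrier A"
  by (simp add: half_def)

lemma half_eigen:
  assumes "p \<in> carrier A" "u \<in> carrier A" "p \<otimes> u = scal A t p"
  shows "p \<otimes> half s u = scal A ((1 + s * t) / 2) p"
proof -
  have "p \<otimes> half s u = scal A (1 / 2) (scal A 1 p \<oplus> scal A (s * t) p)"
    using assms by (simp add: half_def r_distr)
  also have "\<dots> = scal A (1 / 2) (scal A (1 + s * t) p)"
    using scal_add_left[OF assms(1), of 1 "s * t"] by simp
  finally show ?thesis using assms by simp
qed

lemma half_mult_self:
  assumes "u \<in> carrier A" "u \<otimes> u = \<one>" "s * s = 1"
  shows "half s u \<otimes> u = scal A s (half s u)" "u \<otimes> half s u = scal A s (half s u)"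
proof -
  have "half s u \<otimes> u = scal A (1 / 2) (u \<oplus> scal A s \<one>)"
    using assms by (simp add: half_def l_distr)
  moreover have "scal A s (half s u) = scal A (1 / 2) (scal A s \<one> \<oplus> u)"
    using assms by (simp add: half_def scal_add_right mult.left_commute[of s])
  ultimately show "half s u \<otimes> u = scal A s (half s u)" using assms by (simp add: a_comm)
  moreover have "u \<otimes> half s u = half s u \<otimes> u"
    using assms by (simp add: half_def l_distr r_distr)
  ultimately show "u \<otimes> half s u = scal A s (half s u)" by simp
qed

lemma half_commute:
  assumes "b \<in> carrier A" "u \<in> carrier A" "b \<otimes> u = u \<otimes> b"
  shows "b \<otimes> half s u = half s u \<otimes> b"
  using assms by (simp add: half_def l_distr r_distr)

definition projection :: "'a \<Rightarrow> bool" where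
  "projection p \<longleftrightarrow> p \<in> carrier A \<and> p \<otimes> p = p \<and> adj A p = p"

lemma projectionD: assumes "projection p"
  shows "p \<in> carrier A" "p \<otimes> p = p" "adj A p = p"
  using assms by (auto simp: projection_def)

lemma half_projection:
  assumes "u \<in> carrier A" "u \<otimes> u = \<one>" "adj A u = u" "s \<in> {1, -1}"
  shows "projection (half s u)"
proof -
  have "half s u \<otimes> half s u = half s u"
    using half_eigen[of "half s u" u s s] half_mult_self(1)[of u s] assms by auto
  moreover have "adj A (half s u) = half s u"
    using assms by (auto simp: half_def adj_scal adj_add)
  ultimately show ?thesis using assms by (simp add: projection_def)
qed

lemma half_sum:
  assumes "u \<in> carrier A" shows "half 1 u \<oplus> half (-1) u = \<one>"
proof -
  have "half 1 u \<oplus> half (-1) u = scal A (1 / 2) ((\<one> \<oplus> u) \<oplus> (\<one> \<oplus> \<ominus> u))"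
    using assms by (simp add: half_def scal_minus_1 flip: scal_add_right)
  also have "(\<one> \<oplus> u) \<oplus> (\<one> \<oplus> \<ominus> u) = \<one> \<oplus> \<one>" using assms one_closed by algebra
  also have "scal A (1 / 2) (\<one> \<oplus> \<one>) = scal A (1 / 2 + 1 / 2) \<one>"
    unfolding scal_add_left[OF one_closed] by (simp add: scal_add_right)
  finally show ?thesis by simp
qed

lemma list_product_commute:
  assumes "b \<in> carrier A" "\<And>c. c \<in> set cs \<Longrightarrow> c \<in> carrier A \<and> b \<otimes> c = c \<otimes> b"
  shows "b \<otimes> list_product A cs = list_product A cs \<otimes> b"
  using assms(2)
proof (induction cs)
  case (Cons c cs)
  have c: "c \<in> carrier A" "b \<otimes> c = c \<otimes> b" and cs: "list_product A cs \<in> carrier A"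
    using Cons.prems by (auto intro!: list_product_closed)
  have "b \<otimes> (c \<otimes> list_product A cs) = c \<otimes> (b \<otimes> list_product A cs)"
    using c cs assms(1) by (simp flip: m_assoc)
  also have "\<dots> = c \<otimes> list_product A cs \<otimes> b"
    using Cons c cs assms(1) by (simp add: m_assoc)
  finally show ?case by simp
qed (use assms in simp)

lemma list_product_projection:
  assumes "\<And>c. c \<in> set cs \<Longrightarrow> projection c"
    and "\<And>c d. c \<in> set cs \<Longrightarrow> d \<in> set cs \<Longrightarrow> c \<otimes> d = d \<otimes> c"
  shows "projection (list_product A cs)"
  using assms
proof (induction cs)
  case (Cons c cs)
  define e where "e = list_product A cs"
  have c: "c \<in> carrier A" "c \<otimes> c = c" "adj A c = c" using Cons.prems(1)[of c] by (auto simp: projection_def)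
  have e: "e \<in> carrier A" "e \<otimes> e = e" "adj A e = e"
    using Cons by (auto simp: projection_def e_def)
  have ce: "c \<otimes> e = e \<otimes> c"
    unfolding e_def using Cons.prems c(1)
    by (intro list_product_commute) (auto simp: projection_def)
  have "(c \<otimes> e) \<otimes> (c \<otimes> e) = c \<otimes> (e \<otimes> c) \<otimes> e" using c(1) e(1) by (simp add: m_assoc)
  also have "\<dots> = (c \<otimes> c) \<otimes> (e \<otimes> e)" unfolding ce[symmetric] using c(1) e(1) by (simp add: m_assoc)
  finally have "(c \<otimes> e) \<otimes> (c \<otimes> e) = c \<otimes> e" using c(2) e(2) by simp
  moreover have "adj A (c \<otimes> e) = c \<otimes> e" using c e ce by (simp add: adj_mult)
  ultimately have "projection (c \<otimes> e)" using c e by (simp add: projection_def)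
  then show ?case by (simp add: e_def)
qed (simp add: projection_def)

text \<open>If every factor acts on \<open>p\<close> from the right as a scalar, then so does the product. Computing with
  products in this way, only scalars have to be reordered.\<close>

lemma list_product_eigen:
  assumes "p \<in> carrier A" "\<And>i. i \<in> set is \<Longrightarrow> f i \<in> carrier A \<and> p \<otimes> f i = scal A (c i) p"
  shows "p \<otimes> list_product A (map f is) = scal A (\<Prod>i\<leftarrow>is. c i) p"
  using assms(2)
proof (induction "is")
  case (Cons i "is")
  have f: "f i \<in> carrier A" "p \<otimes> f i = scal A (c i) p" and
    is_closed: "list_product A (map f is) \<in> carrier A"
    using Cons.prems by (auto intro!: list_product_closed)
  have "p \<otimes> (f i \<otimes> list_product A (map f is)) = scal A (c i) (p \<otimes> list_product A (map f is))"
    using f is_closed assms(1) by (simp flip: m_assoc)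
  then show ?case using Cons assms(1) by simp
qed (use assms in simp)

lemma constraint_product_eigen:
  assumes p: "p \<in> carrier A" and J: "J \<in> carrier A" "p \<otimes> J = scal A (-1) p"
    and u: "\<And>i. i \<in> set is \<Longrightarrow> u i \<in> carrier A \<and> p \<otimes> u i = scal A (c i) p"
  shows "p \<otimes> list_product A (replicate k J @ map u is) = scal A ((-1) ^ k * (\<Prod>i\<leftarrow>is. c i)) p"
proof -
  have "p \<otimes> list_product A (map (\<lambda>_. J) (replicate k ())) = scal A (\<Prod>_\<leftarrow>replicate k (). -1) p"
    using p J by (intro list_product_eigen) auto
  then have Js: "p \<otimes> list_product A (replicate k J) = scal A ((-1) ^ k) p"
    by (simp add: map_replicate_const prod_list_replicate)
  have us: "p \<otimes> list_product A (map u is) = scal A (\<Prod>i\<leftarrow>is. c i) p"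
    by (rule list_product_eigen[OF p u])
  have closed: "set (replicate k J) \<subseteq> carrier A" "set (map u is) \<subseteq> carrier A"
    using J u by auto
  have "p \<otimes> list_product A (replicate k J @ map u is) =
      p \<otimes> list_product A (replicate k J) \<otimes> list_product A (map u is)"
    using closed[THEN list_product_closed] p by (simp only: list_product_append[OF closed] m_assoc)
  also have "\<dots> = scal A ((-1) ^ k * (\<Prod>i\<leftarrow>is. c i)) p"
    using closed(2)[THEN list_product_closed] p by (simp add: Js us)
  finally show ?thesis .
qed

lemma eq_zero_if_scal_eq:
  assumes "a \<in> carrier A" "scal A c a = scal A d a" "c \<noteq> d"
  shows "a = \<zero>"
proof -
  have "scal A (c - d) a = scal A c a \<oplus> scal A (-1) (scal A d a)"
    using assms(1) scal_add_left[of a c "-d"] by simp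
  also have "scal A (-1) (scal A d a) = \<ominus> scal A c a"
    using assms(1) unfolding assms(2) by (simp only: scal_minus_1 scal_closed)
  finally have "scal A (c - d) a = \<zero>" using assms(1) by (simp only: r_neg scal_closed)
  then have "scal A (inverse (c - d)) (scal A (c - d) a) = \<zero>" by simp
  then show ?thesis using assms by simp
qed

end

definition tuples_on :: "nat set \<Rightarrow> (nat \<rightharpoonup> int) set" where
  "tuples_on V = {a. dom a = V \<and> ran a \<subseteq> {1, -1}}"

definition sign_at :: "(nat \<rightharpoonup> int) \<Rightarrow> nat \<Rightarrow> complex" where
  "sign_at a i = of_int (the (a i))"

lemma finite_tuples_on: "finite V \<Longrightarrow> finite (tuples_on V)"
  unfolding tuples_on_def by (rule finite_set_of_finite_maps) auto

lemma tuples_on_value: assumes "a \<in> tuples_on V" "i \<in> V" shows "a i = Some 1 \<or> a i = Some (-1)"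
proof -
  obtain s where s: "a i = Some s" using assms unfolding tuples_on_def by blast
  then have "s \<in> ran a" by (rule ranI)
  then show ?thesis using assms s unfolding tuples_on_def by auto
qed

lemma sign_at_cases: "a \<in> tuples_on V \<Longrightarrow> i \<in> V \<Longrightarrow> sign_at a i \<in> {1, -1}"
  using tuples_on_value[of a V i] by (auto simp: sign_at_def)

lemma tuples_on_eqI:
  assumes "a \<in> tuples_on V" "b \<in> tuples_on V" "\<And>i. i \<in> V \<Longrightarrow> sign_at a i = sign_at b i"
  shows "a = b"
proof
  fix i show "a i = b i"
  proof (cases "i \<in> V")
    case True
    then show ?thesis
      using assms(3)[OF True] tuples_on_value[OF assms(1)] tuples_on_value[OF assms(2)]
      by (force simp: sign_at_def)
  next
    case False
    then show ?thesis using assms(1,2) by (force simp: tuples_on_def)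
  qed
qed

lemma tuples_on_empty: "tuples_on {} = {Map.empty}"
  by (auto simp: tuples_on_def)

lemma tuples_on_insert: assumes "i \<notin> V"
  shows "tuples_on (insert i V) = (\<lambda>a. a(i \<mapsto> 1)) ` tuples_on V \<union> (\<lambda>a. a(i \<mapsto> -1)) ` tuples_on V"
proof (rule subset_antisym; rule subsetI)
  fix a assume a: "a \<in> tuples_on (insert i V)"
  define b where "b = a(i := None)"
  have "dom b = V" using a assms by (auto simp: b_def tuples_on_def)
  moreover have "ran b \<subseteq> ran a" by (auto simp: b_def ran_def)
  ultimately have "b \<in> tuples_on V" using a by (auto simp: tuples_on_def)
  moreover have "a = b(i \<mapsto> 1) \<or> a = b(i \<mapsto> -1)"
    using tuples_on_value[OF a, of i] by (auto simp: b_def)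
  ultimately show "a \<in> (\<lambda>a. a(i \<mapsto> 1)) ` tuples_on V \<union> (\<lambda>a. a(i \<mapsto> -1)) ` tuples_on V" by blast
next
  fix a assume "a \<in> (\<lambda>a. a(i \<mapsto> 1)) ` tuples_on V \<union> (\<lambda>a. a(i \<mapsto> -1)) ` tuples_on V"
  then obtain b s where b: "b \<in> tuples_on V" "a = b(i \<mapsto> s)" "s = 1 \<or> s = -1" by blast
  have "ran (b(i \<mapsto> s)) \<subseteq> insert s (ran b)" by (auto simp: ran_def)
  then show "a \<in> tuples_on (insert i V)" using b by (auto simp: tuples_on_def)
qed

lemma inj_on_upd_tuples: "i \<notin> V \<Longrightarrow> inj_on (\<lambda>a. a(i \<mapsto> s)) (tuples_on V)"
proof (rule inj_onI)
  fix a b assume i: "i \<notin> V" and ab: "a \<in> tuples_on V" "b \<in> tuples_on V" "a(i \<mapsto> s) = b(i \<mapsto> s)"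
  then have "a i = None" "b i = None" by (auto simp: tuples_on_def)
  then show "a = b" using ab(3) by (metis fun_upd_triv fun_upd_upd)
qed

lemma tuples_on_singleton: "tuples_on {y} = {[y \<mapsto> 1], [y \<mapsto> -1]}"
  unfolding tuples_on_insert[of y "{}", simplified] tuples_on_empty by auto

context complex_star_algebra
begin

text \<open>The joint spectral projection \<open>\<Prod>\<^sub>i (1 + a\<^sub>i u\<^sub>i) / 2\<close> for the eigenvalues \<open>a\<^sub>i\<close>.\<close>

definition joint :: "(nat \<Rightarrow> 'a) \<Rightarrow> nat list \<Rightarrow> (nat \<rightharpoonup> int) \<Rightarrow> 'a" where
  "joint u is a = list_product A (map (\<lambda>i. half (sign_at a i) (u i)) is)"

lemma joint_closed: "(\<And>i. i \<in> set is \<Longrightarrow> u i \<in> carrier A) \<Longrightarrow> joint u is a \<in> carrier A"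
  unfolding joint_def by (intro list_product_closed) auto

lemma joint_simps: "joint u [] a = \<one>" "joint u (i # is) a = half (sign_at a i) (u i) \<otimes> joint u is a"
  by (simp_all add: joint_def)

lemma joint_upd: "i \<notin> set is \<Longrightarrow> joint u is (a(i \<mapsto> s)) = joint u is a"
  unfolding joint_def by (intro arg_cong[of _ _ "list_product A"] map_cong) (auto simp: sign_at_def)

text \<open>With signs \<open>a i\<close> and \<open>t i\<close>, a factor \<open>(1 + a i * t i) / 2\<close> is 1 if they agree and 0 if
  they differ: \<open>joint u is a\<close> tests the eigenvalues \<open>t\<close> of \<open>p\<close> against \<open>a\<close>.\<close>

lemma joint_eigen:
  assumes "p \<in> carrier A" "\<And>i. i \<in> set is \<Longrightarrow> u i \<in> carrier A \<and> p \<otimes> u i = scal A (t i) p"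
  shows "p \<otimes> joint u is a = scal A (\<Prod>i\<leftarrow>is. (1 + sign_at a i * t i) / 2) p"
  unfolding joint_def using assms by (intro list_product_eigen) (auto simp: half_eigen)

text \<open>This is the expansion of \<open>\<Prod>\<^sub>i ((1 + u\<^sub>i) / 2 + (1 - u\<^sub>i) / 2) = 1\<close>. The
  order of the factors is that of the list on both sides.\<close>

lemma joint_sum:
  assumes "distinct is" "\<And>i. i \<in> set is \<Longrightarrow> u i \<in> carrier A"
  shows "(\<Oplus>a\<in>tuples_on (set is). joint u is a) = \<one>"
  using assms
proof (induction "is")
  case Nil
  then show ?case by (simp add: tuples_on_empty joint_simps)
next
  case (Cons i "is")
  let ?T = "tuples_on (set is)"
  have i: "i \<notin> set is" and u: "u i \<in> carrier A" using Cons.prems by auto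
  have fin: "finite ?T" by (simp add: finite_tuples_on)
  have closed: "\<And>a. joint u is a \<in> carrier A" "\<And>a. joint u (i # is) a \<in> carrier A"
    using Cons.prems by (auto intro!: joint_closed)
  have branch: "(\<Oplus>a\<in>(\<lambda>a. a(i \<mapsto> s)) ` ?T. joint u (i # is) a) = half (of_int s) (u i)" for s
  proof -
    have "(\<Oplus>a\<in>(\<lambda>a. a(i \<mapsto> s)) ` ?T. joint u (i # is) a) = (\<Oplus>a\<in>?T. joint u (i # is) (a(i \<mapsto> s)))"
      using closed by (intro finsum_reindex inj_on_upd_tuples i) auto
    also have "\<dots> = (\<Oplus>a\<in>?T. half (of_int s) (u i) \<otimes> joint u is a)"
      using closed u by (intro finsum_cong') (auto simp: joint_simps(2) joint_upd i sign_at_def)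
    also have "\<dots> = half (of_int s) (u i) \<otimes> (\<Oplus>a\<in>?T. joint u is a)"
      using closed u fin by (intro finsum_rdistr[symmetric]) auto
    also have "\<dots> = half (of_int s) (u i)" using Cons u by simp
    finally show ?thesis .
  qed
  have "(\<Oplus>a\<in>tuples_on (set (i # is)). joint u (i # is) a) =
      (\<Oplus>a\<in>(\<lambda>a. a(i \<mapsto> 1)) ` ?T. joint u (i # is) a) \<oplus> (\<Oplus>a\<in>(\<lambda>a. a(i \<mapsto> -1)) ` ?T. joint u (i # is) a)"
    unfolding list.set tuples_on_insert[OF i]
    by (rule finsum_Un_disjoint) (use closed fin in \<open>auto simp: fun_upd_eqD dest: fun_upd_eqD\<close>)
  also have "\<dots> = \<one>" unfolding branch using half_sum[OF u] by simp
  finally show ?case .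
qed

end

locale commuting_involutions = complex_star_algebra A for A :: "('a, 'm) star_algebra_scheme" (structure) +
  fixes u :: "nat \<Rightarrow> 'a" and V :: "nat set"
  assumes fin: "finite V"
    and u_closed [simp]: "i \<in> V \<Longrightarrow> u i \<in> carrier A"
    and u_adj: "i \<in> V \<Longrightarrow> adj A (u i) = u i"
    and u_square: "i \<in> V \<Longrightarrow> u i \<otimes> u i = \<one>"
    and u_commute: "i \<in> V \<Longrightarrow> j \<in> V \<Longrightarrow> u i \<otimes> u j = u j \<otimes> u i"
begin

abbreviation E where "E a \<equiv> joint u (sorted_list_of_set V) a"

lemma half_commutes: assumes "i \<in> V" "j \<in> V"
  shows "half s (u i) \<otimes> u j = u j \<otimes> half s (u i)"
    "half s (u i) \<otimes> half t (u j) = half t (u j) \<otimes> half s (u i)"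
proof -
  show *: "half s (u i) \<otimes> u j = u j \<otimes> half s (u i)"
    using assms u_commute half_commute[of "u j" "u i" s] by simp
  show "half s (u i) \<otimes> half t (u j) = half t (u j) \<otimes> half s (u i)"
    using assms * by (intro half_commute) auto
qed

lemma E_closed [simp]: "E a \<in> carrier A"
  by (rule joint_closed) (use fin in auto)

lemma E_projection: "a \<in> tuples_on V \<Longrightarrow> projection (E a)"
  unfolding joint_def using fin u_adj u_square
  by (intro list_product_projection)
    (auto simp: half_commutes intro!: half_projection dest: sign_at_cases)

lemma E_sum: "(\<Oplus>a\<in>tuples_on V. E a) = \<one>"
  using joint_sum[of "sorted_list_of_set V" u] fin by simp

lemma E_eigen: assumes "a \<in> tuples_on V" "i \<in> V" shows "E a \<otimes> u i = scal A (sign_at a i) (E a)"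
proof -
  have s: "sign_at a i * sign_at a i = 1" using sign_at_cases[OF assms] by auto
  have "joint u is a \<otimes> u i = scal A (sign_at a i) (joint u is a)"
    if "set is \<subseteq> V" "i \<in> set is" for "is"
    using that
  proof (induction "is")
    case (Cons j "is")
    then have j: "j \<in> V" and c: "joint u is a \<in> carrier A" by (auto intro!: joint_closed)
    have comm: "u i \<otimes> joint u is a = joint u is a \<otimes> u i"
      unfolding joint_def using Cons.prems assms(2)
      by (intro list_product_commute) (auto simp: half_commutes)
    show ?case
    proof (cases "j = i")
      case True
      have "joint u (j # is) a \<otimes> u i = (half (sign_at a i) (u i) \<otimes> u i) \<otimes> joint u is a"
        using True c assms(2) by (simp add: joint_simps m_assoc comm)
      then show ?thesis using True c assms(2) half_mult_self(1)[OF u_closed u_square s] 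
        by (simp add: joint_simps)
    next
      case False
      then have "joint u is a \<otimes> u i = scal A (sign_at a i) (joint u is a)" using Cons by auto
      then show ?thesis using c j assms(2) by (simp add: joint_simps m_assoc)
    qed
  qed simp
  then show ?thesis using fin assms by simp
qed

end

section \<open>Solutions of a constraint system in a *-algebra\<close>

locale constraint_system = fixes S :: "'x constraint_system" assumes lin: "linear_bcs S"
begin

abbreviation n where "n \<equiv> num_vars S"
abbreviation X where "X \<equiv> constraints S"
abbreviation T where "T \<equiv> sign_tuples n"

lemma n_pos: "1 \<in> {1..n}"
  using lin by (simp add: linear_bcs_def)

lemma vars_subset: "x \<in> X \<Longrightarrow> vars S x \<subseteq> {1..n}"
  using lin by (auto simp: linear_bcs_def)

lemma finite_vars: "x \<in> X \<Longrightarrow> finite (vars S x)"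
  using vars_subset finite_subset by blast

lemma variable_in_constraint: "i \<in> {1..n} \<Longrightarrow> \<exists>x\<in>X. i \<in> vars S x"
  using lin unfolding linear_bcs_def by blast

lemma tuples_on_subset: "V \<subseteq> {1..n} \<Longrightarrow> tuples_on V \<subseteq> T"
  by (auto simp: tuples_on_def sign_tuples_def)

lemma sign_tuple_on_dom: "a \<in> T \<Longrightarrow> a \<in> tuples_on (dom a)"
  by (simp add: tuples_on_def sign_tuples_def)

lemma satisfying_tuple: "a \<in> T \<Longrightarrow> satisfies S x a \<Longrightarrow> a \<in> tuples_on (vars S x)"
  using sign_tuple_on_dom[of a] by (simp add: satisfies_def)

lemma finite_T: "finite T"
proof -
  have "T \<subseteq> (\<Union>V\<in>Pow {1..n}. tuples_on V)"
    by (auto simp: tuples_on_def sign_tuples_def)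
  then show ?thesis by (rule finite_subset) (auto intro!: finite_tuples_on dest: finite_subset)
qed

lemma satisfies_iff:
  assumes "x \<in> X" "a \<in> tuples_on (vars S x)"
  shows "satisfies S x a \<longleftrightarrow> (-1) ^ parity S x * (\<Prod>i\<in>vars S x. sign_at a i) = 1"
proof -
  have "(-1) ^ parity S x * (\<Prod>i\<in>vars S x. sign_at a i) =
      complex_of_int ((-1) ^ parity S x * (\<Prod>i\<in>vars S x. the (a i)))"
    by (simp add: sign_at_def)
  moreover have "dom a = vars S x" using assms by (simp add: tuples_on_def)
  ultimately show ?thesis unfolding satisfies_def by (metis of_int_1 of_int_eq_iff)
qed

end

text \<open>A solution of the system by involutions of \<open>A\<close>, with an involution \<open>J\<close> that commutes with
  them in place of \<open>-1\<close>.
  Such data amount to a representation of the solution group in \<open>A\<close>.\<close>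

locale operator_solution = constraint_system S + complex_star_algebra A
  for S :: "'x constraint_system" and A :: "('a, 'm) star_algebra_scheme" (structure) +
  fixes u :: "nat \<Rightarrow> 'a" and J :: 'a
  assumes u_closed [simp]: "i \<in> {1..n} \<Longrightarrow> u i \<in> carrier A"
    and u_adj: "i \<in> {1..n} \<Longrightarrow> adj A (u i) = u i"
    and u_square: "i \<in> {1..n} \<Longrightarrow> u i \<otimes> u i = \<one>"
    and u_commute: "x \<in> X \<Longrightarrow> i \<in> vars S x \<Longrightarrow> j \<in> vars S x \<Longrightarrow> u i \<otimes> u j = u j \<otimes> u i"
    and J_closed [simp]: "J \<in> carrier A"
    and J_adj: "adj A J = J"
    and J_square: "J \<otimes> J = \<one>"
    and J_commute: "i \<in> {1..n} \<Longrightarrow> J \<otimes> u i = u i \<otimes> J"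
    and constraint: "x \<in> X \<Longrightarrow>
      list_product A (replicate (parity S x) J @ map u (sorted_list_of_set (vars S x))) = \<one>"
begin

lemma involutions: "x \<in> X \<Longrightarrow> commuting_involutions A u (vars S x)"
  using vars_subset[of x] finite_vars[of x]
  by unfold_locales (auto simp: u_adj u_square subset_iff intro: u_commute)

lemma single_involution: "i \<in> {1..n} \<Longrightarrow> commuting_involutions A u {i}"
  by unfold_locales (auto simp: u_adj u_square)

text \<open>The value at a question with variables \<open>V\<close> and the answer \<open>a\<close>. Answers with the wrong index set
  never win, and they are sent to \<open>\<zero>\<close>. Both players are covered: Alice has
  \<open>V = vars S x\<close> and Bob has \<open>V = {y}\<close>.\<close>

definition value_on :: "nat set \<Rightarrow> (nat \<rightharpoonup> int) \<Rightarrow> 'a" where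
  "value_on V a = (if dom a = V then joint u (sorted_list_of_set V) a else \<zero>)"

definition game_value :: "('x, nat, nat \<rightharpoonup> int, nat \<rightharpoonup> int) game_gen \<Rightarrow> 'a" where
  "game_value g = (case g of PGen x a \<Rightarrow> value_on (vars S x) a | QGen y b \<Rightarrow> value_on {y} b)"

lemma value_on_projection:
  assumes "commuting_involutions A u V" "a \<in> T"
  shows "projection (value_on V a)"
proof -
  interpret commuting_involutions A u V by fact
  show ?thesis
    using assms(2) E_projection[of a] sign_tuple_on_dom[of a]
    by (auto simp: value_on_def projection_def)
qed

lemma value_on_sum:
  assumes "commuting_involutions A u V" "V \<subseteq> {1..n}"
  shows "(\<Oplus>a\<in>T. value_on V a) = \<one>"
proof -
  interpret commuting_involutions A u V by fact
  have "(\<Oplus>a\<in>T. value_on V a) = (\<Oplus>a\<in>tuples_on V. E a)"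
  proof (rule add.finprod_mono_neutral_cong_right[OF finite_T tuples_on_subset[OF assms(2)]])
    show "value_on V a = \<zero>" if "a \<in> T - tuples_on V" for a
      using that sign_tuple_on_dom[of a] by (auto simp: value_on_def)
    show "value_on V a = E a" if "a \<in> tuples_on V" for a
      using that by (auto simp: value_on_def tuples_on_def)
    show "value_on V \<in> T \<rightarrow> carrier A" by (auto simp: value_on_def)
  qed
  then show ?thesis using E_sum by simp
qed

lemma value_on_disagree:
  assumes x: "x \<in> X" and j: "j \<in> vars S x" "a \<in> T" "b \<in> T" "dom b = {j}" "a j \<noteq> b j"
  shows "value_on (vars S x) a \<otimes> value_on {j} b = \<zero>"
proof (cases "dom a = vars S x")
  case True
  interpret commuting_involutions A u "vars S x" by (rule involutions[OF x])
  have a: "a \<in> tuples_on (vars S x)" and b: "b \<in> tuples_on {j}"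
    using sign_tuple_on_dom j True by metis+
  have st: "sign_at b j * sign_at a j = -1"
    using tuples_on_value[OF a j(1)] tuples_on_value[OF b, of j] j(5) by (auto simp: sign_at_def)
  have "E a \<otimes> joint u [j] b = scal A (\<Prod>i\<leftarrow>[j]. (1 + sign_at b i * sign_at a i) / 2) (E a)"
    using j(1) a by (intro joint_eigen) (auto simp: E_eigen)
  also have "\<dots> = \<zero>" using st by simp
  finally show ?thesis using True j(4) by (simp add: value_on_def)
next
  case False
  have "value_on {j} b \<in> carrier A"
    using value_on_projection[OF single_involution, of j b] vars_subset[OF x] j
    by (auto simp: projection_def)
  then show ?thesis using False by (simp add: value_on_def)
qed

text \<open>The projection onto the part of \<open>A\<close> on which \<open>J\<close> acts as \<open>-1\<close>.\<close>

definition e where "e = half (-1) J"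

lemma e_projection: "projection e"
  unfolding e_def by (rule half_projection) (simp_all add: J_square J_adj)

lemma e_closed [simp]: "e \<in> carrier A"
  using e_projection by (simp add: projection_def)

lemma e_J: "e \<otimes> J = scal A (-1) e"
  unfolding e_def by (rule half_mult_self(1)) (simp_all add: J_square)

lemma J_commute_value:
  assumes "commuting_involutions A u V" "V \<subseteq> {1..n}"
  shows "J \<otimes> value_on V a = value_on V a \<otimes> J"
proof -
  interpret commuting_involutions A u V by fact
  have "u i \<in> carrier A \<and> J \<otimes> u i = u i \<otimes> J" if "i \<in> V" for i
    using assms(2) that J_commute[of i] by auto
  then have "J \<otimes> E a = E a \<otimes> J"
    unfolding joint_def using fin by (intro list_product_commute) (auto intro: half_commute)
  then show ?thesis by (simp add: value_on_def)
qed

text \<open>Multiplying \<open>q = e E\<^sub>a\<close> by the constraint \<open>J\<^sup>\<rho> \<Prod> u\<^sub>k = 1\<close> from the right gives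
  \<open>q = ((-1)\<^sup>\<rho> \<Prod> a\<^sub>k) q\<close>. If \<open>a\<close> violates the constraint, the scalar is not 1 and so \<open>q = 0\<close>.
  This is where the sign \<open>J = -1\<close> enters the relations of the game.\<close>

lemma value_on_unsatisfied:
  assumes x: "x \<in> X" and a: "a \<in> T" "\<not> satisfies S x a"
  shows "e \<otimes> value_on (vars S x) a = \<zero>"
proof (cases "dom a = vars S x")
  case True
  interpret commuting_involutions A u "vars S x" by (rule involutions[OF x])
  have a_on: "a \<in> tuples_on (vars S x)" using sign_tuple_on_dom[OF a(1)] True by simp
  have E: "value_on (vars S x) a = E a" using True by (simp add: value_on_def)
  define q where "q = e \<otimes> E a"
  have q: "q \<in> carrier A" by (simp add: q_def)
  have "q \<otimes> J = e \<otimes> (E a \<otimes> J)" by (simp add: q_def m_assoc)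
  also have "E a \<otimes> J = J \<otimes> E a"
    using J_commute_value[OF involutions[OF x] vars_subset[OF x], of a] E by simp
  also have "e \<otimes> (J \<otimes> E a) = scal A (-1) q"
    by (simp add: q_def e_J flip: m_assoc)
  finally have qJ: "q \<otimes> J = scal A (-1) q" .
  have "q \<otimes> u i = scal A (sign_at a i) q" if "i \<in> vars S x" for i
    using that by (simp add: q_def m_assoc E_eigen[OF a_on])
  then have "q \<otimes> list_product A (replicate (parity S x) J @ map u (sorted_list_of_set (vars S x))) =
      scal A ((-1) ^ parity S x * (\<Prod>i\<leftarrow>sorted_list_of_set (vars S x). sign_at a i)) q"
    using q qJ fin by (intro constraint_product_eigen) auto
  then have "scal A 1 q = scal A ((-1) ^ parity S x * (\<Prod>i\<in>vars S x. sign_at a i)) q"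
    using q fin by (simp add: constraint[OF x] flip: prod.distinct_set_conv_list)
  then have "q = \<zero>"
    using q satisfies_iff[OF x a_on] a(2) by (intro eq_zero_if_scal_eq[of q 1]) auto
  then show ?thesis by (simp add: q_def E)
qed (simp add: value_on_def)

end

section \<open>Every representation of the game comes from a solution\<close>

text \<open>The relations of the game C*-algebra, in an arbitrary *-algebra. Orthogonality of the projections
  of one question is not among the relations. For Alice it is derived below from the interplay of
  \<open>p\<close> and \<open>q\<close>, algebraically and not by positivity as in a C*-algebra.\<close>

locale game_representation = constraint_system S + complex_star_algebra A
  for S :: "'x constraint_system" and A :: "('a, 'm) star_algebra_scheme" (structure) +
  fixes p :: "'x \<Rightarrow> (nat \<rightharpoonup> int) \<Rightarrow> 'a" and q :: "nat \<Rightarrow> (nat \<rightharpoonup> int) \<Rightarrow> 'a"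
  assumes p_projection: "x \<in> X \<Longrightarrow> a \<in> T \<Longrightarrow> projection (p x a)"
    and q_projection: "y \<in> {1..n} \<Longrightarrow> b \<in> T \<Longrightarrow> projection (q y b)"
    and p_sum: "x \<in> X \<Longrightarrow> (\<Oplus>a\<in>T. p x a) = \<one>"
    and q_sum: "y \<in> {1..n} \<Longrightarrow> (\<Oplus>b\<in>T. q y b) = \<one>"
    and losing: "x \<in> X \<Longrightarrow> y \<in> {1..n} \<Longrightarrow> a \<in> T \<Longrightarrow> b \<in> T \<Longrightarrow> \<not> lcs_wins S x y a b \<Longrightarrow>
      p x a \<otimes> q y b = \<zero>"
begin

lemma p_closed [simp]: "x \<in> X \<Longrightarrow> a \<in> T \<Longrightarrow> p x a \<in> carrier A"
  using p_projection by (simp add: projection_def)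

lemma q_closed [simp]: "y \<in> {1..n} \<Longrightarrow> b \<in> T \<Longrightarrow> q y b \<in> carrier A"
  using q_projection by (simp only: projection_def)

text \<open>If \<open>a\<close> violates \<open>x\<close>, the pair \<open>(a, b)\<close> loses for all \<open>b\<close>, hence
  \<open>p\<^sub>a = p\<^sub>a \<Sum>\<^sub>b q\<^sub>b = 0\<close>. This needs some question for Bob; variable 1 exists.\<close>

lemma p_unsatisfied:
  assumes "x \<in> X" "a \<in> T" "\<not> satisfies S x a" shows "p x a = \<zero>"
proof -
  have "p x a = p x a \<otimes> (\<Oplus>b\<in>T. q 1 b)" using assms q_sum[OF n_pos] by simp
  also have "\<dots> = (\<Oplus>b\<in>T. p x a \<otimes> q 1 b)"
    using assms q_closed[OF n_pos] finite_T by (intro finsum_rdistr) auto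
  also have "\<dots> = (\<Oplus>b\<in>T. \<zero>)"
    using assms losing[OF assms(1) n_pos assms(2)] by (intro finsum_cong') (auto simp: lcs_wins_def)
  finally show ?thesis by simp
qed

lemma q_wrong_domain:
  assumes "y \<in> {1..n}" "b \<in> T" "dom b \<noteq> {y}" shows "q y b = \<zero>"
proof -
  obtain x where x: "x \<in> X" using variable_in_constraint[OF assms(1)] by blast
  have "q y b = (\<Oplus>a\<in>T. p x a) \<otimes> q y b" using q_closed[OF assms(1,2)] p_sum[OF x] by simp
  also have "\<dots> = (\<Oplus>a\<in>T. p x a \<otimes> q y b)"
    using x q_closed[OF assms(1,2)] finite_T by (intro finsum_ldistr) auto
  also have "\<dots> = (\<Oplus>a\<in>T. \<zero>)"
    using assms losing[OF x assms(1) _ assms(2)] by (intro finsum_cong') (auto simp: lcs_wins_def)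
  finally show ?thesis by simp
qed

lemma singletons_in_T: assumes "y \<in> {1..n}" shows "[y \<mapsto> 1] \<in> T" "[y \<mapsto> -1] \<in> T"
  using assms tuples_on_subset[of "{y}"] tuples_on_singleton[of y] by auto

lemma q_complement: assumes y: "y \<in> {1..n}" shows "q y [y \<mapsto> 1] \<oplus> q y [y \<mapsto> -1] = \<one>"
proof -
  note sT = singletons_in_T[OF y]
  have ne: "[y \<mapsto> 1] \<noteq> [y \<mapsto> (-1 :: int)]" by (auto dest: fun_upd_eqD)
  have "(\<Oplus>b\<in>T. q y b) = (\<Oplus>b\<in>{[y \<mapsto> 1], [y \<mapsto> -1]}. q y b)"
  proof (rule add.finprod_mono_neutral_cong_right[OF finite_T])
    show "q y b = \<zero>" if "b \<in> T - {[y \<mapsto> 1], [y \<mapsto> -1]}" for b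
      using that sign_tuple_on_dom[of b] tuples_on_singleton[of y] by (intro q_wrong_domain y) auto
  qed (use sT q_closed[OF y] in auto)
  also have "\<dots> = q y [y \<mapsto> 1] \<oplus> q y [y \<mapsto> -1]"
    using ne sT q_closed[OF y] by (subst finsum_insert) auto
  finally show ?thesis using q_sum[OF y] by simp
qed

text \<open>Bob's observable. By the previous lemmas only his answers \<open>1\<close> and \<open>-1\<close> to \<open>y\<close> survive.\<close>

definition u where "u y = q y [y \<mapsto> 1] \<ominus> q y [y \<mapsto> -1]"

context
  fixes y assumes y: "y \<in> {1..n}"
begin

lemma q_minus: "q y [y \<mapsto> -1] = \<one> \<ominus> q y [y \<mapsto> 1]"
proof -
  have "q y [y \<mapsto> 1] \<in> carrier A" "q y [y \<mapsto> -1] \<in> carrier A"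
    using q_closed[OF y] singletons_in_T[OF y] by auto
  then show ?thesis by (simp only: add_minus_cancel flip: q_complement[OF y])
qed

lemma u_properties: "u y \<in> carrier A" "adj A (u y) = u y" "u y \<otimes> u y = \<one>"
  and q_half: "q y [y \<mapsto> 1] = half 1 (u y)" "q y [y \<mapsto> -1] = half (-1) (u y)"
proof -
  define r where "r = q y [y \<mapsto> 1]"
  have r: "r \<in> carrier A" "r \<otimes> r = r" "adj A r = r"
    using q_projection[OF y singletons_in_T(1)[OF y]] by (auto simp: r_def projection_def)
  have u: "u y = r \<ominus> (\<one> \<ominus> r)" by (simp add: u_def q_minus r_def)
  show uc: "u y \<in> carrier A" using r by (simp add: u)
  show "adj A (u y) = u y" using r by (simp add: u adj_minus)
  define t where "t = \<one> \<ominus> r"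
  have t: "t \<in> carrier A" "r \<otimes> t = \<zero>" "t \<otimes> r = \<zero>"
    using r by (simp_all add: t_def mult_minus_distrib minus_mult_distrib minus_eq_zero_iff)
  then have "t \<otimes> t = t"
    using r(1) minus_mult_distrib[of t \<one> r] by (simp add: t_def[symmetric])
  moreover have "u y \<otimes> u y = (r \<otimes> r \<ominus> r \<otimes> t) \<ominus> (t \<otimes> r \<ominus> t \<otimes> t)"
    unfolding u t_def[symmetric] using r(1) t(1) by algebra
  moreover have "r \<ominus> (\<zero> \<ominus> t) = r \<oplus> t" using r(1) t(1) by algebra
  moreover have "r \<oplus> t = \<one>" unfolding t_def using r(1) one_closed by algebra
  ultimately show "u y \<otimes> u y = \<one>" using r t by simp
  have "\<one> \<oplus> u y = r \<oplus> r" unfolding u using r(1) one_closed by algebra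
  then have "half 1 (u y) = scal A (1 / 2 + 1 / 2) r"
    unfolding half_def scal_add_left[OF r(1)] using r(1) uc by (simp add: scal_add_right)
  then show *: "q y [y \<mapsto> 1] = half 1 (u y)" using r by (simp add: r_def)
  show "q y [y \<mapsto> -1] = half (-1) (u y)"
    unfolding q_minus * half_sum[OF uc, symmetric]
    by (rule add_minus_cancel) (simp_all add: uc)
qed

end

lemma u_closed_vars: "x \<in> X \<Longrightarrow> i \<in> vars S x \<Longrightarrow> u i \<in> carrier A"
  using vars_subset[of x] by (intro u_properties(1)) blast

text \<open>Of Bob's two answers to \<open>i\<close>, the one that differs from \<open>a\<^sub>i\<close> loses against \<open>a\<close>. So \<open>p\<^sub>a\<close> is
  absorbed by the spectral projection of \<open>u\<^sub>i\<close> for \<open>a\<^sub>i\<close>; the second equation is the adjoint of the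
  first.\<close>

lemma p_eigen:
  assumes x: "x \<in> X" and a: "a \<in> T" "satisfies S x a" and i: "i \<in> vars S x"
  shows "p x a \<otimes> u i = scal A (sign_at a i) (p x a)" "u i \<otimes> p x a = scal A (sign_at a i) (p x a)"
proof -
  have in_n: "i \<in> {1..n}" using vars_subset[OF x] i by blast
  have dom_a: "dom a = vars S x" using a(2) by (simp add: satisfies_def)
  have a_on: "a \<in> tuples_on (vars S x)" using sign_tuple_on_dom[OF a(1)] dom_a by simp
  note sT = singletons_in_T[OF in_n]
  have qc: "q i [i \<mapsto> 1] \<in> carrier A" "q i [i \<mapsto> -1] \<in> carrier A" using q_closed[OF in_n] sT by auto
  have pc: "p x a \<in> carrier A" using x a by simp
  have whole: "p x a = p x a \<otimes> q i [i \<mapsto> 1] \<oplus> p x a \<otimes> q i [i \<mapsto> -1]"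
    using q_complement[OF in_n] pc qc by (simp flip: r_distr)
  have diff: "p x a \<otimes> u i = p x a \<otimes> q i [i \<mapsto> 1] \<ominus> p x a \<otimes> q i [i \<mapsto> -1]"
    unfolding u_def by (rule mult_minus_distrib[OF pc qc])
  show *: "p x a \<otimes> u i = scal A (sign_at a i) (p x a)"
    using tuples_on_value[OF a_on i]
  proof
    assume s: "a i = Some 1"
    then have z: "p x a \<otimes> q i [i \<mapsto> -1] = \<zero>"
      using i by (intro losing x in_n a sT) (simp add: lcs_wins_def)
    show ?thesis using s whole diff pc qc unfolding z by (simp add: sign_at_def)
  next
    assume s: "a i = Some (-1)"
    then have z: "p x a \<otimes> q i [i \<mapsto> 1] = \<zero>"
      using i by (intro losing x in_n a sT) (simp add: lcs_wins_def)
    show ?thesis using s whole diff pc qc unfolding z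
      by (simp add: sign_at_def a_minus_def scal_minus_1)
  qed
  have "adj A (p x a \<otimes> u i) = u i \<otimes> p x a"
    using pc u_properties[OF in_n] projectionD(3)[OF p_projection[OF x a(1)]] by (simp add: adj_mult)
  moreover have "cnj (sign_at a i) = sign_at a i" by (simp add: sign_at_def)
  ultimately show "u i \<otimes> p x a = scal A (sign_at a i) (p x a)"
    using pc projectionD(3)[OF p_projection[OF x a(1)]] by (simp add: * adj_scal)
qed

text \<open>Since \<open>\<Sum>\<^sub>a p\<^sub>a = 1\<close>, an equation may be tested after multiplication by every \<open>p\<^sub>a\<close>. There, by
  the preceding lemma, each \<open>u\<^sub>i\<close> of the constraint becomes the scalar \<open>a\<^sub>i\<close>, and the relations of
  the solution group become identities between signs.\<close>

lemma p_separates: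
  assumes x: "x \<in> X" and z: "z \<in> carrier A" "z' \<in> carrier A"
    and eq: "\<And>a. a \<in> T \<Longrightarrow> satisfies S x a \<Longrightarrow> p x a \<otimes> z = p x a \<otimes> z'"
  shows "z = z'"
proof -
  have expand: "w = (\<Oplus>a\<in>T. p x a \<otimes> w)" if w: "w \<in> carrier A" for w
  proof -
    have "w = (\<Oplus>a\<in>T. p x a) \<otimes> w" using w p_sum[OF x] by simp
    also have "\<dots> = (\<Oplus>a\<in>T. p x a \<otimes> w)"
      using x w finite_T by (intro finsum_ldistr) auto
    finally show ?thesis .
  qed
  have "p x a \<otimes> z = p x a \<otimes> z'" if "a \<in> T" for a
    using eq[OF that] p_unsatisfied[OF x that] z by (cases "satisfies S x a") auto
  then have "(\<Oplus>a\<in>T. p x a \<otimes> z) = (\<Oplus>a\<in>T. p x a \<otimes> z')"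
    using x z by (intro finsum_cong') auto
  then show ?thesis using expand[OF z(1)] expand[OF z(2)] by simp
qed

text \<open>At a variable where \<open>a\<close> and \<open>b\<close> differ,
  \<open>a\<^sub>i p\<^sub>a p\<^sub>b = p\<^sub>a u\<^sub>i p\<^sub>b = b\<^sub>i p\<^sub>a p\<^sub>b\<close>.\<close>

lemma p_orthogonal:
  assumes x: "x \<in> X" and a: "a \<in> T" "satisfies S x a" and b: "b \<in> T" "satisfies S x b" and "a \<noteq> b"
  shows "p x a \<otimes> p x b = \<zero>"
proof -
  have on: "a \<in> tuples_on (vars S x)" "b \<in> tuples_on (vars S x)"
    using satisfying_tuple a b by blast+
  then obtain i where i: "i \<in> vars S x" "sign_at a i \<noteq> sign_at b i"
    using tuples_on_eqI \<open>a \<noteq> b\<close> by metis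
  have c: "p x a \<in> carrier A" "p x b \<in> carrier A" "u i \<in> carrier A"
    using x a b u_properties(1) vars_subset[OF x] i by auto
  have "scal A (sign_at a i) (p x a \<otimes> p x b) = p x a \<otimes> u i \<otimes> p x b"
    using c p_eigen(1)[OF x a i(1)] by simp
  also have "\<dots> = p x a \<otimes> (u i \<otimes> p x b)" using c by (simp add: m_assoc)
  also have "\<dots> = scal A (sign_at b i) (p x a \<otimes> p x b)"
    using c p_eigen(2)[OF x b i(1)] by simp
  finally show ?thesis using c i(2) by (intro eq_zero_if_scal_eq) auto
qed

lemma operator_solution: "operator_solution S A u (scal A (-1) \<one>)"
proof (intro operator_solution.intro operator_solution_axioms.intro)
  show "constraint_system S" "complex_star_algebra A" by unfold_locales
  show "u i \<otimes> u j = u j \<otimes> u i" if x: "x \<in> X" and i: "i \<in> vars S x" and j: "j \<in> vars S x" for x i j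
  proof (rule p_separates[OF x])
    have c: "u i \<in> carrier A" "u j \<in> carrier A" using u_properties(1) vars_subset[OF x] i j by auto
    then show "u i \<otimes> u j \<in> carrier A" "u j \<otimes> u i \<in> carrier A" by auto
    fix a assume a: "a \<in> T" "satisfies S x a"
    have "p x a \<otimes> u k \<otimes> u l = scal A (sign_at a k * sign_at a l) (p x a)"
      if "k \<in> vars S x" "l \<in> vars S x" "u l \<in> carrier A" for k l
      using p_eigen(1)[OF x a that(1)] p_eigen(1)[OF x a that(2)] that(3) x a by simp
    then show "p x a \<otimes> (u i \<otimes> u j) = p x a \<otimes> (u j \<otimes> u i)"
      using i j c x a by (simp add: mult.commute flip: m_assoc)
  qed
  show "list_product A (replicate (parity S x) (scal A (-1) \<one>) @ map u (sorted_list_of_set (vars S x))) = \<one>"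
    if x: "x \<in> X" for x
  proof (rule p_separates[OF x])
    let ?us = "map u (sorted_list_of_set (vars S x))"
    let ?Js = "replicate (parity S x) (scal A (-1) \<one>)"
    show "list_product A (?Js @ ?us) \<in> carrier A"
      using finite_vars[OF x] u_closed_vars[OF x] by (intro list_product_closed) auto
    fix a assume a: "a \<in> T" "satisfies S x a"
    have pc: "p x a \<in> carrier A" using x a by simp
    have "a \<in> tuples_on (vars S x)" using satisfying_tuple a by blast
    then have sign: "(-1) ^ parity S x * (\<Prod>i\<in>vars S x. sign_at a i) = 1"
      using satisfies_iff[OF x] a(2) by simp
    have "p x a \<otimes> list_product A (?Js @ ?us) =
        scal A ((-1) ^ parity S x * (\<Prod>i\<leftarrow>sorted_list_of_set (vars S x). sign_at a i)) (p x a)"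
      using pc finite_vars[OF x] u_closed_vars[OF x] p_eigen(1)[OF x a]
      by (intro constraint_product_eigen) auto
    also have "\<dots> = p x a"
      using pc sign finite_vars[OF x] by (simp flip: prod.distinct_set_conv_list)
    finally show "p x a \<otimes> list_product A (?Js @ ?us) = p x a \<otimes> \<one>" using pc by simp
  qed simp
qed (use u_properties in \<open>auto simp: adj_scal\<close>)

sublocale sol: operator_solution S A u "scal A (-1) \<one>"
  by (rule operator_solution)

text \<open>Alice's projections are recovered from Bob's observables: tested against \<open>p\<^sub>b\<close>, both sides give
  \<open>p\<^sub>b\<close> if \<open>b = a\<close> and \<open>0\<close> otherwise.\<close>

lemma p_eq_value: assumes x: "x \<in> X" and a: "a \<in> T" shows "p x a = sol.value_on (vars S x) a"
proof (cases "dom a = vars S x")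
  case False
  then show ?thesis using p_unsatisfied[OF x a] by (auto simp: sol.value_on_def satisfies_def)
next
  case True
  then have on: "a \<in> tuples_on (vars S x)" using sign_tuple_on_dom[OF a] by simp
  interpret commuting_involutions A u "vars S x" by (rule sol.involutions[OF x])
  have "p x a = E a"
  proof (rule p_separates[OF x])
    fix b assume b: "b \<in> T" "satisfies S x b"
    have on_b: "b \<in> tuples_on (vars S x)" using satisfying_tuple b by blast
    have pc: "p x b \<in> carrier A" using x b by simp
    have "p x b \<otimes> E a = scal A (\<Prod>i\<leftarrow>sorted_list_of_set (vars S x). (1 + sign_at a i * sign_at b i) / 2) (p x b)"
      using pc fin p_eigen(1)[OF x b] by (intro joint_eigen) auto
    then have E: "p x b \<otimes> E a = scal A (\<Prod>i\<in>vars S x. (1 + sign_at a i * sign_at b i) / 2) (p x b)"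
      using fin by (simp flip: prod.distinct_set_conv_list)
    show "p x b \<otimes> p x a = p x b \<otimes> E a"
    proof (cases "a = b")
      case True
      have "sign_at a i * sign_at b i = 1" if "i \<in> vars S x" for i
        using True sign_at_cases[OF on that] by auto
      then have "(\<Prod>i\<in>vars S x. (1 + sign_at a i * sign_at b i) / 2) = 1"
        by (intro prod.neutral) simp
      then show ?thesis using E pc True projectionD(2)[OF p_projection[OF x a]] by simp
    next
      case False
      then obtain i where i: "i \<in> vars S x" "sign_at a i \<noteq> sign_at b i"
        using tuples_on_eqI[OF on on_b] by metis
      then have "1 + sign_at a i * sign_at b i = 0"
        using sign_at_cases[OF on i(1)] sign_at_cases[OF on_b i(1)] by auto
      then have "(\<Prod>i\<in>vars S x. (1 + sign_at a i * sign_at b i) / 2) = 0"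
        using i(1) fin by (intro prod_zero) auto
      moreover have "p x b \<otimes> p x a = \<zero>"
        using False p_orthogonal[OF x b a] p_unsatisfied[OF x a] pc by (cases "satisfies S x a") auto
      ultimately show ?thesis using E pc by simp
    qed
  qed (use x a in auto)
  then show ?thesis using True by (simp add: sol.value_on_def)
qed

lemma q_eq_value: assumes y: "y \<in> {1..n}" and b: "b \<in> T" shows "q y b = sol.value_on {y} b"
proof (cases "dom b = {y}")
  case False
  then show ?thesis using q_wrong_domain[OF y b] by (simp add: sol.value_on_def)
next
  case True
  then have "b \<in> {[y \<mapsto> 1], [y \<mapsto> -1]}"
    using sign_tuple_on_dom[OF b] tuples_on_singleton[of y] by simp
  then show ?thesis
    using True u_properties(1)[OF y] q_half[OF y]
    by (auto simp: sol.value_on_def joint_simps sign_at_def)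
qed

end

section \<open>Cutting down by a central projection\<close>

lemma (in complex_star_algebra) central_annihilator_star_ideal:
  assumes e: "e \<in> carrier A" "adj A e = e" and central: "\<And>a. a \<in> carrier A \<Longrightarrow> e \<otimes> a = a \<otimes> e"
  shows "ideal {a \<in> carrier A. e \<otimes> a = \<zero>} A"
    and "a \<in> carrier A \<Longrightarrow> e \<otimes> a = \<zero> \<Longrightarrow> e \<otimes> adj A a = \<zero>"
proof -
  have sub: "subgroup {a \<in> carrier A. e \<otimes> a = \<zero>} (add_monoid A)"
    by (rule add.subgroupI) (use e in \<open>auto simp: r_distr r_minus intro: exI[of _ \<zero>]\<close>)
  show "ideal {a \<in> carrier A. e \<otimes> a = \<zero>} A"
  proof (rule idealI[OF ring_axioms sub])
    fix a x assume "a \<in> {a \<in> carrier A. e \<otimes> a = \<zero>}" and x: "x \<in> carrier A"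
    then have a: "a \<in> carrier A" "e \<otimes> a = \<zero>" by auto
    have "e \<otimes> (x \<otimes> a) = (e \<otimes> x) \<otimes> a" using e(1) a(1) x by (simp only: m_assoc)
    also have "\<dots> = x \<otimes> (e \<otimes> a)" unfolding central[OF x] using e(1) a(1) x by (simp only: m_assoc)
    finally have "e \<otimes> (x \<otimes> a) = x \<otimes> (e \<otimes> a)" .
    then show "x \<otimes> a \<in> {a \<in> carrier A. e \<otimes> a = \<zero>}" using a x by simp
    have "e \<otimes> (a \<otimes> x) = (e \<otimes> a) \<otimes> x" using e(1) a(1) x by (simp only: m_assoc)
    then show "a \<otimes> x \<in> {a \<in> carrier A. e \<otimes> a = \<zero>}" using a x by simp
  qed
  show "e \<otimes> adj A a = \<zero>" if a: "a \<in> carrier A" "e \<otimes> a = \<zero>"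
  proof -
    have "e \<otimes> adj A a = adj A a \<otimes> e" using a by (intro central) simp
    also have "\<dots> = adj A (e \<otimes> a)" using a(1) e by (simp add: adj_mult)
    finally show ?thesis using a(2) by simp
  qed
qed

text \<open>The annihilator of \<open>e\<close> is closed, because multiplication by \<open>e\<close> is continuous and the norm is
  definite, and it contains \<open>z\<close>. Conversely \<open>a = (1 - e) a = c z a\<close> for \<open>a\<close> in the annihilator,
  so the closure adds nothing to the ideal generated by \<open>z\<close>.\<close>

lemma (in cstar_seminormed_algebra) closed_ideal_generated_central:
  assumes definite: "\<And>a. a \<in> carrier A \<Longrightarrow> nrm A a = 0 \<Longrightarrow> a = \<zero>"
    and e: "e \<in> carrier A" "adj A e = e" and central: "\<And>a. a \<in> carrier A \<Longrightarrow> e \<otimes> a = a \<otimes> e"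
    and z: "z \<in> carrier A" "e \<otimes> z = \<zero>" "\<one> \<ominus> e = scal A c z"
  shows "closed_ideal_generated A {z} = {a \<in> carrier A. e \<otimes> a = \<zero>}"
proof (rule subset_antisym; rule subsetI)
  let ?K = "{a \<in> carrier A. e \<otimes> a = \<zero>}"
  have "norm_closed A ?K"
    unfolding norm_closed_def
  proof (intro ballI impI)
    fix a assume a: "a \<in> carrier A" and approx: "\<forall>\<epsilon>>0. \<exists>k\<in>?K. nrm A (a \<ominus> k) < \<epsilon>"
    have "nrm A (e \<otimes> a) \<le> \<epsilon>" if "\<epsilon> > 0" for \<epsilon>
    proof -
      have ne: "0 \<le> nrm A e" using e by simp
      then have "0 < \<epsilon> / (nrm A e + 1)" using that by simp
      then obtain k where k: "k \<in> carrier A" "e \<otimes> k = \<zero>" "nrm A (a \<ominus> k) < \<epsilon> / (nrm A e + 1)"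
        using approx by blast
      have "e \<otimes> a = e \<otimes> (a \<ominus> k)" using a k e by (simp add: mult_minus_distrib)
      then have "nrm A (e \<otimes> a) \<le> nrm A e * nrm A (a \<ominus> k)" using submult[of e "a \<ominus> k"] a k e by simp
      also have "\<dots> \<le> (nrm A e + 1) * (\<epsilon> / (nrm A e + 1))"
        using k a ne by (intro mult_mono) auto
      also have "\<dots> = \<epsilon>" using ne by simp
      finally show ?thesis .
    qed
    then have "nrm A (e \<otimes> a) \<le> 0" by (meson dense not_le)
    then have "e \<otimes> a = \<zero>" using a e by (intro definite antisym) simp_all
    with a show "a \<in> ?K" by simp
  qed
  moreover have "ideal ?K A" by (rule central_annihilator_star_ideal(1)[OF e central])
  moreover have "{z} \<subseteq> ?K" using z by simp
  ultimately show "a \<in> ?K" if "a \<in> closed_ideal_generated A {z}" for a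
    using that unfolding closed_ideal_generated_def by blast
next
  fix a assume "a \<in> {a \<in> carrier A. e \<otimes> a = \<zero>}"
  then have a: "a \<in> carrier A" "e \<otimes> a = \<zero>" by auto
  have "a = (\<one> \<ominus> e) \<otimes> a" using a e by (simp add: minus_mult_distrib)
  also have "\<dots> = z \<otimes> scal A c a" using a z by simp
  finally have az: "a = z \<otimes> scal A c a" .
  have "a \<in> I" if "ideal I A" "{z} \<subseteq> I" for I
    using ideal.I_r_closed[OF that(1), of z "scal A c a"] that(2) a(1) az by simp
  then show "a \<in> closed_ideal_generated A {z}" unfolding closed_ideal_generated_def by blast
qed

text \<open>The map \<open>\<eta> f = e \<phi>(f)\<close> is an isometric *-homomorphism from \<open>F\<close> onto the corner \<open>e A\<close>, except
  that it sends \<open>1\<close> to \<open>e\<close>. Applied termwise it maps Cauchy sequences to Cauchy sequences, and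
  modulo the closed ideal generated by \<open>z\<close>, which is the annihilator of \<open>e\<close>, it becomes unital and
  surjective. By isometry, its kernel consists of the null sequences.\<close>

lemma completion_iso_quotient_by_central:
  fixes F :: "'a star_algebra" and A :: "'b star_algebra"
  assumes \<sigma>: "cstar_seminormed F \<sigma>" and \<tau>: "cstar_seminormed A \<tau>" and \<phi>: "star_hom F A \<phi>"
    and e: "e \<in> carrier A" "e \<otimes>\<^bsub>A\<^esub> e = e" "adj A e = e"
    and central: "\<And>a. a \<in> carrier A \<Longrightarrow> e \<otimes>\<^bsub>A\<^esub> a = a \<otimes>\<^bsub>A\<^esub> e"
    and isometry: "\<And>f. f \<in> carrier F \<Longrightarrow> \<sigma> f = \<tau> (e \<otimes>\<^bsub>A\<^esub> \<phi> f)"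
    and onto: "\<And>a. a \<in> carrier A \<Longrightarrow> \<exists>f\<in>carrier F. e \<otimes>\<^bsub>A\<^esub> \<phi> f = e \<otimes>\<^bsub>A\<^esub> a"
    and z: "z \<in> carrier A" "e \<otimes>\<^bsub>A\<^esub> z = \<zero>\<^bsub>A\<^esub>" "\<one>\<^bsub>A\<^esub> \<ominus>\<^bsub>A\<^esub> e = scal A c z"
  shows "star_isomorphic (completion F \<sigma>) (star_quotient (completion A \<tau>)
    (closed_ideal_generated (completion A \<tau>) {to_completion A \<tau> z}))"
proof -
  let ?C = "completion A \<tau>" and ?SF = "cauchy_algebra F \<sigma>" and ?SA = "cauchy_algebra A \<tau>"
  interpret F: cstar_completion F \<sigma> by (rule cstar_completion.intro[OF \<sigma>])
  interpret A: cstar_completion A \<tau> by (rule cstar_completion.intro[OF \<tau>])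
  interpret C: cstar_seminormed_algebra ?C by (rule A.completion_seminormed)
  interpret \<phi>: star_algebra_hom F A \<phi> by unfold_locales (rule \<phi>)
  interpret \<iota>: star_algebra_hom A ?C "to_completion A \<tau>"
    by unfold_locales (rule A.to_completion_hom)

  define \<kappa> where "\<kappa> t = A.C.null +>\<^bsub>?SA\<^esub> t" for t
  have \<kappa>_hom: "star_hom ?SA ?C \<kappa>"
    unfolding A.completion_eq \<kappa>_def by (rule star_ideal.coset_hom[OF A.C.null_star_ideal])
  note \<kappa> = star_homD[OF \<kappa>_hom]
  have \<kappa>_zero: "\<kappa> t = \<zero>\<^bsub>?C\<^esub> \<longleftrightarrow> t \<in> A.C.null" if "t \<in> carrier ?SA" for t
    unfolding A.completion_eq star_quotient_simps \<kappa>_def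
    by (rule star_ideal.coset_zero_iff[OF A.C.null_star_ideal that])
  have \<kappa>_onto: "\<exists>t\<in>carrier ?SA. x = \<kappa> t" if "x \<in> carrier ?C" for x
    using that unfolding A.completion_eq star_ideal.coset_carrier[OF A.C.null_star_ideal] \<kappa>_def by blast

  define E where "E = to_completion A \<tau> e"
  have E: "E \<in> carrier ?C" "E \<otimes>\<^bsub>?C\<^esub> E = E" "adj ?C E = E"
    unfolding E_def \<iota>.hom_simps(2)[OF e(1) e(1), symmetric] \<iota>.hom_simps(6)[OF e(1), symmetric] e(2,3)
    using \<iota>.hom_simps(1)[OF e(1)] by simp_all
  have E_\<kappa>: "E = \<kappa> (\<lambda>n. e)"
    by (simp add: E_def to_completion_def A.null_sequences_eq \<kappa>_def)
  have e_seq: "(\<lambda>n. e) \<in> carrier ?SA" by (rule A.cauchy_const[OF e(1)])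
  have E_mult: "E \<otimes>\<^bsub>?C\<^esub> \<kappa> t = \<kappa> (\<lambda>n. e \<otimes>\<^bsub>A\<^esub> t n)" if "t \<in> carrier ?SA" for t
    unfolding E_\<kappa> using \<kappa>(2)[OF e_seq that] by (simp only: A.cauchy_simps)
  have E_central: "E \<otimes>\<^bsub>?C\<^esub> x = x \<otimes>\<^bsub>?C\<^esub> E" if x: "x \<in> carrier ?C" for x
  proof -
    obtain t where t: "t \<in> carrier ?SA" "x = \<kappa> t" using \<kappa>_onto[OF x] by blast
    have "x \<otimes>\<^bsub>?C\<^esub> E = \<kappa> (\<lambda>n. t n \<otimes>\<^bsub>A\<^esub> e)"
      unfolding E_\<kappa> t(2) using \<kappa>(2)[OF t(1) e_seq] by (simp only: A.cauchy_simps)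
    then show ?thesis using E_mult[OF t(1)] t(2) central[OF A.cauchy_mem[OF t(1)]] by simp
  qed
  define I where "I = closed_ideal_generated ?C {to_completion A \<tau> z}"
  have I_eq: "I = {x \<in> carrier ?C. E \<otimes>\<^bsub>?C\<^esub> x = \<zero>\<^bsub>?C\<^esub>}"
    unfolding I_def
  proof (rule C.closed_ideal_generated_central[OF A.completion_definite E(1,3) E_central])
    show "to_completion A \<tau> z \<in> carrier ?C" using z by (simp add: \<iota>.hom_simps)
    show "E \<otimes>\<^bsub>?C\<^esub> to_completion A \<tau> z = \<zero>\<^bsub>?C\<^esub>"
      unfolding E_def \<iota>.hom_simps(2)[OF e(1) z(1), symmetric] z(2) by (rule \<iota>.hom_zero)
    show "\<one>\<^bsub>?C\<^esub> \<ominus>\<^bsub>?C\<^esub> E = scal ?C c (to_completion A \<tau> z)"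
      unfolding E_def \<iota>.hom_simps(4)[symmetric] \<iota>.hom_simps(5)[OF z(1), symmetric] z(3)[symmetric]
      by (rule \<iota>.hom_minus[symmetric]) (simp_all add: e)
  qed
  have I_ideal: "star_ideal ?C I"
    unfolding I_eq
    by (intro star_ideal.intro star_ideal_axioms.intro C.complex_star_algebra_axioms
        C.central_annihilator_star_ideal(1)[OF E(1,3) E_central])
      (auto simp: C.central_annihilator_star_ideal(2)[OF E(1,3) E_central])
  let ?Q = "star_quotient ?C I"
  define \<pi> where "\<pi> x = I +>\<^bsub>?C\<^esub> x" for x
  have \<pi>_hom: "star_hom ?C ?Q \<pi>" unfolding \<pi>_def by (rule star_ideal.coset_hom[OF I_ideal])
  note \<pi> = star_homD[OF \<pi>_hom]
  \<comment> \<open>Cosets of the annihilator are determined by their image in the corner.\<close>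
  have \<pi>_eq: "\<pi> x = \<pi> y \<longleftrightarrow> E \<otimes>\<^bsub>?C\<^esub> x = E \<otimes>\<^bsub>?C\<^esub> y" if "x \<in> carrier ?C" "y \<in> carrier ?C" for x y
  proof -
    have "\<pi> x = \<pi> y \<longleftrightarrow> x \<ominus>\<^bsub>?C\<^esub> y \<in> I"
      unfolding \<pi>_def by (rule star_ideal.coset_eq_iff[OF I_ideal that])
    also have "\<dots> \<longleftrightarrow> E \<otimes>\<^bsub>?C\<^esub> x \<ominus>\<^bsub>?C\<^esub> E \<otimes>\<^bsub>?C\<^esub> y = \<zero>\<^bsub>?C\<^esub>"
      unfolding I_eq using that C.mult_minus_distrib[OF E(1) that] by simp
    finally show ?thesis using that E by (simp add: C.minus_eq_zero_iff)
  qed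
  have \<pi>_zero: "\<pi> x = \<zero>\<^bsub>?Q\<^esub> \<longleftrightarrow> E \<otimes>\<^bsub>?C\<^esub> x = \<zero>\<^bsub>?C\<^esub>" if "x \<in> carrier ?C" for x
    unfolding \<pi>_def star_quotient_simps star_ideal.coset_zero_iff[OF I_ideal that]
    unfolding I_eq using that by simp

  define \<eta> where "\<eta> f = e \<otimes>\<^bsub>A\<^esub> \<phi> f" for f
  have \<eta>_closed: "\<eta> f \<in> carrier A" if "f \<in> carrier F" for f
    using that e by (simp add: \<eta>_def \<phi>.hom_simps)
  have ee: "e \<otimes>\<^bsub>A\<^esub> \<eta> f = \<eta> f" if "f \<in> carrier F" for f
    using that e by (simp add: \<eta>_def \<phi>.hom_simps flip: A.m_assoc)
  have \<eta>_mult: "\<eta> (f \<otimes>\<^bsub>F\<^esub> g) = \<eta> f \<otimes>\<^bsub>A\<^esub> \<eta> g" if "f \<in> carrier F" "g \<in> carrier F" for f g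
  proof -
    have c: "\<phi> f \<in> carrier A" "\<phi> g \<in> carrier A" using that by (simp_all add: \<phi>.hom_simps)
    have "\<eta> f \<otimes>\<^bsub>A\<^esub> \<eta> g = (e \<otimes>\<^bsub>A\<^esub> \<phi> f) \<otimes>\<^bsub>A\<^esub> e \<otimes>\<^bsub>A\<^esub> \<phi> g"
      using c e(1) by (simp add: \<eta>_def A.m_assoc)
    also have "(e \<otimes>\<^bsub>A\<^esub> \<phi> f) \<otimes>\<^bsub>A\<^esub> e = e \<otimes>\<^bsub>A\<^esub> \<phi> f"
      using ee[OF that(1)] central[of "e \<otimes>\<^bsub>A\<^esub> \<phi> f"] c e(1) by (simp add: \<eta>_def)
    finally show ?thesis using that c e(1) by (simp add: \<eta>_def \<phi>.hom_simps A.m_assoc)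
  qed
  have \<eta>_add: "\<eta> (f \<oplus>\<^bsub>F\<^esub> g) = \<eta> f \<oplus>\<^bsub>A\<^esub> \<eta> g" if "f \<in> carrier F" "g \<in> carrier F" for f g
    using that e(1) by (simp add: \<eta>_def \<phi>.hom_simps A.r_distr)
  have \<eta>_minus: "\<eta> (f \<ominus>\<^bsub>F\<^esub> g) = \<eta> f \<ominus>\<^bsub>A\<^esub> \<eta> g" if "f \<in> carrier F" "g \<in> carrier F" for f g
    using that e(1) by (simp add: \<eta>_def \<phi>.hom_minus \<phi>.hom_simps A.mult_minus_distrib)
  have \<eta>_scal: "\<eta> (scal F d f) = scal A d (\<eta> f)" if "f \<in> carrier F" for f d
    using that e(1) by (simp add: \<eta>_def \<phi>.hom_simps)
  have \<eta>_adj: "\<eta> (adj F f) = adj A (\<eta> f)" if "f \<in> carrier F" for f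
    using that e(1,3) central[of "adj A (\<phi> f)"] by (simp add: \<eta>_def \<phi>.hom_simps A.adj_mult)
  have \<eta>_iso: "\<tau> (\<eta> f) = \<sigma> f" if "f \<in> carrier F" for f
    using isometry[OF that] by (simp add: \<eta>_def)

  define seq where "seq s = (\<lambda>n::nat. \<eta> (s n))" for s
  have seq_closed: "seq s \<in> carrier ?SA" if s: "s \<in> carrier ?SF" for s
  proof -
    note mem = F.cauchy_mem[OF s]
    have "\<tau> (seq s m \<ominus>\<^bsub>A\<^esub> seq s n) = \<sigma> (s m \<ominus>\<^bsub>F\<^esub> s n)" for m n
      unfolding seq_def using mem \<eta>_minus[OF mem mem] \<eta>_iso[of "s m \<ominus>\<^bsub>F\<^esub> s n"] by simp
    moreover have "seq s m \<in> carrier A" for m unfolding seq_def by (rule \<eta>_closed[OF mem])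
    ultimately show ?thesis using s unfolding A.cauchy_iff F.cauchy_iff by simp
  qed
  define \<Phi> where "\<Phi> s = \<pi> (\<kappa> (seq s))" for s
  have E_seq: "E \<otimes>\<^bsub>?C\<^esub> \<kappa> (seq s) = \<kappa> (seq s)" if s: "s \<in> carrier ?SF" for s
    unfolding E_mult[OF seq_closed[OF s]] by (simp only: seq_def ee[OF F.cauchy_mem[OF s]])
  have \<Phi>_hom: "star_hom ?SF ?Q \<Phi>"
  proof (rule star_homI)
    fix s t assume s: "s \<in> carrier ?SF" and t: "t \<in> carrier ?SF"
    note s' = seq_closed[OF s] \<kappa>(1)[OF seq_closed[OF s]] and t' = seq_closed[OF t] \<kappa>(1)[OF seq_closed[OF t]]
    note mem = F.cauchy_mem[OF s] F.cauchy_mem[OF t]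
    show "\<Phi> s \<in> carrier ?Q" unfolding \<Phi>_def by (rule \<pi>(1)[OF s'(2)])
    have "seq (s \<otimes>\<^bsub>?SF\<^esub> t) = seq s \<otimes>\<^bsub>?SA\<^esub> seq t"
      unfolding seq_def F.cauchy_simps A.cauchy_simps \<eta>_mult[OF mem] ..
    then show "\<Phi> (s \<otimes>\<^bsub>?SF\<^esub> t) = \<Phi> s \<otimes>\<^bsub>?Q\<^esub> \<Phi> t"
      unfolding \<Phi>_def by (simp only: \<kappa>(2)[OF s'(1) t'(1)] \<pi>(2)[OF s'(2) t'(2)])
    have "seq (s \<oplus>\<^bsub>?SF\<^esub> t) = seq s \<oplus>\<^bsub>?SA\<^esub> seq t"
      unfolding seq_def F.cauchy_simps A.cauchy_simps \<eta>_add[OF mem] ..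
    then show "\<Phi> (s \<oplus>\<^bsub>?SF\<^esub> t) = \<Phi> s \<oplus>\<^bsub>?Q\<^esub> \<Phi> t"
      unfolding \<Phi>_def by (simp only: \<kappa>(3)[OF s'(1) t'(1)] \<pi>(3)[OF s'(2) t'(2)])
    fix d
    have "seq (scal ?SF d s) = scal ?SA d (seq s)"
      unfolding seq_def F.cauchy_simps A.cauchy_simps \<eta>_scal[OF mem(1)] ..
    then show "\<Phi> (scal ?SF d s) = scal ?Q d (\<Phi> s)"
      unfolding \<Phi>_def by (simp only: \<kappa>(5)[OF s'(1)] \<pi>(5)[OF s'(2)])
    have "seq (adj ?SF s) = adj ?SA (seq s)"
      unfolding seq_def F.cauchy_simps A.cauchy_simps \<eta>_adj[OF mem(1)] ..
    then show "\<Phi> (adj ?SF s) = adj ?Q (\<Phi> s)"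
      unfolding \<Phi>_def by (simp only: \<kappa>(6)[OF s'(1)] \<pi>(6)[OF s'(2)])
  next
    have "seq \<one>\<^bsub>?SF\<^esub> = (\<lambda>n. e)"
      unfolding seq_def F.cauchy_simps \<eta>_def using e by (simp add: \<phi>.hom_simps)
    then have "\<Phi> \<one>\<^bsub>?SF\<^esub> = \<pi> E" unfolding \<Phi>_def E_\<kappa> by simp
    also have "\<dots> = \<pi> \<one>\<^bsub>?C\<^esub>" using E by (subst \<pi>_eq) simp_all
    finally show "\<Phi> \<one>\<^bsub>?SF\<^esub> = \<one>\<^bsub>?Q\<^esub>" using \<pi>(4) by simp
  qed
  have kernel: "\<Phi> s = \<zero>\<^bsub>?Q\<^esub> \<longleftrightarrow> s \<in> F.C.null" if s: "s \<in> carrier ?SF" for s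
  proof -
    have "\<Phi> s = \<zero>\<^bsub>?Q\<^esub> \<longleftrightarrow> seq s \<in> null_sequences A \<tau>"
      unfolding \<Phi>_def \<pi>_zero[OF \<kappa>(1)[OF seq_closed[OF s]]] E_seq[OF s] \<kappa>_zero[OF seq_closed[OF s]]
        A.null_sequences_eq ..
    also have "\<dots> \<longleftrightarrow> s \<in> null_sequences F \<sigma>"
      using F.cauchy_mem[OF s] \<eta>_iso[OF F.cauchy_mem[OF s]] \<eta>_closed[OF F.cauchy_mem[OF s]]
      by (simp add: null_sequences_def seq_def)
    finally show ?thesis unfolding F.null_sequences_eq .
  qed
  have surj: "\<Phi> ` carrier ?SF = carrier ?Q"
  proof (rule subset_antisym; rule subsetI)
    fix y assume "y \<in> carrier ?Q"
    then obtain x where x: "x \<in> carrier ?C" "y = \<pi> x"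
      unfolding star_ideal.coset_carrier[OF I_ideal] \<pi>_def by blast
    obtain t where t: "t \<in> carrier ?SA" "x = \<kappa> t" using \<kappa>_onto[OF x(1)] by blast
    note mem = A.cauchy_mem[OF t(1)]
    \<comment> \<open>Lift \<open>t\<close> termwise; by isometry the lifts form a Cauchy sequence, like \<open>e t\<close>.\<close>
    have "\<forall>n. \<exists>f. f \<in> carrier F \<and> \<eta> f = e \<otimes>\<^bsub>A\<^esub> t n" using onto[OF mem] unfolding \<eta>_def by blast
    then obtain s where s: "\<And>n. s n \<in> carrier F" "\<And>n. \<eta> (s n) = e \<otimes>\<^bsub>A\<^esub> t n" by metis
    have et: "(\<lambda>n. e \<otimes>\<^bsub>A\<^esub> t n) \<in> carrier ?SA"
      using A.cauchy_mult[OF e_seq t(1)] .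
    have "\<sigma> (s m \<ominus>\<^bsub>F\<^esub> s n) = \<tau> (e \<otimes>\<^bsub>A\<^esub> t m \<ominus>\<^bsub>A\<^esub> e \<otimes>\<^bsub>A\<^esub> t n)" for m n
      using \<eta>_minus[OF s(1) s(1), of m n] \<eta>_iso[OF F.minus_closed[OF s(1) s(1)], of m n]
      by (simp only: s(2))
    then have s_closed: "s \<in> carrier ?SF" using et s(1) unfolding A.cauchy_iff F.cauchy_iff by simp
    have seq_s: "seq s = (\<lambda>n. e \<otimes>\<^bsub>A\<^esub> t n)" unfolding seq_def s(2) ..
    have "\<kappa> (seq s) = E \<otimes>\<^bsub>?C\<^esub> x" unfolding seq_s t(2) E_mult[OF t(1)] ..
    moreover have "E \<otimes>\<^bsub>?C\<^esub> (E \<otimes>\<^bsub>?C\<^esub> x) = E \<otimes>\<^bsub>?C\<^esub> x"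
      using E x(1) by (simp flip: C.m_assoc)
    ultimately have "\<Phi> s = y"
      unfolding \<Phi>_def x(2) using E(1) x(1) by (subst \<pi>_eq) simp_all
    then show "y \<in> \<Phi> ` carrier ?SF" using s_closed by blast
  qed (use star_homD(1)[OF \<Phi>_hom] in auto)
  show ?thesis
    unfolding F.completion_eq I_def[symmetric]
    by (rule star_isomorphic_of_surj[OF F.C.null_star_ideal
        star_ideal.quotient_star_algebra[OF I_ideal] \<Phi>_hom surj kernel])
qed

section \<open>The group algebra of the solution group\<close>

context operator_solution
begin

definition sol_value :: "sol_gen \<Rightarrow> 'a" where
  "sol_value g = (case g of UGen i \<Rightarrow> u i | JGen \<Rightarrow> J)"

lemma sol_value_properties: assumes "g \<in> sol_gens S"
  shows "sol_value g \<in> carrier A" "adj A (sol_value g) = sol_value g" "sol_value g \<otimes> sol_value g = \<one>"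
  using assms u_adj u_square J_adj J_square u_closed by (auto simp: sol_value_def sol_gens_def)

lemma letter_sol_value: "g \<in> sol_gens S \<Longrightarrow> letter_value A sol_value (g, b) = sol_value g"
  by (simp add: letter_value_def sol_value_properties)

lemma sol_presentation_valuation:
  "presentation_valuation A (sol_gens S) sol_value (sol_relations S)"
proof (intro presentation_valuation.intro presentation_valuation_axioms.intro
    word_valuation.intro word_valuation_axioms.intro complex_star_algebra_axioms)
  fix l r assume lr: "(l, r) \<in> sol_relations S"
  have U: "UGen i \<in> sol_gens S" if "i \<in> {1..n}" for i using that by (simp add: sol_gens_def)
  have JG: "JGen \<in> sol_gens S" by (simp add: sol_gens_def)
  have wu: "letter_value A sol_value (UGen i, True) = u i" if "i \<in> {1..n}" for i
    using letter_sol_value[OF U[OF that]] by (simp add: sol_value_def)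
  have wJ: "letter_value A sol_value (JGen, True) = J"
    using letter_sol_value[OF JG] by (simp add: sol_value_def)
  from lr consider
      i where "i \<in> {1..n}" "l = [(UGen i, True), (UGen i, True)]" "r = []"
    | "l = [(JGen, True), (JGen, True)]" "r = []"
    | i where "i \<in> {1..n}" "l = [(JGen, True), (UGen i, True)]" "r = [(UGen i, True), (JGen, True)]"
    | i j x where "x \<in> X" "i \<in> vars S x" "j \<in> vars S x"
        "l = [(UGen i, True), (UGen j, True)]" "r = [(UGen j, True), (UGen i, True)]"
    | x where "x \<in> X" "r = []"
        "l = replicate (parity S x) (JGen, True) @
          map (\<lambda>i. (UGen i, True)) (sorted_list_of_set (vars S x))"
    unfolding sol_relations_def Let_def by blast
  then show "word_value A sol_value l = word_value A sol_value r"
  proof cases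
    case 1
    then show ?thesis using u_square[of i] u_closed[of i] wu[of i] by (simp add: word_value_def)
  next
    case 2
    then show ?thesis using J_square wJ by (simp add: word_value_def)
  next
    case 3
    then show ?thesis using J_commute[of i] u_closed[of i] wu[of i] wJ by (simp add: word_value_def)
  next
    case 4
    then have ij: "i \<in> {1..n}" "j \<in> {1..n}" using vars_subset by blast+
    then show ?thesis using 4 u_commute[of x i j] u_closed[of i] u_closed[of j] wu[of i] wu[of j]
      by (simp add: word_value_def)
  next
    case 5
    have "map (letter_value A sol_value) l =
        replicate (parity S x) J @ map u (sorted_list_of_set (vars S x))"
      using 5 wJ wu vars_subset[OF 5(1)] finite_vars[OF 5(1)] by (auto simp: subset_iff)
    then show ?thesis using constraint[OF 5(1)] 5(2) by (simp add: word_value_def)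
  qed
qed (use sol_value_properties in auto)

end

context constraint_system
begin

abbreviation \<Gamma> where "\<Gamma> \<equiv> solution_group S"
abbreviation cls where "cls \<equiv> word_class (sol_gens S) (sol_relations S)"
abbreviation U where "U i \<equiv> basis_element (cls [(UGen i, True)])"
abbreviation JJ where "JJ \<equiv> basis_element (sol_J S)"

lemma group_\<Gamma>: "group \<Gamma>"
  unfolding solution_group_def by (rule presented_group_group)

end

sublocale constraint_system \<subseteq> G: star_monoid "solution_group S" "m_inv (solution_group S)"
  by (rule star_monoid_group[OF group_\<Gamma>])

context constraint_system
begin

lemma group_algebra_eq: "group_algebra \<Gamma> = G.\<A>"
  by (simp add: group_algebra_def)

lemma cls_carrier: "w \<in> words (sol_gens S) \<Longrightarrow> cls w \<in> carrier \<Gamma>"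
  by (simp add: solution_group_def presented_group_carrier)

lemma gens_mem: "JGen \<in> sol_gens S" "i \<in> {1..n} \<Longrightarrow> UGen i \<in> sol_gens S"
  by (simp_all add: sol_gens_def)

lemma cls_mult: "v \<in> words (sol_gens S) \<Longrightarrow> w \<in> words (sol_gens S) \<Longrightarrow>
    cls v \<otimes>\<^bsub>\<Gamma>\<^esub> cls w = cls (v @ w)"
  unfolding solution_group_def by (rule word_class_mult)

lemma cls_one: "\<one>\<^bsub>\<Gamma>\<^esub> = cls []"
  unfolding solution_group_def by (rule presented_group_one)

lemma basis_cls_mult: "v \<in> words (sol_gens S) \<Longrightarrow> w \<in> words (sol_gens S) \<Longrightarrow>
    basis_element (cls v) \<otimes>\<^bsub>G.\<A>\<^esub> basis_element (cls w) = basis_element (cls (v @ w))"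
  by (simp add: G.basis_mult cls_mult)

lemma basis_cls_one: "basis_element (cls []) = \<one>\<^bsub>G.\<A>\<^esub>"
  by (simp add: G.operations(1) cls_one)

text \<open>The word congruence relates \<open>v @ l @ w\<close> and \<open>v @ r @ w\<close>; here \<open>v = w = []\<close>.\<close>

lemma cls_relation:
  "(l, r) \<in> sol_relations S \<Longrightarrow> l \<in> words (sol_gens S) \<Longrightarrow> r \<in> words (sol_gens S) \<Longrightarrow> cls l = cls r"
  using word_congruence.relation[of "[]" "sol_gens S" "[]" l r "sol_relations S"]
  by (simp add: word_class_eq_iff)

lemma basis_cls_product: "w \<in> words (sol_gens S) \<Longrightarrow>
    list_product G.\<A> (map (\<lambda>l. basis_element (cls [l])) w) = basis_element (cls w)"
proof (induction w)
  case (Cons l w)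
  then show ?case using basis_cls_mult[of "[l]" w] by simp
qed (simp add: basis_cls_one)

lemma cls_involution:
  assumes "g \<in> sol_gens S"
  shows "cls [(g, True), (g, True)] = cls []" "cls [(g, False)] = cls [(g, True)]"
proof -
  have "([(g, True), (g, True)], []) \<in> sol_relations S"
    using assms by (auto simp: sol_gens_def sol_relations_def Let_def)
  then show *: "cls [(g, True), (g, True)] = cls []" using assms by (intro cls_relation) auto
  interpret group \<Gamma> by (rule group_\<Gamma>)
  have "inv\<^bsub>\<Gamma>\<^esub> (cls [(g, True)]) = cls [(g, True)]"
  proof (rule inv_equality)
    show "cls [(g, True)] \<otimes>\<^bsub>\<Gamma>\<^esub> cls [(g, True)] = \<one>\<^bsub>\<Gamma>\<^esub>"
      using assms * by (simp add: solution_group_def word_class_mult presented_group_one)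
  qed (use assms in \<open>auto simp: cls_carrier\<close>)
  moreover have "inv\<^bsub>\<Gamma>\<^esub> (cls [(g, True)]) = cls [(g, False)]"
    using word_class_inv[of "[(g, True)]" "sol_gens S" "sol_relations S"] assms
    by (simp add: solution_group_def)
  ultimately show "cls [(g, False)] = cls [(g, True)]" by simp
qed

lemma basis_cls_involution:
  assumes "g \<in> sol_gens S"
  shows "basis_element (cls [(g, True)]) \<in> carrier G.\<A>"
    and "adj G.\<A> (basis_element (cls [(g, True)])) = basis_element (cls [(g, True)])"
    and "basis_element (cls [(g, True)]) \<otimes>\<^bsub>G.\<A>\<^esub> basis_element (cls [(g, True)]) = \<one>\<^bsub>G.\<A>\<^esub>"
proof -
  have w: "[(g, True)] \<in> words (sol_gens S)" using assms by simp
  show "basis_element (cls [(g, True)]) \<in> carrier G.\<A>" using cls_carrier[OF w] by simp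
  have "inv\<^bsub>\<Gamma>\<^esub> (cls [(g, True)]) = cls [(g, False)]"
    using word_class_inv[OF w] by (simp add: solution_group_def)
  then show "adj G.\<A> (basis_element (cls [(g, True)])) = basis_element (cls [(g, True)])"
    using cls_carrier[OF w] cls_involution(2)[OF assms] by (simp add: G.basis_adj)
  show "basis_element (cls [(g, True)]) \<otimes>\<^bsub>G.\<A>\<^esub> basis_element (cls [(g, True)]) = \<one>\<^bsub>G.\<A>\<^esub>"
    using basis_cls_mult[OF w w] cls_involution(1)[OF assms] by (simp add: basis_cls_one)
qed

text \<open>The group algebra carries the universal solution.\<close>

lemma group_algebra_solution: "operator_solution S G.\<A> U JJ"
proof (intro operator_solution.intro operator_solution_axioms.intro G.monoid_star_algebra
    constraint_system_axioms)
  have swap: "basis_element (cls [(g, True)]) \<otimes>\<^bsub>G.\<A>\<^esub> basis_element (cls [(h, True)]) =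
      basis_element (cls [(h, True)]) \<otimes>\<^bsub>G.\<A>\<^esub> basis_element (cls [(g, True)])"
    if "g \<in> sol_gens S" "h \<in> sol_gens S"
      "([(g, True), (h, True)], [(h, True), (g, True)]) \<in> sol_relations S" for g h
    using that cls_relation[OF that(3)] by (simp add: basis_cls_mult)
  show "JJ \<otimes>\<^bsub>G.\<A>\<^esub> U i = U i \<otimes>\<^bsub>G.\<A>\<^esub> JJ" if "i \<in> {1..n}" for i
    unfolding sol_J_def using that
    by (intro swap gens_mem) (auto simp: sol_relations_def Let_def)
  show "U i \<otimes>\<^bsub>G.\<A>\<^esub> U j = U j \<otimes>\<^bsub>G.\<A>\<^esub> U i" if x: "x \<in> X" "i \<in> vars S x" "j \<in> vars S x" for x i j
  proof -
    have "i \<in> {1..n}" "j \<in> {1..n}" using x vars_subset by blast+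
    then show ?thesis using x
      by (intro swap gens_mem) (auto simp: sol_relations_def Let_def)
  qed
  show "list_product G.\<A> (replicate (parity S x) JJ @ map U (sorted_list_of_set (vars S x))) = \<one>\<^bsub>G.\<A>\<^esub>"
    if x: "x \<in> X" for x
  proof -
    let ?w = "replicate (parity S x) (JGen, True) @
      map (\<lambda>i. (UGen i, True)) (sorted_list_of_set (vars S x))"
    have "UGen i \<in> sol_gens S" if "i \<in> vars S x" for i
      using that vars_subset[OF x] by (intro gens_mem) blast
    then have w: "?w \<in> words (sol_gens S)"
      using gens_mem(1) finite_vars[OF x] by (auto simp: words_def)
    have "(?w, []) \<in> sol_relations S"
      using x unfolding sol_relations_def Let_def by blast
    then have "cls ?w = cls []" using w by (intro cls_relation) auto
    then show ?thesis
      using basis_cls_product[OF w] by (simp add: basis_cls_one sol_J_def comp_def)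
  qed
qed (use basis_cls_involution[OF gens_mem(2)] basis_cls_involution[OF gens_mem(1)] in \<open>auto simp: sol_J_def\<close>)

end

section \<open>The free *-algebra of the game\<close>

context constraint_system
begin

abbreviation \<G> where "\<G> \<equiv> lcs_game S"
abbreviation gens where "gens \<equiv> game_gens \<G>"
abbreviation F where "F \<equiv> game_free_algebra \<G>"

lemma gens_iff: "g \<in> gens \<longleftrightarrow>
    (\<exists>x a. g = PGen x a \<and> x \<in> X \<and> a \<in> T) \<or> (\<exists>y b. g = QGen y b \<and> y \<in> {1..n} \<and> b \<in> T)"
  by (auto simp: game_gens_def lcs_game_def)

end

sublocale constraint_system \<subseteq> W: star_monoid "word_monoid (game_gens (lcs_game S))" reverse_word
  by (rule star_monoid_words)

context constraint_system
begin

lemma F_eq: "F = W.\<A>"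
  by (simp add: game_free_algebra_def free_star_algebra_def)

lemma F_star_algebra: "complex_star_algebra F"
  unfolding F_eq by (rule W.monoid_star_algebra)

lemma generator_closed: "g \<in> gens \<Longrightarrow> generator g \<in> carrier F"
  by (simp add: F_eq generator_def)

lemma relator_cases [consumes 1, case_names square self_adj p_sum q_sum losing]:
  assumes "r \<in> game_relators \<G>"
  obtains g where "g \<in> gens" "r = generator g \<otimes>\<^bsub>F\<^esub> generator g \<ominus>\<^bsub>F\<^esub> generator g"
    | g where "g \<in> gens" "r = adj F (generator g) \<ominus>\<^bsub>F\<^esub> generator g"
    | x where "x \<in> X" "r = (\<Oplus>\<^bsub>F\<^esub>a\<in>T. generator (PGen x a)) \<ominus>\<^bsub>F\<^esub> \<one>\<^bsub>F\<^esub>"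
    | y where "y \<in> {1..n}" "r = (\<Oplus>\<^bsub>F\<^esub>b\<in>T. generator (QGen y b)) \<ominus>\<^bsub>F\<^esub> \<one>\<^bsub>F\<^esub>"
    | x y a b where "x \<in> X" "y \<in> {1..n}" "a \<in> T" "b \<in> T" "\<not> lcs_wins S x y a b"
        "r = generator (PGen x a) \<otimes>\<^bsub>F\<^esub> generator (QGen y b)"
  using assms unfolding game_relators_def Let_def Un_iff mem_Collect_eq lcs_game_def game.simps
  by (elim disjE exE conjE) metis+

lemma relators:
  "g \<in> gens \<Longrightarrow> generator g \<otimes>\<^bsub>F\<^esub> generator g \<ominus>\<^bsub>F\<^esub> generator g \<in> game_relators \<G>"
  "g \<in> gens \<Longrightarrow> adj F (generator g) \<ominus>\<^bsub>F\<^esub> generator g \<in> game_relators \<G>"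
  "x \<in> X \<Longrightarrow> (\<Oplus>\<^bsub>F\<^esub>a\<in>T. generator (PGen x a)) \<ominus>\<^bsub>F\<^esub> \<one>\<^bsub>F\<^esub> \<in> game_relators \<G>"
  "y \<in> {1..n} \<Longrightarrow> (\<Oplus>\<^bsub>F\<^esub>b\<in>T. generator (QGen y b)) \<ominus>\<^bsub>F\<^esub> \<one>\<^bsub>F\<^esub> \<in> game_relators \<G>"
  "x \<in> X \<Longrightarrow> y \<in> {1..n} \<Longrightarrow> a \<in> T \<Longrightarrow> b \<in> T \<Longrightarrow> \<not> lcs_wins S x y a b \<Longrightarrow>
    generator (PGen x a) \<otimes>\<^bsub>F\<^esub> generator (QGen y b) \<in> game_relators \<G>"
  unfolding game_relators_def Let_def
  by (blast, blast, auto simp: lcs_game_def)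

lemma F_universal: "universal_cstar_data F (game_relators \<G>)"
  using free_algebra_universal[of gens "game_relators \<G>"] relators(1,2)
  by (simp add: game_free_algebra_def)

lemma game_representation_of_hom:
  fixes B :: "('b, 'n) star_algebra_scheme"
  assumes "complex_star_algebra B" and h: "star_hom F B h"
    and kills: "\<And>r. r \<in> game_relators \<G> \<Longrightarrow> h r = \<zero>\<^bsub>B\<^esub>"
  shows "game_representation S B (\<lambda>x a. h (generator (PGen x a))) (\<lambda>y b. h (generator (QGen y b)))"
proof -
  interpret F: complex_star_algebra F by (rule F_star_algebra)
  interpret B: complex_star_algebra B by fact
  interpret h: star_algebra_hom F B h by unfold_locales (rule h)
  have eq: "h a = h b" if "a \<ominus>\<^bsub>F\<^esub> b \<in> game_relators \<G>" "a \<in> carrier F" "b \<in> carrier F" for a b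
    using kills[OF that(1)] that(2,3) h.hom_simps(1) by (simp add: h.hom_minus B.minus_eq_zero_iff)
  have proj: "B.projection (h (generator g))" if "g \<in> gens" for g
  proof -
    note c = generator_closed[OF that]
    have "h (generator g \<otimes>\<^bsub>F\<^esub> generator g) = h (generator g)" "h (adj F (generator g)) = h (generator g)"
      using relators(1,2)[OF that] c by (auto intro!: eq)
    then show ?thesis using c by (simp add: B.projection_def h.hom_simps)
  qed
  have sums: "(\<Oplus>\<^bsub>B\<^esub>i\<in>K. h (f i)) = \<one>\<^bsub>B\<^esub>"
    if "(\<Oplus>\<^bsub>F\<^esub>i\<in>K. f i) \<ominus>\<^bsub>F\<^esub> \<one>\<^bsub>F\<^esub> \<in> game_relators \<G>" "\<And>i. i \<in> K \<Longrightarrow> f i \<in> carrier F" for K and f :: "(nat \<rightharpoonup> int) \<Rightarrow> _"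
  proof -
    have "h (\<Oplus>\<^bsub>F\<^esub>i\<in>K. f i) = h \<one>\<^bsub>F\<^esub>" using that by (intro eq F.finsum_closed) auto
    then show ?thesis using that(2) by (simp add: h.hom_finsum h.hom_simps)
  qed
  show ?thesis
  proof (intro game_representation.intro game_representation_axioms.intro
      constraint_system_axioms B.complex_star_algebra_axioms)
    show "h (generator (PGen x a)) \<otimes>\<^bsub>B\<^esub> h (generator (QGen y b)) = \<zero>\<^bsub>B\<^esub>"
      if "x \<in> X" "y \<in> {1..n}" "a \<in> T" "b \<in> T" "\<not> lcs_wins S x y a b" for x y a b
      using kills[OF relators(5)[OF that]] that
      by (subst h.hom_simps(2)[symmetric]) (auto intro!: generator_closed simp: gens_iff)
    show "B.projection (h (generator (PGen x a)))" if "x \<in> X" "a \<in> T" for x a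
      using that by (intro proj) (simp add: gens_iff)
    show "B.projection (h (generator (QGen y b)))" if "y \<in> {1..n}" "b \<in> T" for y b
      using that by (intro proj) (simp add: gens_iff)
  next
    fix x assume x: "x \<in> X"
    show "(\<Oplus>\<^bsub>B\<^esub>a\<in>T. h (generator (PGen x a))) = \<one>\<^bsub>B\<^esub>"
      using x by (intro sums[OF relators(3)] generator_closed) (auto simp: gens_iff)
  next
    fix y assume y: "y \<in> {1..n}"
    show "(\<Oplus>\<^bsub>B\<^esub>b\<in>T. h (generator (QGen y b))) = \<one>\<^bsub>B\<^esub>"
      using y by (intro sums[OF relators(4)] generator_closed) (auto simp: gens_iff)
  qed
qed

lemma star_hom_free_eqI:
  fixes B :: "('b, 'n) star_algebra_scheme"
  assumes "complex_star_algebra B" and h: "star_hom F B h" and h': "star_hom F B h'"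
    and gen: "\<And>g. g \<in> gens \<Longrightarrow> h (generator g) = h' (generator g)" and f: "f \<in> carrier F"
  shows "h f = h' f"
proof -
  interpret F: complex_star_algebra F by (rule F_star_algebra)
  note hs = star_homD[OF h] and hs' = star_homD[OF h']
  have basis_Cons: "basis_element (l # w) = basis_element [l] \<otimes>\<^bsub>F\<^esub> basis_element w" for l w
    by (simp add: F_eq W.basis_mult)
  have letter: "h (basis_element [l]) = h' (basis_element [l])" if "fst l \<in> gens" for l
  proof (cases "snd l")
    case True
    then show ?thesis using gen[OF that] by (cases l) (simp add: generator_def)
  next
    case False
    then have "basis_element [l] = adj F (generator (fst l))"
      using that by (cases l) (simp add: generator_def F_eq W.basis_adj)
    then show ?thesis using gen[OF that] generator_closed[OF that] by (simp add: hs(6) hs'(6))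
  qed
  have "h (basis_element w) = h' (basis_element w)" if "w \<in> words gens" for w
    using that
  proof (induction w)
    case Nil
    have "basis_element [] = \<one>\<^bsub>F\<^esub>" by (simp add: F_eq W.operations(1))
    then show ?case by (simp add: hs(4) hs'(4))
  next
    case (Cons l w)
    have c: "basis_element [l] \<in> carrier F" "basis_element w \<in> carrier F"
      using Cons.prems by (simp_all add: F_eq)
    have "h (basis_element w) = h' (basis_element w)" using Cons by simp
    then show ?case
      unfolding basis_Cons[of l w] hs(2)[OF c] hs'(2)[OF c] using letter[of l] Cons.prems by simp
  qed
  then show ?thesis
    by (intro W.star_hom_eqI[OF assms(1) h[unfolded F_eq] h'[unfolded F_eq] _ f[unfolded F_eq]]) simp
qed

end

context operator_solution
begin

lemma game_value_simps: "game_value (PGen x a) = value_on (vars S x) a"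
  "game_value (QGen y b) = value_on {y} b"
  by (simp_all add: game_value_def)

lemma game_value_projection: "g \<in> gens \<Longrightarrow> projection (game_value g)"
  using value_on_projection[OF involutions] value_on_projection[OF single_involution]
  by (auto simp: gens_iff game_value_def)

lemma game_word_valuation: "word_valuation A gens game_value"
  by unfold_locales (use game_value_projection in \<open>auto simp: projection_def\<close>)

definition game_hom :: "(('x, nat, nat \<rightharpoonup> int, nat \<rightharpoonup> int) game_gen word \<Rightarrow> complex) \<Rightarrow> 'a" where
  "game_hom = monoid_representation.extension A (word_value A game_value)"

lemma game_hom: "star_hom F A game_hom"
  and game_hom_generator: "g \<in> gens \<Longrightarrow> game_hom (generator g) = game_value g"
proof -
  interpret word_valuation A gens game_value by (rule game_word_valuation)
  interpret E: monoid_representation "word_monoid gens" reverse_word A "word_value A game_value"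
    by (rule word_representation)
  show "star_hom F A game_hom" unfolding F_eq game_hom_def by (rule E.extension_star_hom)
  show "game_hom (generator g) = game_value g" if "g \<in> gens"
    using that E.extension_basis[of "[(g, True)]"] by (simp add: game_hom_def generator_def word_value_letter)
qed

text \<open>All relators but those of losing answers vanish already under the homomorphism itself. A losing
  pair fails because Alice violates her constraint, which is where the factor \<open>e\<close> enters,
  because Bob's answer has the wrong index set, or because the answers disagree.\<close>

lemma game_hom_relator:
  assumes "r \<in> game_relators \<G>"
  shows "e \<otimes> game_hom r = \<zero>"
proof -
  interpret F: complex_star_algebra F by (rule F_star_algebra)
  interpret h: star_algebra_hom F A game_hom by unfold_locales (rule game_hom)
  note gv = game_value_projection[unfolded projection_def]
  have sum: "e \<otimes> game_hom ((\<Oplus>\<^bsub>F\<^esub>a\<in>T. generator (g a)) \<ominus>\<^bsub>F\<^esub> \<one>\<^bsub>F\<^esub>) = \<zero>"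
    if g: "\<And>a. a \<in> T \<Longrightarrow> g a \<in> gens" "\<And>a. game_value (g a) = value_on V a"
      and V: "commuting_involutions A u V" "V \<subseteq> {1..n}" for g V
  proof -
    have c: "value_on V a \<in> carrier A" if "a \<in> T" for a
      using gv[OF g(1)[OF that]] by (simp add: g(2))
    have "game_hom (\<Oplus>\<^bsub>F\<^esub>a\<in>T. generator (g a)) = (\<Oplus>a\<in>T. game_hom (generator (g a)))"
      using g generator_closed by (intro h.hom_finsum) blast
    also have "\<dots> = (\<Oplus>a\<in>T. value_on V a)"
      by (rule finsum_cong') (use c in \<open>auto simp: game_hom_generator[OF g(1)] g(2)\<close>)
    also have "\<dots> = \<one>" by (rule value_on_sum[OF V])
    finally have one: "game_hom (\<Oplus>\<^bsub>F\<^esub>a\<in>T. generator (g a)) = \<one>" .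
    have "(\<Oplus>\<^bsub>F\<^esub>a\<in>T. generator (g a)) \<in> carrier F"
      using g generator_closed by (intro F.finsum_closed) blast
    then show ?thesis by (simp add: h.hom_minus one h.hom_simps(4) minus_self)
  qed
  from assms show ?thesis
  proof (cases rule: relator_cases)
    case (square g)
    then show ?thesis using gv[OF square(1)] generator_closed[OF square(1)]
      by (simp add: h.hom_minus h.hom_simps game_hom_generator minus_self)
  next
    case (self_adj g)
    then show ?thesis using gv[OF self_adj(1)] generator_closed[OF self_adj(1)]
      by (simp add: h.hom_minus h.hom_simps game_hom_generator minus_self)
  next
    case (p_sum x)
    then show ?thesis
      by (auto simp: game_value_simps gens_iff intro!: sum[OF _ _ involutions vars_subset])
  next
    case (q_sum y)
    then show ?thesis
      by (auto simp: game_value_simps gens_iff intro!: sum[OF _ _ single_involution])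
  next
    case (losing x y a b)
    have g: "PGen x a \<in> gens" "QGen y b \<in> gens" using losing by (simp_all add: gens_iff)
    have c: "value_on (vars S x) a \<in> carrier A" "value_on {y} b \<in> carrier A"
      using gv[OF g(1)] gv[OF g(2)] by (simp_all add: game_value_simps)
    have "game_hom r = value_on (vars S x) a \<otimes> value_on {y} b"
      unfolding losing(6) h.hom_simps(2)[OF generator_closed[OF g(1)] generator_closed[OF g(2)]]
        game_hom_generator[OF g(1)] game_hom_generator[OF g(2)] by (simp only: game_value_simps)
    moreover have "e \<otimes> (value_on (vars S x) a \<otimes> value_on {y} b) = \<zero>"
    proof (cases "satisfies S x a")
      case False
      then show ?thesis using value_on_unsatisfied[OF losing(1,3)] c by (simp flip: m_assoc)
    next
      case True
      then have "dom b \<noteq> {y} \<or> (dom b = {y} \<and> y \<in> vars S x \<and> a y \<noteq> b y)"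
        using losing(5) by (auto simp: lcs_wins_def)
      then have "value_on (vars S x) a \<otimes> value_on {y} b = \<zero>"
      proof
        assume "dom b \<noteq> {y}"
        then show ?thesis using c by (simp add: value_on_def)
      qed (use value_on_disagree[OF losing(1) _ losing(3,4)] in blast)
      then show ?thesis by simp
    qed
    ultimately show ?thesis by simp
  qed
qed

end

section \<open>The isomorphism\<close>

context star_algebra_hom
begin

lemma hom_half: "u \<in> carrier A \<Longrightarrow> h (A.half s u) = B.half s (h u)"
  by (simp add: A.half_def B.half_def hom_simps)

lemma hom_list_product: "set as \<subseteq> carrier A \<Longrightarrow> h (list_product A as) = list_product B (map h as)"
  by (induction as) (simp_all add: hom_simps A.list_product_closed)

lemma hom_joint:
  assumes "\<And>i. i \<in> set is \<Longrightarrow> u i \<in> carrier A \<and> h (u i) = v i"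
  shows "h (A.joint u is a) = B.joint v is a"
proof -
  have "h (A.joint u is a) = list_product B (map h (map (\<lambda>i. A.half (sign_at a i) (u i)) is))"
    unfolding A.joint_def using assms by (intro hom_list_product) auto
  also have "map h (map (\<lambda>i. A.half (sign_at a i) (u i)) is) = map (\<lambda>i. B.half (sign_at a i) (v i)) is"
    using assms by (simp add: hom_half)
  finally show ?thesis by (simp add: B.joint_def)
qed

end

context constraint_system
begin

lemma U_letters:
  assumes "fst l \<in> sol_gens S"
  shows "basis_element (cls [l]) = JJ \<or> (\<exists>i\<in>{1..n}. basis_element (cls [l]) = U i)"
proof -
  have "cls [l] = cls [(fst l, True)]"
    using cls_involution(2)[OF assms] by (cases l; cases "snd l") auto
  then show ?thesis using assms by (auto simp: sol_gens_def sol_J_def)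
qed

end

sublocale constraint_system \<subseteq> sol: operator_solution S "monoid_algebra (solution_group S) (m_inv (solution_group S))"
    "\<lambda>i. basis_element (word_class (sol_gens S) (sol_relations S) [(UGen i, True)])" "basis_element (sol_J S)"
  by (rule group_algebra_solution)

context constraint_system
begin

text \<open>\<open>J\<close> and the \<open>u\<^sub>i\<close> generate the group algebra as an algebra: inverse letters add nothing because
  the generators are involutions.\<close>

lemma subalgebra_induct [consumes 1, case_names J U one mult add scal]:
  assumes "a \<in> carrier G.\<A>"
    and J: "P JJ" and U: "\<And>i. i \<in> {1..n} \<Longrightarrow> P (U i)" and one: "P \<one>\<^bsub>G.\<A>\<^esub>"
    and mult: "\<And>a b. a \<in> carrier G.\<A> \<Longrightarrow> b \<in> carrier G.\<A> \<Longrightarrow> P a \<Longrightarrow> P b \<Longrightarrow> P (a \<otimes>\<^bsub>G.\<A>\<^esub> b)"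
    and add: "\<And>a b. a \<in> carrier G.\<A> \<Longrightarrow> b \<in> carrier G.\<A> \<Longrightarrow> P a \<Longrightarrow> P b \<Longrightarrow> P (a \<oplus>\<^bsub>G.\<A>\<^esub> b)"
    and scal: "\<And>a c. a \<in> carrier G.\<A> \<Longrightarrow> P a \<Longrightarrow> P (scal G.\<A> c a)"
  shows "P a"
proof -
  have word: "P (basis_element (cls w))" if "w \<in> words (sol_gens S)" for w
    using that
  proof (induction w)
    case Nil
    then show ?case using one by (simp only: basis_cls_one)
  next
    case (Cons l w)
    then have l: "fst l \<in> sol_gens S" and lw: "[l] \<in> words (sol_gens S)" "w \<in> words (sol_gens S)" by auto
    have "P (basis_element (cls [l]))" using U_letters[OF l] J U by auto
    then have "P (basis_element (cls [l]) \<otimes>\<^bsub>G.\<A>\<^esub> basis_element (cls w))"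
      using Cons.IH[OF lw(2)] cls_carrier[OF lw(1)] cls_carrier[OF lw(2)] by (intro mult) auto
    then show ?case using basis_cls_mult[OF lw] by simp
  qed
  have basis: "P (basis_element m)" if m: "m \<in> carrier \<Gamma>" for m
  proof -
    obtain w where "w \<in> words (sol_gens S)" "m = cls w"
      using m unfolding solution_group_def presented_group_carrier by blast
    then show ?thesis using word by simp
  qed
  show ?thesis
    using assms(1)
  proof (induction a rule: G.span_induct)
    case zero
    have "P (scal G.\<A> 0 \<one>\<^bsub>G.\<A>\<^esub>)" using one by (intro scal) simp_all
    then show ?case by simp
  next
    case (add c m f)
    show ?case
      using add.hyps add.IH basis[OF add.hyps(1)] by (intro assms(6) scal) (simp_all add: G.closed)
  qed
qed

lemma JJ_central: "a \<in> carrier G.\<A> \<Longrightarrow> JJ \<otimes>\<^bsub>G.\<A>\<^esub> a = a \<otimes>\<^bsub>G.\<A>\<^esub> JJ"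
proof (induction a rule: subalgebra_induct)
  case (mult a b)
  have "JJ \<otimes>\<^bsub>G.\<A>\<^esub> (a \<otimes>\<^bsub>G.\<A>\<^esub> b) = (JJ \<otimes>\<^bsub>G.\<A>\<^esub> a) \<otimes>\<^bsub>G.\<A>\<^esub> b"
    using mult.hyps by (simp add: sol.m_assoc)
  also have "\<dots> = a \<otimes>\<^bsub>G.\<A>\<^esub> (JJ \<otimes>\<^bsub>G.\<A>\<^esub> b)" unfolding mult.IH(1) using mult.hyps by (simp add: sol.m_assoc)
  also have "\<dots> = a \<otimes>\<^bsub>G.\<A>\<^esub> b \<otimes>\<^bsub>G.\<A>\<^esub> JJ" unfolding mult.IH(2) using mult.hyps by (simp add: sol.m_assoc)
  finally show ?case .
next
  case (add a b)
  then show ?case by (simp add: sol.l_distr sol.r_distr)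
qed (simp_all add: sol.J_commute del: atLeastAtMost_iff)

lemma e_central: "a \<in> carrier G.\<A> \<Longrightarrow> sol.e \<otimes>\<^bsub>G.\<A>\<^esub> a = a \<otimes>\<^bsub>G.\<A>\<^esub> sol.e"
  unfolding sol.e_def using JJ_central[of a] by (intro sol.half_commute[symmetric]) simp_all

text \<open>By this lemma and the next, \<open>J + 1\<close> lies in the annihilator of \<open>e\<close> and generates it.\<close>

lemma e_annihilates: "sol.e \<otimes>\<^bsub>G.\<A>\<^esub> (JJ \<oplus>\<^bsub>G.\<A>\<^esub> \<one>\<^bsub>G.\<A>\<^esub>) = \<zero>\<^bsub>G.\<A>\<^esub>"
  using sol.e_J by (simp add: sol.r_distr sol.scal_minus_1 sol.l_neg)

lemma one_minus_e: "\<one>\<^bsub>G.\<A>\<^esub> \<ominus>\<^bsub>G.\<A>\<^esub> sol.e = scal G.\<A> (1 / 2) (JJ \<oplus>\<^bsub>G.\<A>\<^esub> \<one>\<^bsub>G.\<A>\<^esub>)"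
proof -
  have "\<one>\<^bsub>G.\<A>\<^esub> \<ominus>\<^bsub>G.\<A>\<^esub> sol.e = (sol.e \<oplus>\<^bsub>G.\<A>\<^esub> sol.half 1 JJ) \<ominus>\<^bsub>G.\<A>\<^esub> sol.e"
    using sol.half_sum[OF sol.J_closed] by (simp add: sol.e_def sol.a_comm)
  also have "\<dots> = sol.half 1 JJ" by (rule sol.add_minus_cancel) simp_all
  finally show ?thesis by (simp add: sol.half_def sol.a_comm)
qed

abbreviation \<phi> where "\<phi> \<equiv> sol.game_hom"

text \<open>In the corner, \<open>J\<close> is hit by \<open>-1\<close> and \<open>u\<^sub>i\<close> by \<open>2 q\<^sub>i - 1\<close>, where \<open>q\<^sub>i\<close> is the generator of
  Bob's answer \<open>1\<close> to \<open>i\<close>.\<close>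

lemma game_hom_onto_corner:
  assumes "a \<in> carrier G.\<A>"
  shows "\<exists>f\<in>carrier F. sol.e \<otimes>\<^bsub>G.\<A>\<^esub> \<phi> f = sol.e \<otimes>\<^bsub>G.\<A>\<^esub> a"
proof -
  interpret F: complex_star_algebra F by (rule F_star_algebra)
  interpret \<phi>: star_algebra_hom F G.\<A> \<phi> by unfold_locales (rule sol.game_hom)
  from assms show ?thesis
  proof (induction a rule: subalgebra_induct)
    case J
    have "sol.e \<otimes>\<^bsub>G.\<A>\<^esub> \<phi> (scal F (-1) \<one>\<^bsub>F\<^esub>) = sol.e \<otimes>\<^bsub>G.\<A>\<^esub> JJ"
      by (simp add: \<phi>.hom_simps sol.e_J)
    then show ?case by (intro bexI[of _ "scal F (-1) \<one>\<^bsub>F\<^esub>"]) simp_all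
  next
    case (U i)
    let ?q = "generator (QGen i [i \<mapsto> 1])"
    have "[i \<mapsto> 1] \<in> T" using U tuples_on_subset[of "{i}"] tuples_on_singleton[of i] by auto
    then have g: "QGen i [i \<mapsto> 1] \<in> gens" using U by (simp add: gens_iff)
    note c = generator_closed[OF g]
    have Ui: "U i \<in> carrier G.\<A>" using U by (rule sol.u_closed)
    have "\<phi> ?q = sol.half 1 (U i)"
      using Ui by (simp add: sol.game_hom_generator[OF g] sol.game_value_simps sol.value_on_def
        sol.joint_simps sign_at_def)
    then have "\<phi> (scal F 2 ?q \<ominus>\<^bsub>F\<^esub> \<one>\<^bsub>F\<^esub>) = (\<one>\<^bsub>G.\<A>\<^esub> \<oplus>\<^bsub>G.\<A>\<^esub> U i) \<ominus>\<^bsub>G.\<A>\<^esub> \<one>\<^bsub>G.\<A>\<^esub>"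
      using c Ui by (simp add: \<phi>.hom_minus \<phi>.hom_simps sol.half_def)
    also have "\<dots> = U i" by (rule sol.add_minus_cancel) (simp_all add: Ui)
    finally show ?case using c by (intro bexI[of _ "scal F 2 ?q \<ominus>\<^bsub>F\<^esub> \<one>\<^bsub>F\<^esub>"]) simp_all
  next
    case one
    show ?case by (rule bexI[of _ "\<one>\<^bsub>F\<^esub>"]) (simp_all add: star_homD(4)[OF sol.game_hom])
  next
    case (mult a b)
    then obtain f g where f: "f \<in> carrier F" "sol.e \<otimes>\<^bsub>G.\<A>\<^esub> \<phi> f = sol.e \<otimes>\<^bsub>G.\<A>\<^esub> a"
      and g: "g \<in> carrier F" "sol.e \<otimes>\<^bsub>G.\<A>\<^esub> \<phi> g = sol.e \<otimes>\<^bsub>G.\<A>\<^esub> b" by blast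
    have c: "\<phi> f \<in> carrier G.\<A>" "\<phi> g \<in> carrier G.\<A>" using f g \<phi>.hom_simps(1) by auto
    have "sol.e \<otimes>\<^bsub>G.\<A>\<^esub> (\<phi> f \<otimes>\<^bsub>G.\<A>\<^esub> \<phi> g) = (sol.e \<otimes>\<^bsub>G.\<A>\<^esub> \<phi> f) \<otimes>\<^bsub>G.\<A>\<^esub> \<phi> g"
      using c by (simp only: sol.m_assoc sol.e_closed)
    also have "\<dots> = (a \<otimes>\<^bsub>G.\<A>\<^esub> sol.e) \<otimes>\<^bsub>G.\<A>\<^esub> \<phi> g" unfolding f(2) e_central[OF mult.hyps(1)] ..
    also have "\<dots> = a \<otimes>\<^bsub>G.\<A>\<^esub> (sol.e \<otimes>\<^bsub>G.\<A>\<^esub> b)" unfolding g(2)[symmetric]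
      using c mult.hyps by (simp only: sol.m_assoc sol.e_closed)
    also have "\<dots> = (a \<otimes>\<^bsub>G.\<A>\<^esub> sol.e) \<otimes>\<^bsub>G.\<A>\<^esub> b" using mult.hyps by (simp only: sol.m_assoc sol.e_closed)
    also have "\<dots> = sol.e \<otimes>\<^bsub>G.\<A>\<^esub> (a \<otimes>\<^bsub>G.\<A>\<^esub> b)" unfolding e_central[OF mult.hyps(1), symmetric]
      using mult.hyps by (simp only: sol.m_assoc sol.e_closed)
    finally show ?case
      using f(1) g(1) by (intro bexI[of _ "f \<otimes>\<^bsub>F\<^esub> g"]) (simp_all add: \<phi>.hom_simps)
  next
    case (add a b)
    then obtain f g where f: "f \<in> carrier F" "sol.e \<otimes>\<^bsub>G.\<A>\<^esub> \<phi> f = sol.e \<otimes>\<^bsub>G.\<A>\<^esub> a"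
      and g: "g \<in> carrier F" "sol.e \<otimes>\<^bsub>G.\<A>\<^esub> \<phi> g = sol.e \<otimes>\<^bsub>G.\<A>\<^esub> b" by blast
    then show ?case using add.hyps
      by (intro bexI[of _ "f \<oplus>\<^bsub>F\<^esub> g"]) (simp_all add: \<phi>.hom_simps sol.r_distr)
  next
    case (scal a c)
    then obtain f where f: "f \<in> carrier F" "sol.e \<otimes>\<^bsub>G.\<A>\<^esub> \<phi> f = sol.e \<otimes>\<^bsub>G.\<A>\<^esub> a" by blast
    then show ?case using scal.hyps
      by (intro bexI[of _ "scal F c f"]) (simp_all add: \<phi>.hom_simps)
  qed
qed

end

sublocale constraint_system \<subseteq> uF: universal_cstar_data "game_free_algebra (lcs_game S)" "game_relators (lcs_game S)"
  by (rule F_universal)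

context constraint_system
begin

lemma group_universal: "universal_cstar_data G.\<A> {}"
  using group_algebra_universal[OF group_\<Gamma>] by (simp add: group_algebra_eq)

abbreviation \<tau> where "\<tau> \<equiv> universal_seminorm G.\<A> {}"

lemma relators_closed: assumes "r \<in> game_relators \<G>" shows "r \<in> carrier F"
  using assms
proof (cases rule: relator_cases)
  case (square g)
  then show ?thesis using generator_closed by simp
next
  case (self_adj g)
  then show ?thesis using generator_closed by simp
next
  case (p_sum x)
  then show ?thesis using generator_closed
    by (auto simp: gens_iff intro!: uF.minus_closed uF.finsum_closed)
next
  case (q_sum y)
  then show ?thesis using generator_closed
    by (auto simp: gens_iff intro!: uF.minus_closed uF.finsum_closed)
next
  case (losing x y a b)
  then show ?thesis using generator_closed by (auto simp: gens_iff intro!: uF.m_closed)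
qed

text \<open>The right-hand side is the largest C*-seminorm that vanishes on the relators, and the left-hand
  side is another one.\<close>

lemma corner_seminorm_le: assumes f: "f \<in> carrier F" shows "\<tau> (sol.e \<otimes>\<^bsub>G.\<A>\<^esub> \<phi> f) \<le> uF.\<sigma> f"
proof -
  interpret uG: universal_cstar_data G.\<A> "{}" by (rule group_universal)
  interpret \<tau>: cstar_seminormed G.\<A> \<tau> by (rule uG.universal_seminormed)
  have "cstar_seminormed G.\<A> (\<lambda>a. \<tau> (sol.e \<otimes>\<^bsub>G.\<A>\<^esub> a))"
    using sol.projectionD[OF sol.e_projection] e_central by (intro \<tau>.corner)
  then have "cstar_seminormed F (\<lambda>f. \<tau> (sol.e \<otimes>\<^bsub>G.\<A>\<^esub> \<phi> f))"
    by (rule cstar_seminormed.pullback[OF _ F_star_algebra sol.game_hom])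
  then show ?thesis
    using f by (intro uF.le_universal) (simp_all add: sol.game_hom_relator)
qed

text \<open>The relations hold in the game C*-algebra, so they provide a solution with \<open>J = -1\<close> there, and
  hence a *-homomorphism \<open>\<psi>\<close> from the group algebra with \<open>\<psi>(e) = 1\<close>. As \<open>\<psi> \<circ> \<phi>\<close> agrees with the
  canonical map on generators, \<open>\<sigma> f = \<parallel>\<psi>(\<phi> f)\<parallel> = \<parallel>\<psi>(e \<phi>(f))\<parallel>\<close>, and the norm pulled back along
  \<open>\<psi>\<close> is one of the C*-seminorms whose supremum is \<open>\<tau>\<close>.\<close>

lemma seminorm_le_corner: assumes f: "f \<in> carrier F" shows "uF.\<sigma> f \<le> \<tau> (sol.e \<otimes>\<^bsub>G.\<A>\<^esub> \<phi> f)"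
proof -
  interpret uG: universal_cstar_data G.\<A> "{}" by (rule group_universal)
  interpret cF: cstar_completion F uF.\<sigma> by (rule cstar_completion.intro[OF uF.universal_seminormed])
  let ?B = "completion F uF.\<sigma>" and ?\<iota> = "to_completion F uF.\<sigma>"
  interpret B: cstar_seminormed_algebra ?B by (rule cF.completion_seminormed)
  have \<iota>_hom: "star_hom F ?B ?\<iota>" by (rule cF.to_completion_hom)
  note \<iota> = star_homD[OF \<iota>_hom]
  have kills: "?\<iota> r = \<zero>\<^bsub>?B\<^esub>" if r: "r \<in> game_relators \<G>" for r
    using relators_closed[OF r] uF.universal_vanishes[OF r] cF.nrm_to_completion[of r] \<iota>(1)[of r]
    by (intro cF.completion_definite) simp_all
  interpret rep: game_representation S ?B "\<lambda>x a. ?\<iota> (generator (PGen x a))" "\<lambda>y b. ?\<iota> (generator (QGen y b))"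
    by (rule game_representation_of_hom[OF B.complex_star_algebra_axioms \<iota>_hom kills])
  interpret val: presentation_valuation ?B "sol_gens S" rep.sol.sol_value "sol_relations S"
    by (rule rep.sol.sol_presentation_valuation)
  interpret ext: monoid_representation \<Gamma> "m_inv \<Gamma>" ?B val.class_value
    using val.class_representation by (simp only: solution_group_def)
  let ?\<psi> = ext.extension
  interpret \<psi>: star_algebra_hom G.\<A> ?B ?\<psi>
    by unfold_locales (rule ext.extension_star_hom)
  have \<psi>_gen: "?\<psi> (basis_element (cls [(g, True)])) = rep.sol.sol_value g" if "g \<in> sol_gens S" for g
    using that cls_carrier[of "[(g, True)]"]
    by (simp add: ext.extension_basis val.class_value_word_class val.word_value_letter)
  have \<psi>_U: "?\<psi> (U i) = rep.u i" if "i \<in> {1..n}" for i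
    using \<psi>_gen[OF gens_mem(2)[OF that]] by (simp add: rep.sol.sol_value_def)
  have \<psi>_J: "?\<psi> JJ = scal ?B (-1) \<one>\<^bsub>?B\<^esub>"
    using \<psi>_gen[OF gens_mem(1)] by (simp add: rep.sol.sol_value_def sol_J_def)
  have \<psi>_value: "?\<psi> (sol.value_on V a) = rep.sol.value_on V a" if V: "V \<subseteq> {1..n}" for V a
  proof -
    have "?\<psi> (sol.joint U (sorted_list_of_set V) a) = B.joint rep.u (sorted_list_of_set V) a"
    proof (rule \<psi>.hom_joint)
      fix i assume "i \<in> set (sorted_list_of_set V)"
      then have "i \<in> {1..n}" using V finite_subset[OF V] by auto
      then show "U i \<in> carrier G.\<A> \<and> ?\<psi> (U i) = rep.u i" using sol.u_closed \<psi>_U by blast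
    qed
    then show ?thesis by (simp add: sol.value_on_def rep.sol.value_on_def \<psi>.hom_zero)
  qed
  have gen: "?\<psi> (\<phi> (generator g)) = ?\<iota> (generator g)" if g: "g \<in> gens" for g
    using g unfolding gens_iff
  proof (elim disjE exE conjE)
    fix x a assume xa: "g = PGen x a" "x \<in> X" "a \<in> T"
    show ?thesis unfolding sol.game_hom_generator[OF g] unfolding xa(1) sol.game_value_simps
      using \<psi>_value[OF vars_subset[OF xa(2)]] rep.p_eq_value[OF xa(2,3)] by simp
  next
    fix y b assume yb: "g = QGen y b" "y \<in> {1..n}" "b \<in> T"
    then have "{y} \<subseteq> {1..n}" by blast
    then show ?thesis unfolding sol.game_hom_generator[OF g] unfolding yb(1) sol.game_value_simps
      using \<psi>_value rep.q_eq_value[OF yb(2,3)] by simp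
  qed
  have factor: "?\<psi> (\<phi> f) = ?\<iota> f"
    by (rule star_hom_free_eqI[OF B.complex_star_algebra_axioms
        star_hom_comp[OF sol.game_hom ext.extension_star_hom] \<iota>_hom gen f])
  have "?\<psi> sol.e = B.half (-1) (scal ?B (-1) \<one>\<^bsub>?B\<^esub>)"
    unfolding sol.e_def by (simp only: \<psi>.hom_half sol.J_closed \<psi>_J)
  also have "\<dots> = \<one>\<^bsub>?B\<^esub>"
    using B.half_eigen[of "\<one>\<^bsub>?B\<^esub>" "scal ?B (-1) \<one>\<^bsub>?B\<^esub>" "-1" "-1"] by simp
  finally have \<psi>_e: "?\<psi> sol.e = \<one>\<^bsub>?B\<^esub>" .
  have \<phi>f: "\<phi> f \<in> carrier G.\<A>" by (rule star_homD(1)[OF sol.game_hom f])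
  have "uF.\<sigma> f = nrm ?B (?\<psi> (sol.e \<otimes>\<^bsub>G.\<A>\<^esub> \<phi> f))"
    unfolding \<psi>.hom_simps(2)[OF sol.e_closed \<phi>f] \<psi>_e factor
    using cF.nrm_to_completion[OF f] \<iota>(1)[OF f] by simp
  also have "\<dots> \<le> \<tau> (sol.e \<otimes>\<^bsub>G.\<A>\<^esub> \<phi> f)"
  proof (rule uG.le_universal)
    show "(\<lambda>a. nrm ?B (?\<psi> a)) \<in> uG.\<S>"
      using B.pullback[OF G.monoid_star_algebra ext.extension_star_hom] by simp
  qed (use \<phi>f in simp)
  finally show ?thesis .
qed

lemma game_cstar_iso:
  "star_isomorphic (game_cstar \<G>)
     (star_quotient (group_cstar \<Gamma>)
       (closed_ideal_generated (group_cstar \<Gamma>)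
         {group_unitary \<Gamma> (sol_J S) \<oplus>\<^bsub>group_cstar \<Gamma>\<^esub> \<one>\<^bsub>group_cstar \<Gamma>\<^esub>}))"
proof -
  interpret uG: universal_cstar_data G.\<A> "{}" by (rule group_universal)
  interpret cG: cstar_completion G.\<A> \<tau> by (rule cstar_completion.intro[OF uG.universal_seminormed])
  let ?C = "completion G.\<A> \<tau>" and ?\<iota> = "to_completion G.\<A> \<tau>"
  have "star_isomorphic (completion F uF.\<sigma>)
      (star_quotient ?C (closed_ideal_generated ?C {?\<iota> (JJ \<oplus>\<^bsub>G.\<A>\<^esub> \<one>\<^bsub>G.\<A>\<^esub>)}))"
  proof (rule completion_iso_quotient_by_central[OF uF.universal_seminormed uG.universal_seminormed
        sol.game_hom sol.projectionD[OF sol.e_projection] e_central])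
    show "uF.\<sigma> f = \<tau> (sol.e \<otimes>\<^bsub>G.\<A>\<^esub> \<phi> f)" if "f \<in> carrier F" for f
      using corner_seminorm_le[OF that] seminorm_le_corner[OF that] by simp
  qed (simp_all add: game_hom_onto_corner e_annihilates one_minus_e)
  moreover have "?\<iota> (JJ \<oplus>\<^bsub>G.\<A>\<^esub> \<one>\<^bsub>G.\<A>\<^esub>) = ?\<iota> JJ \<oplus>\<^bsub>?C\<^esub> \<one>\<^bsub>?C\<^esub>"
    using star_homD(3,4)[OF cG.to_completion_hom] by simp
  ultimately show ?thesis
    by (simp add: game_cstar_def universal_cstar_def group_cstar_def group_unitary_def group_algebra_eq)
qed

end

theorem proposition4p10:
  fixes S :: "'x constraint_system"
  assumes "linear_bcs S"
  shows "star_isomorphic (game_cstar (lcs_game S))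
           (let \<Gamma> = solution_group S; A = group_cstar \<Gamma>
            in star_quotient A
                 (closed_ideal_generated A {group_unitary \<Gamma> (sol_J S) \<oplus>\<^bsub>A\<^esub> \<one>\<^bsub>A\<^esub>}))"
  unfolding Let_def by (rule constraint_system.game_cstar_iso) (rule constraint_system.intro[OF assms])

end
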